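(* Let $\Omega$ be a bounded, simply connected domain and $\psi$ a conformal map from $\mathbb D$ onto $\Omega$. Let $1\le p_0<2$ and set $q_0=\frac{p_0}{2-p_0}$. Suppose $|\psi'|^2\in\mathrm{B}_{q_0^+}(\mathbb D)$, $p_0<p<p_0'$, and \[\sigma\in\begin{cases}\mathrm{B}_p(\Omega),& p_0=1,\\ \mathrm{B}_{p/p_0}(\Omega)\cap\mathrm{RH}_{\frac{p_0'}{p_0'-p}}(\Omega),& p_0>1.\end{cases}\] Then the Bergman projection $\Pi_\Omega$ is bounded on $L^p(\Omega,\sigma)$.
   Context: $p_0'=p_0/(p_0-1)$ is the conjugate exponent ($p_0'=\infty$ if $p_0=1$). $\mathbb D$ is the open unit disc, $\mathbb T$ the unit circle, $dA$ normalized area measure. A weight is a locally integrable, a.e. positive function. For measurable $f$, $0<p<\infty$, weight $v$, measurable $E$: $\langle f\rangle_{p,v,E}=\big(\int_E|f|^pv\,dA\big)^{1/p}/\big(\int_Ev\,dA\big)^{1/p}$; for $p=\infty$ it is $\|f\|_{L^\infty(E)}$; $v$ omitted when $v\equiv1$, $p$ omitted when $p=1$. For an arc $I\subset\mathbb T$ with center $e^{i\theta_0}$ and normalized arclength $\ell(I)$ ($\ell(\mathbb T)=1$), $Q_I=\{re^{i\theta}\in\mathbb D:1-r\le\ell(I),|\theta-\theta_0|\le\ell(I)/2\}$. For $1\le q<\infty$, $u\in\mathrm{B}_q(\mathbb D)$ means $\sup_I\langle u\rangle_{Q_I}\langle u^{-1}\rangle_{\frac1{q-1},Q_I}<\infty$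 (over all arcs; $\frac1{q-1}=\infty$ if $q=1$), and $\mathrm{B}_{q_0^+}(\mathbb D)=\bigcap_{q>q_0}\mathrm{B}_q(\mathbb D)$. For a weight $\sigma$ on $\Omega$: $\sigma\in\mathrm{B}_q(\Omega)$ if $\sup_I\langle\sigma\rangle_{\psi(Q_I)}\langle\sigma^{-1}\rangle_{\frac1{q-1},\psi(Q_I)}<\infty$; for $1<s<\infty$, $\sigma\in\mathrm{RH}_s(\Omega)$ if $\sup_I\langle\sigma\rangle_{s,\psi(Q_I)}\big(\langle\sigma\rangle_{\psi(Q_I)}\big)^{-1}<\infty$. $\Pi_\Omega$ is the orthogonal projection of $L^2(\Omega)$ onto its holomorphic subspace; bounded on $L^p(\Omega,\sigma)$ means it extends to a bounded operator on the $L^p$ space of $\sigma\,dA$. *)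

theory Defs
  imports "HOL-Analysis.Analysis"
begin

text \<open>Area measure: Lebesgue measure on the plane. The normalisation of dA
  by 1/pi is irrelevant here (averages are ratios, orthogonality is unaffected,
  L^p norms only change by a fixed constant factor).\<close>

definition is_weight :: "complex set \<Rightarrow> (complex \<Rightarrow> real) \<Rightarrow> bool" where
  "is_weight S u \<longleftrightarrow> u \<in> borel_measurable lborel
     \<and> (\<forall>K. compact K \<and> K \<subseteq> S \<longrightarrow> set_integrable lborel K u)
     \<and> (AE z in lborel. z \<in> S \<longrightarrow> u z > 0)"

definition wavg :: "real \<Rightarrow> (complex \<Rightarrow> real) \<Rightarrow> complex set \<Rightarrow> (complex \<Rightarrow> real) \<Rightarrow> real" where
  "wavg p v E f = (LINT z:E|lborel. \<bar>f z\<bar> powr p * v z) powr (1/p)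
                 / (LINT z:E|lborel. v z) powr (1/p)"

definition carleson_box :: "real \<Rightarrow> real \<Rightarrow> complex set" where
  "carleson_box th0 l = {z. \<exists>r th. z = complex_of_real r * cis th \<and> 0 \<le> r \<and> r < 1
                             \<and> 1 - r \<le> l \<and> \<bar>th - th0\<bar> \<le> l / 2}"

definition carleson_boxes :: "complex set set" where
  "carleson_boxes = {carleson_box th0 l | th0 l. 0 < l \<and> l \<le> 1}"

definition B_cond :: "complex set set \<Rightarrow> real \<Rightarrow> (complex \<Rightarrow> real) \<Rightarrow> bool" where
  "B_cond \<Q> q u \<longleftrightarrow> (\<exists>C. \<forall>Q\<in>\<Q>.
      set_integrable lborel Q u \<and>
      (if q = 1 then
         (AE z in lborel. z \<in> Q \<longrightarrow> wavg 1 (\<lambda>_. 1) Q u * \<bar>1 / u z\<bar> \<le> C)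
       else
         set_integrable lborel Q (\<lambda>z. \<bar>1 / u z\<bar> powr (1 / (q - 1))) \<and>
         wavg 1 (\<lambda>_. 1) Q u * wavg (1 / (q - 1)) (\<lambda>_. 1) Q (\<lambda>z. 1 / u z) \<le> C))"

definition RH_cond :: "complex set set \<Rightarrow> real \<Rightarrow> (complex \<Rightarrow> real) \<Rightarrow> bool" where
  "RH_cond \<Q> s u \<longleftrightarrow> (\<exists>C. \<forall>Q\<in>\<Q>.
      set_integrable lborel Q u \<and>
      set_integrable lborel Q (\<lambda>z. \<bar>u z\<bar> powr s) \<and>
      wavg s (\<lambda>_. 1) Q u \<le> C * wavg 1 (\<lambda>_. 1) Q u)"

definition B_disc :: "real \<Rightarrow> (complex \<Rightarrow> real) \<Rightarrow> bool" where
  "B_disc q u \<longleftrightarrow> is_weight (ball 0 1) u \<and> B_cond carleson_boxes q u"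

definition B_disc_plus :: "real \<Rightarrow> (complex \<Rightarrow> real) \<Rightarrow> bool" where
  "B_disc_plus q0 u \<longleftrightarrow> (\<forall>q>q0. B_disc q u)"

definition B_dom :: "(complex \<Rightarrow> complex) \<Rightarrow> real \<Rightarrow> (complex \<Rightarrow> real) \<Rightarrow> bool" where
  "B_dom \<psi> q \<sigma> \<longleftrightarrow> B_cond ((\<lambda>Q. \<psi> ` Q) ` carleson_boxes) q \<sigma>"

definition RH_dom :: "(complex \<Rightarrow> complex) \<Rightarrow> real \<Rightarrow> (complex \<Rightarrow> real) \<Rightarrow> bool" where
  "RH_dom \<psi> s \<sigma> \<longleftrightarrow> RH_cond ((\<lambda>Q. \<psi> ` Q) ` carleson_boxes) s \<sigma>"

definition in_Lp :: "complex set \<Rightarrow> real \<Rightarrow> (complex \<Rightarrow> real) \<Rightarrow> (complex \<Rightarrow> complex) \<Rightarrow> bool" where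
  "in_Lp \<Omega> p \<sigma> f \<longleftrightarrow> f \<in> borel_measurable lborel
     \<and> set_integrable lborel \<Omega> (\<lambda>z. norm (f z) powr p * \<sigma> z)"

definition Lp_norm :: "complex set \<Rightarrow> real \<Rightarrow> (complex \<Rightarrow> real) \<Rightarrow> (complex \<Rightarrow> complex) \<Rightarrow> real" where
  "Lp_norm \<Omega> p \<sigma> f = (LINT z:\<Omega>|lborel. norm (f z) powr p * \<sigma> z) powr (1/p)"

definition bergman_space :: "complex set \<Rightarrow> (complex \<Rightarrow> complex) set" where
  "bergman_space \<Omega> = {g. g holomorphic_on \<Omega> \<and> in_Lp \<Omega> 2 (\<lambda>_. 1) g}"

definition is_bergman_proj :: "complex set \<Rightarrow> (complex \<Rightarrow> complex) \<Rightarrow> (complex \<Rightarrow> complex) \<Rightarrow> bool" where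
  "is_bergman_proj \<Omega> f g \<longleftrightarrow> g \<in> bergman_space \<Omega> \<and>
     (\<forall>h\<in>bergman_space \<Omega>. (LINT z:\<Omega>|lborel. (f z - g z) * cnj (h z)) = 0)"

text \<open>Pi_Omega extends to a bounded operator on L^p(Omega, sigma): bounded in the
  L^p(sigma) norm on the dense subspace L^2(Omega) \<inter> L^p(Omega,sigma).\<close>
definition bergman_bounded :: "complex set \<Rightarrow> real \<Rightarrow> (complex \<Rightarrow> real) \<Rightarrow> bool" where
  "bergman_bounded \<Omega> p \<sigma> \<longleftrightarrow> (\<exists>C. \<forall>f g.
      in_Lp \<Omega> 2 (\<lambda>_. 1) f \<and> in_Lp \<Omega> p \<sigma> f \<and> is_bergman_proj \<Omega> f g \<longrightarrow>
      in_Lp \<Omega> p \<sigma> g \<and> Lp_norm \<Omega> p \<sigma> g \<le> C * Lp_norm \<Omega> p \<sigma> f)"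

end

theory Submission
  imports Defs "HOL-Complex_Analysis.Complex_Analysis"
begin

text \<open>
  The conformal map \<open>\<psi>\<close> turns the Bergman projection of \<open>\<Omega>\<close> into that of the disc: testing against
  \<open>(\<xi>\<inverse>)'\<close>, where \<open>\<xi>\<close> is \<open>\<psi>\<close> precomposed with a Moebius map, and using the area mean value property
  bounds \<open>\<bar>g (\<psi> a)\<bar> \<bar>\<psi>' a\<bar>\<close> by the integral of \<open>\<bar>f \<circ> \<psi>\<bar> \<bar>\<psi>'\<bar>\<close> against \<open>\<bar>1 - cnj a z\<bar>\<close> to the power \<open>-2\<close>. It remains
  to bound this positive operator on the disc with weight \<open>(\<sigma> \<circ> \<psi>) u powr (1 - p/2)\<close>, where
  \<open>u = \<bar>\<psi>'\<bar>\<^sup>2\<close>.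

  The disc is cut into dyadic tiles, the top halves of Carleson boxes, which form a binary tree. Both
  \<open>u\<close> and its negative powers are moduli of holomorphic functions, so the sub-mean value property and
  the hypothesis on \<open>u\<close> make \<open>u\<close> essentially constant on tiles. The box condition on a weight says
  that its mass on a whole box is controlled by its mass on the top tile; hence the mass decays
  geometrically along the generations. This gives a reverse Hoelder inequality for the averages over
  tiles, although Bekolle-Bonami weights themselves need not satisfy one, and it is this gain that absorbs
  the powers of \<open>u\<close>, which are integrable only for exponents strictly below the critical one. The same decay lets a
  Schur test, with powers of the tile masses as test sequences, bound the operator on the tree.
\<close>

section \<open>Change of variables for conformal maps\<close>

text \<open>Write \<open>\<pi>0 = 1/p0'\<close> and let \<open>q\<close> be conjugate to
  \<open>p\<close>. Then \<open>p0 < p < p0'\<close> says \<open>q * \<pi>0 < 1\<close> and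
  \<open>p * \<pi>0 < 1\<close>. Since \<open>1/(q0 - 1) = (1 - 2 * \<pi>0) / (2 * \<pi>0)\<close>,
  the hypothesis on \<open>u\<close> controls \<open>u powr (-\<tau>)\<close> for
  \<open>\<tau> * (2 * \<pi>0) < 1 - 2 * \<pi>0\<close>. The conditions on \<open>\<sigma>\<close>
  combine into one condition of Bekolle type on a power of \<open>\<sigma> \<circ> \<psi>\<close>
  with respect to the measure \<open>u dA\<close>; in this form the weight and its dual are
  exchanged by exchanging \<open>p\<close> and \<open>q\<close>. The obstacle is an endpoint. On a
  tile the disc weight is modelled by the area times an average to the power
  \<open>1 - p * \<pi>0\<close> times \<open>u powr (1 - p/2)\<close>. Hoelder's inequality with
  exponents \<open>1 - p * \<pi>0\<close> and \<open>p * \<pi>0\<close> against a negative power of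
  \<open>u\<close> would force \<open>\<tau> = (1 - 2 * \<pi>0) / (2 * \<pi>0)\<close>, the excluded
  endpoint. The reverse Hoelder gain shifts weight to the second factor and lowers
  \<open>\<tau>\<close> into the admissible range. As that gain concerns averages over tiles, the
  argument runs on tile averages instead of pointwise values of the weight.\<close>

definition vec_complex :: "real^2 \<Rightarrow> complex" where "vec_complex x = Complex (vec_nth x 1) (vec_nth x 2)"
definition complex_vec :: "complex \<Rightarrow> real^2" where "complex_vec z = vector [Re z, Im z]"

lemma vec_complex_inverse [simp]: "complex_vec (vec_complex x) = x"
  by (simp add: complex_vec_def vec_complex_def vec_eq_iff forall_2)

lemma complex_vec_inverse [simp]: "vec_complex (complex_vec z) = z"
  by (simp add: complex_vec_def vec_complex_def)

lemma bounded_linear_vec_complex: "bounded_linear vec_complex"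
  by (intro linear_conv_bounded_linear[THEN iffD1] linearI)
     (auto simp: vec_complex_def complex_eq_iff)

lemma bounded_linear_complex_vec: "bounded_linear complex_vec"
  by (intro linear_conv_bounded_linear[THEN iffD1] linearI)
     (auto simp: complex_vec_def vec_eq_iff forall_2)

lemma borel_measurable_vec_complex [measurable]: "vec_complex \<in> borel_measurable borel"
  by (intro borel_measurable_continuous_onI linear_continuous_on bounded_linear_vec_complex)

text \<open>The area formula applied below is phrased with matrix determinants on
  \<open>real^2\<close>, hence this identification of the plane with it. Boxes go to boxes with the
  same side lengths, and Lebesgue measure is determined by its values on boxes.\<close>

lemma distr_vec_complex: "distr lborel borel vec_complex = lborel"
proof (rule lborel_eqI[symmetric])
  fix l u :: complex
  assume le: "\<And>b. b \<in> Basis \<Longrightarrow> l \<bullet> b \<le> u \<bullet> b"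
  have *: "vec_complex -` box l u = box (complex_vec l) (complex_vec u)"
    by (auto simp: in_box_complex_iff mem_box_cart vec_complex_def complex_vec_def forall_2)
  have "emeasure (distr lborel borel vec_complex) (box l u) = emeasure lborel (box (complex_vec l) (complex_vec u))"
    by (subst emeasure_distr) (auto simp: *)
  also have "\<dots> = (\<Prod>b\<in>Basis. (complex_vec u - complex_vec l) \<bullet> b)"
    using le[of 1] le[of \<i>]
    by (subst emeasure_lborel_box)
       (auto simp: Basis_vec_def complex_vec_def Basis_complex_def UNIV_2 inner_axis)
  also have "(\<Prod>b\<in>Basis. (complex_vec u - complex_vec l) \<bullet> b) = (\<Prod>b\<in>Basis. (u - l) \<bullet> b)"
  proof -
    have "(Basis :: (real^2) set) = {axis 1 1, axis 2 1}"
      by (auto simp: Basis_vec_def UNIV_2)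
    moreover have "axis 1 1 \<noteq> (axis 2 (1::real) :: real^2)" by (simp add: axis_eq_axis)
    ultimately have "(\<Prod>b\<in>Basis. x \<bullet> b) = (x \<bullet> axis 1 1) * (x \<bullet> axis 2 1)" for x :: "real^2"
      by (metis (no_types, lifting) finite.emptyI finite_insert insert_absorb insert_not_empty prod.empty prod.insert mult.right_neutral singletonD)
    then show ?thesis by (simp add: Basis_complex_def inner_axis complex_vec_def)
  qed
  finally show "emeasure (distr lborel borel vec_complex) (box l u) = (\<Prod>b\<in>Basis. (u - l) \<bullet> b)" .
qed simp

lemma emeasure_vec_complex:
  assumes "A \<in> sets borel"
  shows "emeasure lborel (complex_vec ` A) = emeasure lborel A"
proof -
  have "complex_vec ` A = vec_complex -` A"
    by (auto simp: image_iff) (metis vec_complex_inverse)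
  then show ?thesis
    using assms arg_cong[OF distr_vec_complex, of "\<lambda>M. emeasure M A"] by (simp add: emeasure_distr)
qed

lemma complex_vec_image_borel: "A \<in> sets borel \<Longrightarrow> complex_vec ` A \<in> sets borel"
proof -
  have "complex_vec ` A = vec_complex -` A \<inter> space borel"
    by (auto simp: image_iff) (metis vec_complex_inverse)
  then show "A \<in> sets borel \<Longrightarrow> ?thesis" by (simp only: ) (rule measurable_sets, auto)
qed

text \<open>The image is the preimage of \<open>A\<close> under the inverse map, which is
  holomorphic and hence continuous on the open image of \<open>S\<close>.\<close>

lemma inj_holomorphic_image_borel:
  assumes "open S" "f holomorphic_on S" "inj_on f S" "A \<in> sets borel" "A \<subseteq> S"
  shows "f ` A \<in> sets borel"
proof -
  obtain g where g: "g holomorphic_on (f ` S)" "\<And>z. z \<in> S \<Longrightarrow> g (f z) = z"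
    using holomorphic_has_inverse[OF assms(2,1,3)] by metis
  have op: "open (f ` S)" by (rule open_mapping_thm3[OF assms(2,1,3)])
  have "f ` A = g -` A \<inter> f ` S" using g(2) assms(5) by (force simp: image_iff)
  also have "\<dots> \<in> sets (restrict_space borel (f ` S))"
    using measurable_sets[OF borel_measurable_continuous_on_restrict[OF holomorphic_on_imp_continuous_on[OF g(1)]] assms(4)]
    by (simp add: space_restrict_space)
  finally show ?thesis using op by (auto simp: sets_restrict_space)
qed

lemma holomorphic_deriv_borel:
  assumes "open S" "f holomorphic_on S"
  shows "(\<lambda>z. indicator S z * (cmod (deriv f z))\<^sup>2) \<in> borel_measurable borel"
proof -
  have "(\<lambda>z. if z \<in> S then (cmod (deriv f z))\<^sup>2 else 0) \<in> borel_measurable borel"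
    by (intro borel_measurable_continuous_on_if continuous_intros
       holomorphic_on_imp_continuous_on holomorphic_deriv assms borel_open)
  also have "(\<lambda>z. if z \<in> S then (cmod (deriv f z))\<^sup>2 else 0) = (\<lambda>z. indicator S z * (cmod (deriv f z))\<^sup>2)"
    by (auto simp: fun_eq_iff indicator_def)
  finally show ?thesis .
qed

lemma emeasure_holomorphic_image:
  assumes "open S" "f holomorphic_on S" "inj_on f S" "A \<in> sets borel" "A \<subseteq> S"
  shows "emeasure lborel (f ` A) = (\<integral>\<^sup>+z\<in>A. ennreal ((cmod (deriv f z))\<^sup>2) \<partial>lborel)"
proof -
  define B where "B = complex_vec ` A"
  define F where "F = complex_vec \<circ> f \<circ> vec_complex"
  define F' where "F' x h = complex_vec (deriv f (vec_complex x) * vec_complex h)" for x h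
  define J where "J x = (cmod (deriv f (vec_complex x)))\<^sup>2" for x
  have Bb: "B \<in> sets borel" unfolding B_def by (rule complex_vec_image_borel[OF assms(4)])
  have BS: "vec_complex x \<in> S" if "x \<in> B" for x using that assms(5) by (auto simp: B_def)
  have der: "(F has_derivative F' x) (at x within B)" if "x \<in> B" for x
  proof -
    have "(f has_field_derivative deriv f (vec_complex x)) (at (vec_complex x))"
      by (rule holomorphic_derivI[OF assms(2,1) BS[OF that]])
    then have "(f has_derivative (\<lambda>h. deriv f (vec_complex x) * h)) (at (vec_complex x))"
      by (simp add: has_field_derivative_def)
    then show ?thesis unfolding F_def F'_def o_def
      by (intro bounded_linear.has_derivative[OF bounded_linear_complex_vec]
          has_derivative_compose[OF bounded_linear_imp_has_derivative[OF bounded_linear_vec_complex]])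
  qed
  have inj: "inj_on F B"
    using assms(3,5) unfolding inj_on_def F_def B_def
    by (auto) (metis complex_vec_inverse in_mono)
  \<comment> \<open>Multiplication by \<open>a + i b\<close> has the real matrix with rows
    \<open>a, -b\<close> and \<open>b, a\<close>, whose determinant is the squared modulus.\<close>
  have det: "det (matrix (F' x)) = J x" for x
    unfolding J_def cmod_power2
    by (simp add: det_2 matrix_def F'_def vec_complex_def complex_vec_def axis_def power2_eq_square)
  have J_nonneg: "0 \<le> J x" for x by (simp add: J_def)
  have FB: "F ` B = complex_vec ` (f ` A)" by (auto simp: F_def B_def image_image)
  have fAb: "f ` A \<in> sets borel" by (rule inj_holomorphic_image_borel[OF assms])
  have iff: "F ` B \<in> lmeasurable \<and> measure lebesgue (F ` B) = m \<longleftrightarrow> (J has_integral m) B" for m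
    using has_measure_differentiable_image[OF _ der inj, of m] Bb
    by (simp add: det abs_of_nonneg[OF J_nonneg])
  have Jm: "(\<lambda>z. indicator A z * (cmod (deriv f z))\<^sup>2) \<in> borel_measurable borel"
  proof -
    have "(\<lambda>z. indicator A z * (indicator S z * (cmod (deriv f z))\<^sup>2)) \<in> borel_measurable borel"
      by (intro borel_measurable_times borel_measurable_indicator assms(4) holomorphic_deriv_borel[OF assms(1,2)])
    also have "(\<lambda>z. indicator A z * (indicator S z * (cmod (deriv f z))\<^sup>2)) = (\<lambda>z. indicator A z * (cmod (deriv f z))\<^sup>2)"
      using assms(5) by (auto simp: fun_eq_iff indicator_def)
    finally show ?thesis .
  qed
  have ind: "indicator B x = (indicator A (vec_complex x) :: real)" for x
    unfolding B_def by (auto simp: indicator_def image_iff) (metis vec_complex_inverse)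
  have nn: "(\<integral>\<^sup>+z\<in>A. ennreal ((cmod (deriv f z))\<^sup>2) \<partial>lborel) = (\<integral>\<^sup>+x. ennreal (indicator B x * J x) \<partial>lborel)"
  proof -
    have "(\<integral>\<^sup>+z\<in>A. ennreal ((cmod (deriv f z))\<^sup>2) \<partial>lborel) = (\<integral>\<^sup>+z. ennreal (indicator A z * (cmod (deriv f z))\<^sup>2) \<partial>lborel)"
      by (intro nn_integral_cong) (auto simp: indicator_def)
    also have "\<dots> = (\<integral>\<^sup>+x. ennreal (indicator A (vec_complex x) * (cmod (deriv f (vec_complex x)))\<^sup>2) \<partial>lborel)"
      using Jm by (subst distr_vec_complex[symmetric], subst nn_integral_distr) auto
    finally show ?thesis by (simp add: ind J_def)
  qed
  have JB: "(\<lambda>x. indicator B x * J x) \<in> borel_measurable borel"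
    unfolding ind J_def using measurable_compose[OF borel_measurable_vec_complex Jm] by simp
  have ind': "(\<lambda>x. indicator B x * J x) = (\<lambda>x. if x \<in> B then J x else 0)"
    by (auto simp: indicator_def)
  have leb: "emeasure lborel (f ` A) = emeasure lebesgue (F ` B)"
    unfolding FB using complex_vec_image_borel[OF fAb] emeasure_vec_complex[OF fAb] by simp
  have Fl: "F ` B \<in> sets lebesgue" unfolding FB using complex_vec_image_borel[OF fAb] by simp
  have Jnn: "0 \<le> indicator B x * J x" for x by (simp add: J_def)
  \<comment> \<open>\<open>iff\<close> speaks of finite measure only. If the image has infinite
    measure, the integral must be infinite too, since a finite integral would make the image measure
    finite.\<close>
  show ?thesis
  proof (cases "emeasure lebesgue (F ` B) = \<infinity>")
    case False
    then have "F ` B \<in> lmeasurable" using Fl by (simp add: fmeasurable_def top.not_eq_extremum)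
    then have "(J has_integral measure lebesgue (F ` B)) B" using iff by blast
    then have "((\<lambda>x. indicator B x * J x) has_integral measure lebesgue (F ` B)) UNIV"
      unfolding ind' by (simp add: has_integral_restrict_UNIV)
    from nn_integral_has_integral_lborel[OF JB Jnn this]
    have "(\<integral>\<^sup>+x. ennreal (indicator B x * J x) \<partial>lborel) = measure lebesgue (F ` B)" .
    then show ?thesis unfolding nn leb using False by (simp add: emeasure_eq_ennreal_measure)
  next
    case True
    have "(\<integral>\<^sup>+x. ennreal (indicator B x * J x) \<partial>lborel) = \<infinity>"
    proof (rule ccontr)
      assume "\<not> ?thesis"
      then have "(\<integral>\<^sup>+x. ennreal (indicator B x * J x) \<partial>lborel) < \<infinity>" by (simp add: less_top)
      then have "(\<lambda>x. indicator B x * J x) integrable_on UNIV"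
        by (intro nn_integral_integrable_on JB Jnn)
      then obtain m where "((\<lambda>x. indicator B x * J x) has_integral m) UNIV" by blast
      then have "(J has_integral m) B" unfolding ind' by (simp add: has_integral_restrict_UNIV)
      then have "F ` B \<in> lmeasurable" using iff by blast
      then show False using True fmeasurableD2[of "F ` B" lebesgue] by (metis infinity_ennreal_def)
    qed
    then show ?thesis unfolding nn leb using True by simp
  qed
qed

lemma holomorphic_extend_borel:
  assumes "open S" "f holomorphic_on S"
  shows "(\<lambda>z. if z \<in> S then f z else (c::complex)) \<in> borel_measurable borel"
  by (intro borel_measurable_continuous_on_if continuous_intros
       holomorphic_on_imp_continuous_on assms borel_open)

text \<open>Stated as an identity of measures, the change of variables yields the substitution rules
  for nonnegative and for Bochner integrals alike. Outside \<open>S\<close> the density vanishes;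
  the value 0 there only makes the map globally measurable.\<close>

lemma distr_holomorphic:
  assumes S: "open S" and f: "f holomorphic_on S" and inj: "inj_on f S"
  shows "distr (density lborel (\<lambda>z. ennreal (indicator S z * (cmod (deriv f z))\<^sup>2))) borel (\<lambda>z. if z \<in> S then f z else 0)
    = density lborel (indicator (f ` S))" (is "distr ?M borel ?f = ?N")
proof (rule measure_eqI)
  have op: "open (f ` S)" by (rule open_mapping_thm3[OF f S inj])
  have [measurable]: "?f \<in> borel_measurable borel" "(\<lambda>z. indicator S z * (cmod (deriv f z))\<^sup>2) \<in> borel_measurable borel"
    using holomorphic_extend_borel[OF S f] holomorphic_deriv_borel[OF S f] by auto
  have [measurable]: "S \<in> sets borel" "f ` S \<in> sets borel" using S op by auto
  fix B assume "B \<in> sets (distr ?M borel ?f)"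
  then have B[measurable]: "B \<in> sets borel" by simp
  define A where "A = S \<inter> (?f -` B \<inter> space borel)"
  have A[measurable]: "A \<in> sets borel" unfolding A_def by measurable
  have fA: "f ` A = B \<inter> f ` S" by (auto simp: A_def)
  have [measurable]: "?f -` B \<inter> space borel \<in> sets borel" by measurable
  have "emeasure (distr ?M borel ?f) B = emeasure ?M (?f -` B \<inter> space borel)"
    by (subst emeasure_distr) auto
  also have "\<dots> = (\<integral>\<^sup>+z. ennreal (indicator S z * (cmod (deriv f z))\<^sup>2) * indicator (?f -` B \<inter> space borel) z \<partial>lborel)"
    by (rule emeasure_density) measurable
  also have "\<dots> = (\<integral>\<^sup>+z\<in>A. ennreal ((cmod (deriv f z))\<^sup>2) \<partial>lborel)"
    by (intro nn_integral_cong) (auto simp: A_def indicator_def)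
  also have "\<dots> = emeasure lborel (f ` A)"
    by (rule emeasure_holomorphic_image[symmetric, OF S f inj A]) (auto simp: A_def)
  also have "\<dots> = emeasure ?N B"
    unfolding fA by (subst emeasure_density) (auto simp: indicator_inter_arith[symmetric] nn_integral_indicator Int_commute)
  finally show "emeasure (distr ?M borel ?f) B = emeasure ?N B" .
qed simp

lemma nn_integral_holomorphic_image:
  assumes S: "open S" and f: "f holomorphic_on S" and inj: "inj_on f S"
    and h[measurable]: "h \<in> borel_measurable borel" and A: "A \<in> sets borel" "A \<subseteq> S"
  shows "(\<integral>\<^sup>+w\<in>f ` A. h w \<partial>lborel) = (\<integral>\<^sup>+z\<in>A. h (f z) * ennreal ((cmod (deriv f z))\<^sup>2) \<partial>lborel)"
proof -
  let ?f = "\<lambda>z. if z \<in> S then f z else 0"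
  have op: "open (f ` S)" by (rule open_mapping_thm3[OF f S inj])
  have [measurable]: "?f \<in> borel_measurable borel" "(\<lambda>z. indicator S z * (cmod (deriv f z))\<^sup>2) \<in> borel_measurable borel"
    using holomorphic_extend_borel[OF S f] holomorphic_deriv_borel[OF S f] by auto
  have [measurable]: "f ` A \<in> sets borel" "f ` S \<in> sets borel"
    using inj_holomorphic_image_borel[OF S f inj A] op by auto
  have "(\<integral>\<^sup>+w\<in>f ` A. h w \<partial>lborel) = (\<integral>\<^sup>+w. indicator (f ` S) w * (h w * indicator (f ` A) w) \<partial>lborel)"
    using A by (intro nn_integral_cong) (auto simp: indicator_def)
  also have "\<dots> = (\<integral>\<^sup>+w. h w * indicator (f ` A) w \<partial>density lborel (indicator (f ` S)))"
    by (subst nn_integral_density) auto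
  also have "\<dots> = (\<integral>\<^sup>+z. ennreal (indicator S z * (cmod (deriv f z))\<^sup>2) * (h (?f z) * indicator (f ` A) (?f z)) \<partial>lborel)"
    by (subst distr_holomorphic[OF S f inj, symmetric], subst nn_integral_distr, simp, simp, subst nn_integral_density) auto
  also have "\<dots> = (\<integral>\<^sup>+z\<in>A. h (f z) * ennreal ((cmod (deriv f z))\<^sup>2) \<partial>lborel)"
    using A inj by (intro nn_integral_cong) (auto simp: indicator_def mult_ac inj_on_def)
  finally show ?thesis .
qed

lemma set_integral_holomorphic_image:
  fixes h :: "complex \<Rightarrow> complex"
  assumes S: "open S" and f: "f holomorphic_on S" and inj: "inj_on f S"
    and h[measurable]: "h \<in> borel_measurable borel"
  shows "(LINT w:f ` S|lborel. h w) = (LINT z:S|lborel. h (f z) * complex_of_real ((cmod (deriv f z))\<^sup>2))"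
proof -
  let ?f = "\<lambda>z. if z \<in> S then f z else 0"
  have op: "open (f ` S)" by (rule open_mapping_thm3[OF f S inj])
  have m[measurable]: "?f \<in> borel_measurable borel" "(\<lambda>z. indicator S z * (cmod (deriv f z))\<^sup>2) \<in> borel_measurable borel"
    using holomorphic_extend_borel[OF S f] holomorphic_deriv_borel[OF S f] by auto
  have [measurable]: "f ` S \<in> sets borel" using op by auto
  have "(LINT w:f ` S|lborel. h w) = (\<integral>w. h w \<partial>density lborel (\<lambda>w. ennreal (indicator (f ` S) w)))"
    unfolding set_lebesgue_integral_def by (subst integral_density) auto
  also have "density lborel (\<lambda>w. ennreal (indicator (f ` S) w)) = density lborel (indicator (f ` S))"
    by (intro density_cong) (auto simp: indicator_def)
  also have "(\<integral>w. h w \<partial>density lborel (indicator (f ` S))) = (\<integral>z. (indicator S z * (cmod (deriv f z))\<^sup>2) *\<^sub>R h (?f z) \<partial>lborel)"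
    by (subst distr_holomorphic[OF S f inj, symmetric], subst integral_distr, simp, simp, subst integral_density) auto
  also have "\<dots> = (LINT z:S|lborel. h (f z) * complex_of_real ((cmod (deriv f z))\<^sup>2))"
    unfolding set_lebesgue_integral_def
    by (intro Bochner_Integration.integral_cong) (auto simp: indicator_def scaleR_conv_of_real mult_ac)
  finally show ?thesis .
qed

section \<open>The area mean value property\<close>

lemma circle_mean_value:
  fixes \<phi> :: "complex \<Rightarrow> complex"
  assumes "\<phi> holomorphic_on cball 0 1"
  shows "(LINT x:{0..1::real}|lborel. \<phi> (cis (2*pi*x))) = \<phi> 0"
proof -
  have "((\<lambda>u. \<phi> u / (u - 0)) has_contour_integral (2 * of_real pi * \<i> * \<phi> 0)) (circlepath 0 1)"
    by (rule Cauchy_integral_circlepath_simple[OF assms]) auto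
  then have "((\<lambda>x. \<phi> (circlepath 0 1 x) / circlepath 0 1 x * (2 * of_real pi * \<i> * exp (2 * of_real pi * \<i> * x)))
      has_integral (2 * of_real pi * \<i> * \<phi> 0)) {0..1}"
    unfolding has_contour_integral_def
    by (rule has_integral_eq[rotated]) (auto simp: vector_derivative_circlepath01)
  then have "((\<lambda>x. \<phi> (cis (2*pi*x)) * (2 * of_real pi * \<i>)) has_integral (2 * of_real pi * \<i> * \<phi> 0)) {0..1}"
    by (rule has_integral_eq[rotated]) (auto simp: circlepath cis_conv_exp mult_ac)
  then have "((\<lambda>x. \<phi> (cis (2*pi*x)) * (2 * of_real pi * \<i>) * (1 / (2 * of_real pi * \<i>)))
     has_integral (2 * of_real pi * \<i> * \<phi> 0 * (1 / (2 * of_real pi * \<i>)))) {0..1}"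
    by (rule has_integral_mult_left)
  then have 1: "((\<lambda>x. \<phi> (cis (2*pi*x))) has_integral \<phi> 0) {0..1}"
    by simp
  have "continuous_on {0..1} (\<lambda>x::real. \<phi> (cis (2*pi*x)))"
    by (intro continuous_on_compose2[OF holomorphic_on_imp_continuous_on[OF assms]] continuous_intros) auto
  then have "set_integrable lborel {0..1} (\<lambda>x. \<phi> (cis (2*pi*x)))"
    by (rule borel_integrable_atLeastAtMost')
  from set_borel_integral_eq_integral(2)[OF this] 1 show ?thesis by (simp add: integral_unique)
qed

lemma integral_rotate:
  fixes H :: "complex \<Rightarrow> complex"
  assumes "H \<in> borel_measurable borel" "cmod c = 1"
  shows "(\<integral>z. H (a + c * (z - a)) \<partial>lborel) = (\<integral>z. H z \<partial>lborel)"
    "(\<integral>\<^sup>+z. ennreal (norm (H (a + c * (z - a)))) \<partial>lborel) = (\<integral>\<^sup>+z. ennreal (norm (H z)) \<partial>lborel)"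
proof -
  let ?f = "\<lambda>z. a + c * (z - a)"
  have c: "c \<noteq> 0" using assms by auto
  have hol: "?f holomorphic_on UNIV" by (intro holomorphic_intros)
  have der: "deriv ?f z = c" for z
    by (rule DERIV_imp_deriv) (auto intro!: derivative_eq_intros)
  have inj: "inj_on ?f UNIV" using c by (auto simp: inj_on_def)
  have im: "range ?f = UNIV"
  proof -
    have "w = ?f (a + (w - a) / c)" for w using c by (simp add: field_simps)
    then show ?thesis by blast
  qed
  show "(\<integral>z. H (?f z) \<partial>lborel) = (\<integral>z. H z \<partial>lborel)"
    using set_integral_holomorphic_image[OF open_UNIV hol inj assms(1)]
    by (simp add: im der assms(2) set_lebesgue_integral_def)
  show "(\<integral>\<^sup>+z. ennreal (norm (H (?f z))) \<partial>lborel) = (\<integral>\<^sup>+z. ennreal (norm (H z)) \<partial>lborel)"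
    using nn_integral_holomorphic_image[OF open_UNIV hol inj, of "\<lambda>z. ennreal (norm (H z))" UNIV] assms(1)
    by (simp add: im der assms(2))
qed

text \<open>Rotations about \<open>a\<close> preserve area, so the integral may be averaged over all
  rotations; after Fubini the inner integral is a circle mean. Only circles inside the open ball
  enter, so integrability is all that is asked of \<open>h\<close> near the boundary.\<close>

lemma area_mean_value:
  assumes h: "h holomorphic_on ball a r" and r: "0 < r" and int: "set_integrable lborel (ball a r) h"
  shows "(LINT z:ball a r|lborel. h z) = of_real (pi * r\<^sup>2) * h a"
proof -
  define H where "H z = indicator (ball a r) z *\<^sub>R h z" for z
  have Hi: "integrable lborel H" using int unfolding set_integrable_def H_def .
  have Hm[measurable]: "H \<in> borel_measurable borel" using borel_measurable_integrable[OF Hi] by simp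
  define R where "R t z = a + cis (2*pi*t) * (z - a)" for t :: real and z
  define K where "K = (\<lambda>(t::real,z). indicator {0..1::real} t *\<^sub>R H (R t z))"
  have Rm[measurable]: "(\<lambda>(t,z). R t z) \<in> borel_measurable (borel \<Otimes>\<^sub>M borel)"
    unfolding R_def borel_prod by (intro borel_measurable_continuous_onI) (auto intro!: continuous_intros simp: split_def)
  have Km[measurable]: "K \<in> borel_measurable (lborel \<Otimes>\<^sub>M lborel)"
    unfolding K_def by measurable
  have rot: "(\<integral>z. H (R t z) \<partial>lborel) = (\<integral>z. H z \<partial>lborel)"
      "(\<integral>\<^sup>+z. ennreal (norm (H (R t z))) \<partial>lborel) = (\<integral>\<^sup>+z. ennreal (norm (H z)) \<partial>lborel)" for t
    unfolding R_def using integral_rotate[OF Hm, of "cis (2*pi*t)" a] by simp_all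
  have Rt[measurable]: "R t \<in> borel_measurable borel" for t
    unfolding R_def by measurable
  have iR: "integrable lborel (\<lambda>z. H (R t z))" for t
    using Hi unfolding integrable_iff_bounded rot(2) by auto
  have nR: "(\<integral>z. norm (H (R t z)) \<partial>lborel) = (\<integral>z. norm (H z) \<partial>lborel)" for t
    by (simp add: integral_eq_nn_integral rot(2))
  have Kint: "integrable (lborel \<Otimes>\<^sub>M lborel) K"
  proof (rule lborel_pair.Fubini_integrable)
    have "(\<lambda>x. LINT y|lborel. norm (K (x, y))) = (\<lambda>x. indicator {0..1} x *\<^sub>R (\<integral>z. norm (H z) \<partial>lborel))"
      by (simp add: K_def nR fun_eq_iff)
    then show "integrable lborel (\<lambda>x. LINT y|lborel. norm (K (x, y)))"
      by (simp add: integrable_mult_left)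
    show "AE x in lborel. integrable lborel (\<lambda>y. K (x, y))"
      using iR by (auto simp: K_def)
  qed simp
  have "(\<integral>z. H z \<partial>lborel) = (\<integral>t. indicator {0..1::real} t *\<^sub>R (\<integral>z. H z \<partial>lborel) \<partial>lborel)"
    by simp
  also have "\<dots> = (\<integral>t. \<integral>z. indicator {0..1::real} t *\<^sub>R H (R t z) \<partial>lborel \<partial>lborel)"
    by (simp add: rot)
  also have "\<dots> = (\<integral>z. \<integral>t. indicator {0..1::real} t *\<^sub>R H (R t z) \<partial>lborel \<partial>lborel)"
    using lborel_pair.Fubini_integral[of "\<lambda>t z. indicator {0..1::real} t *\<^sub>R H (R t z)"] Kint unfolding K_def by simp
  also have "\<dots> = (\<integral>z. indicator (ball a r) z *\<^sub>R h a \<partial>lborel)"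
  proof (intro Bochner_Integration.integral_cong refl)
    fix z
    have mem: "R t z \<in> ball a r \<longleftrightarrow> z \<in> ball a r" for t
      by (simp add: R_def dist_norm norm_mult norm_minus_commute)
    show "(\<integral>t. indicator {0..1::real} t *\<^sub>R H (R t z) \<partial>lborel) = indicator (ball a r) z *\<^sub>R h a"
    proof (cases "z \<in> ball a r")
      case True
      have *: "(\<lambda>s. h (a + s * (z - a))) holomorphic_on cball 0 1"
      proof (rule holomorphic_on_compose_gen[OF _ h, unfolded o_def])
        show "(\<lambda>s. a + s * (z - a)) ` cball 0 1 \<subseteq> ball a r"
        proof clarsimp
          fix s :: complex assume "cmod s \<le> 1"
          then have "cmod s * cmod (z - a) \<le> cmod (z - a)" by (simp add: mult_left_le_one_le)
          with True show "dist a (a + s * (z - a)) < r"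
            by (simp add: dist_norm norm_mult norm_minus_commute)
        qed
      qed (intro holomorphic_intros)
      have "(\<integral>t. indicator {0..1::real} t *\<^sub>R H (R t z) \<partial>lborel) = (LINT t:{0..1}|lborel. h (a + cis (2*pi*t) * (z - a)))"
        using True mem unfolding set_lebesgue_integral_def H_def by (simp add: R_def)
      also have "\<dots> = h a" using circle_mean_value[OF *] by simp
      finally show ?thesis using True by simp
    next
      case False
      then show ?thesis using mem by (simp add: H_def)
    qed
  qed
  also have "\<dots> = of_real (pi * r\<^sup>2) * h a"
    using r by (simp add: content_ball eval_unit_ball_vol scaleR_conv_of_real)
  finally show ?thesis unfolding H_def set_lebesgue_integral_def .
qed

section \<open>A pointwise bound for the Bergman projection\<close>

lemma borel_compose_holomorphic:
  fixes h :: "complex \<Rightarrow> complex"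
  assumes S: "open S" and f: "f holomorphic_on S" and h[measurable]: "h \<in> borel_measurable borel"
  shows "(\<lambda>z. indicator S z *\<^sub>R h (f z)) \<in> borel_measurable (borel :: complex measure)"
    (is "?L \<in> _")
proof -
  have Sb: "S \<in> sets borel" using S by auto
  have "(\<lambda>z. indicator S z *\<^sub>R h (if z \<in> S then f z else 0)) \<in> borel_measurable borel"
    by (intro borel_measurable_scaleR borel_measurable_indicator Sb
        measurable_compose[OF holomorphic_extend_borel[OF S f] h])
  also have "(\<lambda>z. indicator S z *\<^sub>R h (if z \<in> S then f z else 0)) = ?L"
    by (auto simp: indicator_def)
  finally show ?thesis .
qed

lemma L2_pullback_integrable:
  assumes \<xi>: "\<xi> holomorphic_on ball 0 1" "inj_on \<xi> (ball 0 1)"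
    and f: "in_Lp (\<xi> ` ball 0 1) 2 (\<lambda>_. 1) f"
  shows "set_integrable lborel (ball 0 1) (\<lambda>z. f (\<xi> z) * deriv \<xi> z)"
proof -
  have fm[measurable]: "f \<in> borel_measurable borel" using f by (simp add: in_Lp_def)
  have [measurable]: "(\<lambda>z. indicator (ball 0 1) z *\<^sub>R f (\<xi> z)) \<in> borel_measurable borel"
    by (rule borel_compose_holomorphic[OF _ \<xi>(1) fm]) simp
  have [measurable]: "(\<lambda>z. indicator (ball 0 1) z *\<^sub>R deriv \<xi> z) \<in> borel_measurable borel"
    using borel_compose_holomorphic[OF _ holomorphic_deriv[OF \<xi>(1)], of "\<lambda>z. z"] by simp
  have meas: "(\<lambda>z. indicator (ball 0 1) z *\<^sub>R (f (\<xi> z) * deriv \<xi> z)) \<in> borel_measurable borel"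
  proof -
    have "(\<lambda>z. (indicator (ball 0 1) z *\<^sub>R f (\<xi> z)) * (indicator (ball 0 1) z *\<^sub>R deriv \<xi> z)) \<in> borel_measurable borel"
      by measurable
    also have "(\<lambda>z. (indicator (ball 0 1) z *\<^sub>R f (\<xi> z)) * (indicator (ball 0 1) z *\<^sub>R deriv \<xi> z))
      = (\<lambda>z. indicator (ball 0 1) z *\<^sub>R (f (\<xi> z) * deriv \<xi> z))" by (auto simp: indicator_def)
    finally show ?thesis .
  qed
  have "set_integrable lborel (\<xi> ` ball 0 1) (\<lambda>z. norm (f z) powr 2 * 1)" using f by (simp add: in_Lp_def)
  then have "(\<integral>\<^sup>+w\<in>\<xi> ` ball 0 1. ennreal (norm (f w) ^ 2) \<partial>lborel) < \<infinity>"
    unfolding set_integrable_def integrable_iff_bounded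
    by (elim conjE order.strict_trans1[rotated]) (intro nn_integral_mono, auto simp: indicator_def)
  then have fin: "(\<integral>\<^sup>+z\<in>ball 0 1. ennreal (norm (f (\<xi> z)) ^ 2) * ennreal ((cmod (deriv \<xi> z))\<^sup>2) \<partial>lborel) < \<infinity>"
    using \<xi> by (subst (asm) nn_integral_holomorphic_image[of "ball 0 1"]) auto
  \<comment> \<open>Square integrability passes to integrability because the disc has finite area;
    this elementary bound takes the place of Cauchy-Schwarz.\<close>
  have le: "x \<le> 1 + x\<^sup>2" for x :: real
    using sum_power2_ge_zero[of "x - 1/2" 0] by (simp add: power2_eq_square algebra_simps)
  have "(\<integral>\<^sup>+z. norm (indicator (ball 0 1) z *\<^sub>R (f (\<xi> z) * deriv \<xi> z)) \<partial>lborel)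
     \<le> (\<integral>\<^sup>+z. indicator (ball (0::complex) 1) z + ennreal (norm (f (\<xi> z)) ^ 2) * ennreal ((cmod (deriv \<xi> z))\<^sup>2) * indicator (ball 0 1) z \<partial>lborel)"
  proof (intro nn_integral_mono)
    fix z show "ennreal (norm (indicator (ball 0 1) z *\<^sub>R (f (\<xi> z) * deriv \<xi> z))) \<le>
       indicator (ball (0::complex) 1) z + ennreal (norm (f (\<xi> z)) ^ 2) * ennreal ((cmod (deriv \<xi> z))\<^sup>2) * indicator (ball 0 1) z"
      using le[of "norm (f (\<xi> z) * deriv \<xi> z)"]
      by (auto simp: indicator_def norm_mult power_mult_distrib simp flip: ennreal_mult ennreal_1 ennreal_plus)
  qed
  also have "\<dots> = (\<integral>\<^sup>+z. indicator (ball (0::complex) 1) z \<partial>lborel) + (\<integral>\<^sup>+z\<in>ball 0 1. ennreal (norm (f (\<xi> z)) ^ 2) * ennreal ((cmod (deriv \<xi> z))\<^sup>2) \<partial>lborel)"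
  proof (rule nn_integral_add)
    have "(\<lambda>z. ennreal ((norm (indicator (ball 0 1) z *\<^sub>R f (\<xi> z)))^2) * ennreal ((norm (indicator (ball 0 1) z *\<^sub>R deriv \<xi> z))^2)) \<in> borel_measurable lborel"
      by measurable
    also have "(\<lambda>z. ennreal ((norm (indicator (ball 0 1) z *\<^sub>R f (\<xi> z)))^2) * ennreal ((norm (indicator (ball 0 1) z *\<^sub>R deriv \<xi> z))^2))
      = (\<lambda>z. ennreal (norm (f (\<xi> z)) ^ 2) * ennreal ((cmod (deriv \<xi> z))\<^sup>2) * indicator (ball 0 1) z)"
      by (auto simp: indicator_def)
    finally show "(\<lambda>z. ennreal (norm (f (\<xi> z)) ^ 2) * ennreal ((cmod (deriv \<xi> z))\<^sup>2) * indicator (ball 0 1) z) \<in> borel_measurable lborel" .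
  qed (rule borel_measurable_indicator, simp)
  also have "\<dots> < \<infinity>"
    using fin emeasure_lborel_ball_finite[of "0::complex" 1] by (simp add: less_top)
  finally show ?thesis
    unfolding set_integrable_def using meas by (intro integrableI_bounded) auto
qed

text \<open>The test function \<open>h\<close> corresponds to the constant 1 on the disc: its square
  integral is the area of the disc, so it lies in the Bergman space. Orthogonality of
  \<open>f - g\<close> to \<open>h\<close> becomes equality of the disc integrals of
  \<open>f\<close> and \<open>g\<close>, both pulled back with the factor
  \<open>deriv \<xi>\<close>.\<close>

lemma bergman_proj_center:
  assumes \<xi>: "\<xi> holomorphic_on ball 0 1" "inj_on \<xi> (ball 0 1)"
    and f: "in_Lp (\<xi> ` ball 0 1) 2 (\<lambda>_. 1) f" and g: "is_bergman_proj (\<xi> ` ball 0 1) f g"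
  shows "of_real pi * (g (\<xi> 0) * deriv \<xi> 0) = (LINT z:ball 0 1|lborel. f (\<xi> z) * deriv \<xi> z)"
proof -
  let ?D = "ball (0::complex) 1" and ?\<Omega> = "\<xi> ` ball 0 1"
  have op: "open ?\<Omega>" by (rule open_mapping_thm3[OF \<xi>(1) _ \<xi>(2)]) simp
  have [measurable]: "?\<Omega> \<in> sets borel" using op by simp
  obtain k where k: "k holomorphic_on ?\<Omega>" "\<And>z. z \<in> ?D \<Longrightarrow> deriv \<xi> z * deriv k (\<xi> z) = 1"
    using holomorphic_has_inverse[OF \<xi>(1) _ \<xi>(2)] by (metis open_ball)
  define h where "h w = (if w \<in> ?\<Omega> then deriv k w else 0)" for w
  have hm[measurable]: "h \<in> borel_measurable borel"
    unfolding h_def by (rule holomorphic_extend_borel[OF op holomorphic_deriv[OF k(1) op]])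
  have hhol: "h holomorphic_on ?\<Omega>"
    using holomorphic_deriv[OF k(1) op] by (rule holomorphic_transform) (simp add: h_def)
  have hk: "deriv \<xi> z * h (\<xi> z) = 1" if "z \<in> ?D" for z using k(2)[OF that] that by (auto simp: h_def)
  have "(\<integral>\<^sup>+w\<in>?\<Omega>. ennreal (norm (h w) ^ 2) \<partial>lborel) = (\<integral>\<^sup>+z\<in>?D. ennreal (norm (h (\<xi> z)) ^ 2) * ennreal ((cmod (deriv \<xi> z))\<^sup>2) \<partial>lborel)"
    using \<xi> by (subst nn_integral_holomorphic_image[of "ball 0 1"]) auto
  also have "\<dots> = (\<integral>\<^sup>+z. indicator ?D z \<partial>lborel)"
  proof (intro nn_integral_cong)
    fix z show "ennreal (norm (h (\<xi> z)) ^ 2) * ennreal ((cmod (deriv \<xi> z))\<^sup>2) * indicator ?D z = indicator ?D z"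
      using hk[of z] by (auto simp: indicator_def norm_mult[symmetric] power_mult_distrib[symmetric] mult.commute simp flip: ennreal_mult)
  qed
  also have "\<dots> < \<infinity>"
    using emeasure_lborel_ball_finite[of "0::complex" 1] by (simp add: less_top)
  finally have "set_integrable lborel ?\<Omega> (\<lambda>z. norm (h z) powr 2 * 1)"
    unfolding set_integrable_def integrable_iff_bounded
    by (auto elim!: order.strict_trans1[rotated] intro!: nn_integral_mono simp: indicator_def)
  with hhol hm have "h \<in> bergman_space ?\<Omega>" unfolding bergman_space_def in_Lp_def by simp
  with g have "0 = (LINT z:?\<Omega>|lborel. (f z - g z) * cnj (h z))" and gb: "g holomorphic_on ?\<Omega>" "in_Lp ?\<Omega> 2 (\<lambda>_. 1) g"
    unfolding is_bergman_proj_def bergman_space_def by auto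
  have fm[measurable]: "f \<in> borel_measurable borel" "g \<in> borel_measurable borel"
    using f gb(2) by (auto simp: in_Lp_def)
  have [measurable]: "(\<lambda>w. cnj (h w)) \<in> borel_measurable borel"
    by (rule measurable_compose[OF hm]) (intro borel_measurable_continuous_onI continuous_intros)
  note \<open>0 = (LINT z:?\<Omega>|lborel. (f z - g z) * cnj (h z))\<close>
  also have "(LINT z:?\<Omega>|lborel. (f z - g z) * cnj (h z)) = (LINT z:?D|lborel. (f (\<xi> z) - g (\<xi> z)) * cnj (h (\<xi> z)) * complex_of_real ((cmod (deriv \<xi> z))\<^sup>2))"
    by (rule set_integral_holomorphic_image[OF _ \<xi>]) auto
  also have "\<dots> = (LINT z:?D|lborel. f (\<xi> z) * deriv \<xi> z - g (\<xi> z) * deriv \<xi> z)"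
  proof (intro set_lebesgue_integral_cong allI impI)
    fix z assume z: "z \<in> ?D"
    have "cnj (h (\<xi> z)) * complex_of_real ((cmod (deriv \<xi> z))\<^sup>2) = deriv \<xi> z * cnj (deriv \<xi> z * h (\<xi> z))"
      unfolding complex_norm_square by simp
    also have "\<dots> = deriv \<xi> z" using hk[OF z] by simp
    finally show "(f (\<xi> z) - g (\<xi> z)) * cnj (h (\<xi> z)) * complex_of_real ((cmod (deriv \<xi> z))\<^sup>2) = f (\<xi> z) * deriv \<xi> z - g (\<xi> z) * deriv \<xi> z"
      by (simp add: algebra_simps)
  qed simp
  also have "\<dots> = (LINT z:?D|lborel. f (\<xi> z) * deriv \<xi> z) - (LINT z:?D|lborel. g (\<xi> z) * deriv \<xi> z)"
    by (intro set_integral_diff L2_pullback_integrable \<xi> f gb(2))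
  also have "(LINT z:?D|lborel. g (\<xi> z) * deriv \<xi> z) = of_real (pi * 1\<^sup>2) * (g (\<xi> 0) * deriv \<xi> 0)"
  proof (rule area_mean_value)
    show "(\<lambda>z. g (\<xi> z) * deriv \<xi> z) holomorphic_on ?D"
      by (intro holomorphic_on_mult holomorphic_deriv \<xi> holomorphic_on_compose_gen[OF \<xi>(1) gb(1), unfolded o_def]) auto
  qed (auto intro: L2_pullback_integrable \<xi> gb(2))
  finally show ?thesis by simp
qed

lemma one_minus_cnj_mult_nonzero:
  assumes "cmod a < 1" "cmod z < 1" shows "1 - cnj a * z \<noteq> 0"
proof
  assume "1 - cnj a * z = 0"
  then have "cmod (cnj a * z) = 1" by (metis norm_one right_minus_eq)
  moreover have "cmod a * cmod z < 1 * 1" using assms by (intro mult_strict_mono') auto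
  ultimately show False by (simp add: norm_mult)
qed

text \<open>The Moebius map \<open>\<phi>\<close> sends 0 to \<open>a\<close>, so the identity at
  the centre for \<open>\<psi> \<circ> \<phi>\<close> becomes one at \<open>a\<close>; undoing the
  substitution turns \<open>deriv \<phi>\<close> into the kernel. No formula for the Bergman kernel
  of the domain enters.\<close>

lemma bergman_proj_pointwise:
  assumes \<psi>: "\<psi> holomorphic_on ball 0 1" "inj_on \<psi> (ball 0 1)"
    and f: "in_Lp (\<psi> ` ball 0 1) 2 (\<lambda>_. 1) f" and g: "is_bergman_proj (\<psi> ` ball 0 1) f g"
    and a: "a \<in> ball 0 1"
  shows "ennreal (cmod (g (\<psi> a)) * cmod (deriv \<psi> a)) \<le>
     (\<integral>\<^sup>+z\<in>ball 0 1. ennreal (cmod (f (\<psi> z)) * cmod (deriv \<psi> z) / (cmod (1 - cnj a * z))\<^sup>2) \<partial>lborel)"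
proof -
  let ?D = "ball (0::complex) 1"
  define \<phi> where "\<phi> = Moebius_function 0 (- a)"
  define m where "m = 1 - (cmod a)\<^sup>2"
  have m: "m > 0" using a by (simp add: m_def power_less_one_iff abs_square_less_1)
  have a1: "cmod a < 1" using a by simp
  have \<phi>eq: "\<phi> z = (z + a) / (1 + cnj a * z)" for z
    by (simp add: \<phi>_def Moebius_function_simple)
  have nz: "1 + cnj a * z \<noteq> 0" if "z \<in> ?D" for z
    using one_minus_cnj_mult_nonzero[of "-a" z] a that by simp
  have \<phi>hol: "\<phi> holomorphic_on ?D" unfolding \<phi>_def by (rule Moebius_function_holomorphic) (use a in simp)
  have \<phi>inv: "Moebius_function 0 a (\<phi> z) = z" "\<phi> (Moebius_function 0 a z) = z" if "z \<in> ?D" for z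
    using that a unfolding \<phi>_def by (auto intro!: Moebius_function_compose)
  have \<phi>im: "\<phi> ` ?D = ?D"
  proof
    show "\<phi> ` ?D \<subseteq> ?D" using a unfolding \<phi>_def by (auto intro!: Moebius_function_norm_lt_1)
    show "?D \<subseteq> \<phi> ` ?D"
    proof
      fix z assume z: "z \<in> ?D"
      have "Moebius_function 0 a z \<in> ?D" using a z by (auto intro!: Moebius_function_norm_lt_1)
      with \<phi>inv(2)[OF z] show "z \<in> \<phi> ` ?D" by (metis imageI)
    qed
  qed
  have \<phi>inj: "inj_on \<phi> ?D" using \<phi>inv(1) by (metis inj_onI)
  have \<phi>D: "(\<phi> has_field_derivative (of_real m / (1 + cnj a * z)\<^sup>2)) (at z)" if "z \<in> ?D" for z
  proof -
    have "((\<lambda>z. (z + a) / (1 + cnj a * z)) has_field_derivative ((1 * (1 + cnj a * z) - (z + a) * cnj a) / ((1 + cnj a * z) * (1 + cnj a * z)))) (at z)"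
      by (rule derivative_eq_intros | use nz[OF that] in simp)+
    moreover have "(1 * (1 + cnj a * z) - (z + a) * cnj a) = of_real m"
      by (simp add: m_def algebra_simps complex_norm_square[symmetric])
    ultimately show ?thesis unfolding \<phi>eq by (simp add: power2_eq_square)
  qed
  have d\<phi>: "deriv \<phi> z = of_real m / (1 + cnj a * z)\<^sup>2" if "z \<in> ?D" for z
    using \<phi>D[OF that] by (rule DERIV_imp_deriv)
  define \<xi> where "\<xi> = \<psi> \<circ> \<phi>"
  have \<xi>hol: "\<xi> holomorphic_on ?D" unfolding \<xi>_def
    by (rule holomorphic_on_compose_gen[OF \<phi>hol \<psi>(1)]) (simp add: \<phi>im)
  have \<xi>inj: "inj_on \<xi> ?D" unfolding \<xi>_def by (rule comp_inj_on[OF \<phi>inj]) (simp add: \<phi>im \<psi>)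
  have \<xi>im: "\<xi> ` ?D = \<psi> ` ?D" unfolding \<xi>_def image_comp[symmetric] \<phi>im ..
  have d\<xi>: "deriv \<xi> z = deriv \<psi> (\<phi> z) * deriv \<phi> z" if "z \<in> ?D" for z
  proof -
    have "\<phi> z \<in> ?D" using \<phi>im that by blast
    then show ?thesis unfolding \<xi>_def
      using \<phi>hol \<psi>(1) that by (intro deriv_chain) (auto intro!: holomorphic_on_imp_differentiable_at[of _ ?D])
  qed
  have \<xi>0: "\<xi> 0 = \<psi> a" "deriv \<xi> 0 = deriv \<psi> a * of_real m"
    using d\<xi>[of 0] d\<phi>[of 0] by (auto simp: \<xi>_def \<phi>eq)
  have fm[measurable]: "f \<in> borel_measurable borel" using f by (simp add: in_Lp_def)
  have "(LINT z:?D|lborel. f (\<xi> z) * deriv \<xi> z) = of_real pi * (g (\<xi> 0) * deriv \<xi> 0)"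
    by (rule sym, rule bergman_proj_center[OF \<xi>hol \<xi>inj]) (auto simp: \<xi>im f g)
  then have "ennreal (pi * (cmod (g (\<psi> a)) * cmod (deriv \<psi> a) * m)) = ennreal (norm (LINT z:?D|lborel. f (\<xi> z) * deriv \<xi> z))"
    using m by (simp add: \<xi>0 norm_mult mult.assoc)
  also have "\<dots> \<le> (\<integral>\<^sup>+z. norm (indicator ?D z *\<^sub>R (f (\<xi> z) * deriv \<xi> z)) \<partial>lborel)"
    unfolding set_lebesgue_integral_def by (rule integral_norm_bound_ennreal[OF L2_pullback_integrable[OF \<xi>hol \<xi>inj, unfolded \<xi>im, OF f, unfolded set_integrable_def]])
  also have "\<dots> = (\<integral>\<^sup>+z\<in>?D. ennreal (cmod (f (\<psi> (\<phi> z))) * cmod (deriv \<psi> (\<phi> z)) * (m / (cmod (1 - cnj a * \<phi> z))\<^sup>2)) * ennreal ((cmod (deriv \<phi> z))\<^sup>2) \<partial>lborel)"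
  proof (intro nn_integral_cong)
    fix z
    show "ennreal (norm (indicator ?D z *\<^sub>R (f (\<xi> z) * deriv \<xi> z))) =
      ennreal (cmod (f (\<psi> (\<phi> z))) * cmod (deriv \<psi> (\<phi> z)) * (m / (cmod (1 - cnj a * \<phi> z))\<^sup>2)) * ennreal ((cmod (deriv \<phi> z))\<^sup>2) * indicator ?D z"
    proof (cases "z \<in> ?D")
      case True
      \<comment> \<open>With this identity the single factor \<open>cmod (deriv \<phi> z)\<close>
        becomes \<open>m\<close> times the kernel at \<open>\<phi> z\<close> times the Jacobian of
        \<open>\<phi>\<close>, the form needed to substitute \<open>w = \<phi> z\<close>.\<close>
      have "1 - cnj a * \<phi> z = of_real m / (1 + cnj a * z)"
        using nz[OF True] by (simp add: \<phi>eq m_def field_simps complex_norm_square[symmetric])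
      then have "m / (cmod (1 - cnj a * \<phi> z))\<^sup>2 = (cmod (1 + cnj a * z))\<^sup>2 / m"
        using m by (simp add: norm_divide power_divide power2_eq_square)
      moreover have "(cmod (deriv \<phi> z))\<^sup>2 = cmod (deriv \<phi> z) * (m / (cmod (1 + cnj a * z))\<^sup>2)"
        using m by (simp add: d\<phi>[OF True] norm_divide norm_power norm_mult power2_eq_square)
      ultimately have *: "(m / (cmod (1 - cnj a * \<phi> z))\<^sup>2) * (cmod (deriv \<phi> z))\<^sup>2 = cmod (deriv \<phi> z)"
        using m nz[OF True] by simp
      have "norm (f (\<xi> z) * deriv \<xi> z) = cmod (f (\<psi> (\<phi> z))) * cmod (deriv \<psi> (\<phi> z)) * ((m / (cmod (1 - cnj a * \<phi> z))\<^sup>2) * (cmod (deriv \<phi> z))\<^sup>2)"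
        unfolding * d\<xi>[OF True] by (simp add: \<xi>_def norm_mult)
      then show ?thesis using True m by (simp add: mult.assoc flip: ennreal_mult)
    qed simp
  qed
  also have "\<dots> = (\<integral>\<^sup>+w\<in>?D. ennreal (cmod (f (\<psi> w)) * cmod (deriv \<psi> w) * (m / (cmod (1 - cnj a * w))\<^sup>2)) \<partial>lborel)"
  proof -
    define P where "P w = ennreal (cmod (indicator ?D w *\<^sub>R f (\<psi> w)) * cmod (indicator ?D w *\<^sub>R deriv \<psi> w) * (m / (cmod (1 - cnj a * w))\<^sup>2))" for w
    have [measurable]: "(\<lambda>z. indicator (ball 0 1) z *\<^sub>R f (\<psi> z)) \<in> borel_measurable borel"
      by (rule borel_compose_holomorphic[OF _ \<psi>(1) fm]) simp
    have [measurable]: "(\<lambda>z. indicator (ball 0 1) z *\<^sub>R deriv \<psi> z) \<in> borel_measurable borel"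
      using borel_compose_holomorphic[OF _ holomorphic_deriv[OF \<psi>(1)], of "\<lambda>z. z"] by simp
    have Pm: "P \<in> borel_measurable borel" unfolding P_def by measurable
    have \<phi>D': "\<phi> z \<in> ?D" if "z \<in> ?D" for z using \<phi>im that by blast
    have "(\<integral>\<^sup>+w\<in>\<phi> ` ?D. P w \<partial>lborel) = (\<integral>\<^sup>+z\<in>?D. P (\<phi> z) * ennreal ((cmod (deriv \<phi> z))\<^sup>2) \<partial>lborel)"
      by (rule nn_integral_holomorphic_image[OF _ \<phi>hol \<phi>inj Pm]) auto
    also have "\<dots> = (\<integral>\<^sup>+z\<in>?D. ennreal (cmod (f (\<psi> (\<phi> z))) * cmod (deriv \<psi> (\<phi> z)) * (m / (cmod (1 - cnj a * \<phi> z))\<^sup>2)) * ennreal ((cmod (deriv \<phi> z))\<^sup>2) \<partial>lborel)"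
      using \<phi>D' by (intro nn_integral_cong) (auto simp: P_def indicator_def)
    finally have 1: "(\<integral>\<^sup>+w\<in>?D. P w \<partial>lborel) = \<dots>" unfolding \<phi>im .
    have "(\<integral>\<^sup>+w\<in>?D. P w \<partial>lborel) = (\<integral>\<^sup>+w\<in>?D. ennreal (cmod (f (\<psi> w)) * cmod (deriv \<psi> w) * (m / (cmod (1 - cnj a * w))\<^sup>2)) \<partial>lborel)"
      by (intro nn_integral_cong) (auto simp: P_def indicator_def)
    with 1 show ?thesis by simp
  qed
  also have "\<dots> = ennreal m * (\<integral>\<^sup>+w\<in>?D. ennreal (cmod (f (\<psi> w)) * cmod (deriv \<psi> w) / (cmod (1 - cnj a * w))\<^sup>2) \<partial>lborel)"
  proof -
    have [measurable]: "(\<lambda>z. indicator (ball 0 1) z *\<^sub>R f (\<psi> z)) \<in> borel_measurable borel"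
      by (rule borel_compose_holomorphic[OF _ \<psi>(1) fm]) simp
    have [measurable]: "(\<lambda>z. indicator (ball 0 1) z *\<^sub>R deriv \<psi> z) \<in> borel_measurable borel"
      using borel_compose_holomorphic[OF _ holomorphic_deriv[OF \<psi>(1)], of "\<lambda>z. z"] by simp
    have "(\<lambda>w. ennreal (cmod (indicator ?D w *\<^sub>R f (\<psi> w)) * cmod (indicator ?D w *\<^sub>R deriv \<psi> w) / (cmod (1 - cnj a * w))\<^sup>2)) \<in> borel_measurable lborel"
      by measurable
    also have "(\<lambda>w. ennreal (cmod (indicator ?D w *\<^sub>R f (\<psi> w)) * cmod (indicator ?D w *\<^sub>R deriv \<psi> w) / (cmod (1 - cnj a * w))\<^sup>2))
      = (\<lambda>w. ennreal (cmod (f (\<psi> w)) * cmod (deriv \<psi> w) / (cmod (1 - cnj a * w))\<^sup>2) * indicator ?D w)"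
      by (auto simp: indicator_def)
    finally show ?thesis
      using m by (subst nn_integral_cmult[symmetric])
        (auto intro!: nn_integral_cong simp: indicator_def mult_ac simp flip: ennreal_mult)
  qed
  finally have fin: "ennreal (pi * (cmod (g (\<psi> a)) * cmod (deriv \<psi> a) * m)) \<le> ennreal m * (\<integral>\<^sup>+w\<in>?D. ennreal (cmod (f (\<psi> w)) * cmod (deriv \<psi> w) / (cmod (1 - cnj a * w))\<^sup>2) \<partial>lborel)" .
  \<comment> \<open>The factor \<open>pi\<close>, which stems from the unnormalised area, is dropped
    by \<open>1 \<le> pi\<close>.\<close>
  have "1 * (cmod (g (\<psi> a)) * cmod (deriv \<psi> a) * m) \<le> pi * (cmod (g (\<psi> a)) * cmod (deriv \<psi> a) * m)"
    using m pi_ge_two by (intro mult_right_mono) auto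
  then have "ennreal m * ennreal (cmod (g (\<psi> a)) * cmod (deriv \<psi> a)) \<le> ennreal (pi * (cmod (g (\<psi> a)) * cmod (deriv \<psi> a) * m))"
    using m by (simp add: ennreal_leI mult_ac flip: ennreal_mult)
  with fin have "ennreal m * ennreal (cmod (g (\<psi> a)) * cmod (deriv \<psi> a)) \<le> ennreal m * (\<integral>\<^sup>+w\<in>?D. ennreal (cmod (f (\<psi> w)) * cmod (deriv \<psi> w) / (cmod (1 - cnj a * w))\<^sup>2) \<partial>lborel)"
    by (rule order_trans[rotated])
  then show ?thesis using m by (simp add: ennreal_mult_le_mult_iff)
qed

section \<open>Hoelder inequalities and the Schur test\<close>

lemma Young_powr:
  fixes a b :: real
  assumes "0 < \<alpha>" "0 < \<beta>" "\<alpha> + \<beta> = 1" "0 \<le> a" "0 \<le> b"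
  shows "a powr \<alpha> * b powr \<beta> \<le> \<alpha> * a + \<beta> * b"
proof (cases "a = 0 \<or> b = 0")
  case False
  then show ?thesis using assms Youngs_inequality_0[of \<alpha> \<beta> a b] by simp
qed (use assms in auto)

lemma Holder_sum_powr:
  fixes f g :: "'i \<Rightarrow> real"
  assumes ab: "0 < \<alpha>" "0 < \<beta>" "\<alpha> + \<beta> = 1" and I: "finite I"
    and nn: "\<And>i. i \<in> I \<Longrightarrow> 0 \<le> f i" "\<And>i. i \<in> I \<Longrightarrow> 0 \<le> g i"
  shows "(\<Sum>i\<in>I. f i powr \<alpha> * g i powr \<beta>) \<le> (\<Sum>i\<in>I. f i) powr \<alpha> * (\<Sum>i\<in>I. g i) powr \<beta>"
proof (cases "sum f I = 0 \<or> sum g I = 0")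
  case True
  then have "(\<forall>i\<in>I. f i = 0) \<or> (\<forall>i\<in>I. g i = 0)"
    using nn I by (simp add: sum_nonneg_eq_0_iff)
  then have "(\<Sum>i\<in>I. f i powr \<alpha> * g i powr \<beta>) = 0" using ab by (intro sum.neutral) auto
  then show ?thesis by simp
next
  case False
  define F G where "F = sum f I" and "G = sum g I"
  have FG: "F > 0" "G > 0" using False nn unfolding F_def G_def by (metis order.not_eq_order_implies_strict sum_nonneg)+
  have "(\<Sum>i\<in>I. f i powr \<alpha> * g i powr \<beta>) = F powr \<alpha> * G powr \<beta> * (\<Sum>i\<in>I. (f i / F) powr \<alpha> * (g i / G) powr \<beta>)"
    using FG nn by (simp add: sum_distrib_left powr_divide)
  also have "\<dots> \<le> F powr \<alpha> * G powr \<beta> * (\<Sum>i\<in>I. \<alpha> * (f i / F) + \<beta> * (g i / G))"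
    using FG nn ab by (intro mult_left_mono sum_mono Young_powr) auto
  also have "(\<Sum>i\<in>I. \<alpha> * (f i / F) + \<beta> * (g i / G)) = \<alpha> * (F / F) + \<beta> * (G / G)"
    unfolding F_def G_def sum.distrib sum_divide_distrib sum_distrib_left ..
  also have "\<dots> = 1" using FG ab by simp
  finally show ?thesis by (simp add: F_def G_def)
qed

text \<open>Real upper bounds \<open>F\<close> and \<open>G\<close> stand in for the two integrals,
  so that real powers of them make sense. The normalisation divides by both, hence the separate
  treatment of a vanishing bound.\<close>

lemma Holder_nn_integral_powr:
  fixes f g :: "'a \<Rightarrow> real"
  assumes ab: "0 < \<alpha>" "0 < \<beta>" "\<alpha> + \<beta> = 1"
    and m[measurable]: "f \<in> borel_measurable M" "g \<in> borel_measurable M"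
    and nn: "\<And>x. 0 \<le> f x" "\<And>x. 0 \<le> g x"
    and F: "(\<integral>\<^sup>+x. ennreal (f x) \<partial>M) \<le> ennreal F" "0 \<le> F" and G: "(\<integral>\<^sup>+x. ennreal (g x) \<partial>M) \<le> ennreal G" "0 \<le> G"
  shows "(\<integral>\<^sup>+x. ennreal (f x powr \<alpha> * g x powr \<beta>) \<partial>M) \<le> ennreal (F powr \<alpha> * G powr \<beta>)"
proof (cases "F = 0 \<or> G = 0")
  case True
  then have "(AE x in M. f x = 0) \<or> (AE x in M. g x = 0)"
  proof
    assume "F = 0"
    then have "AE x in M. ennreal (f x) = 0" using F by (subst nn_integral_0_iff_AE[symmetric]) auto
    then have "AE x in M. f x = 0" by eventually_elim (use nn(1) in \<open>simp add: ennreal_eq_0_iff antisym\<close>)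
    then show ?thesis by simp
  next
    assume "G = 0"
    then have "AE x in M. ennreal (g x) = 0" using G by (subst nn_integral_0_iff_AE[symmetric]) auto
    then have "AE x in M. g x = 0" by eventually_elim (use nn(2) in \<open>simp add: ennreal_eq_0_iff antisym\<close>)
    then show ?thesis by simp
  qed
  then have "AE x in M. ennreal (f x powr \<alpha> * g x powr \<beta>) = 0" using ab by auto
  then show ?thesis by (subst nn_integral_0_iff_AE[THEN iffD2]) auto
next
  case False
  then have FG: "F > 0" "G > 0" using F G by auto
  have "(\<integral>\<^sup>+x. ennreal (f x powr \<alpha> * g x powr \<beta>) \<partial>M)
    \<le> (\<integral>\<^sup>+x. ennreal (F powr \<alpha> * G powr \<beta> * \<alpha> / F) * ennreal (f x) + ennreal (F powr \<alpha> * G powr \<beta> * \<beta> / G) * ennreal (g x) \<partial>M)"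
  proof (intro nn_integral_mono)
    fix x
    have "f x powr \<alpha> * g x powr \<beta> = F powr \<alpha> * G powr \<beta> * ((f x / F) powr \<alpha> * (g x / G) powr \<beta>)"
      using FG nn by (simp add: powr_divide)
    also have "\<dots> \<le> F powr \<alpha> * G powr \<beta> * (\<alpha> * (f x / F) + \<beta> * (g x / G))"
      using FG nn ab by (intro mult_left_mono Young_powr) auto
    finally show "ennreal (f x powr \<alpha> * g x powr \<beta>) \<le> ennreal (F powr \<alpha> * G powr \<beta> * \<alpha> / F) * ennreal (f x) + ennreal (F powr \<alpha> * G powr \<beta> * \<beta> / G) * ennreal (g x)"
      using FG nn ab by (simp add: ennreal_leI distrib_left mult_ac flip: ennreal_mult ennreal_plus)
  qed
  also have "\<dots> = ennreal (F powr \<alpha> * G powr \<beta> * \<alpha> / F) * (\<integral>\<^sup>+x. ennreal (f x) \<partial>M) + ennreal (F powr \<alpha> * G powr \<beta> * \<beta> / G) * (\<integral>\<^sup>+x. ennreal (g x) \<partial>M)"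
    by (simp add: nn_integral_add nn_integral_cmult)
  also have "\<dots> \<le> ennreal (F powr \<alpha> * G powr \<beta> * \<alpha> / F) * ennreal F + ennreal (F powr \<alpha> * G powr \<beta> * \<beta> / G) * ennreal G"
    by (intro add_mono mult_left_mono F G) auto
  also have "\<dots> = ennreal (F powr \<alpha> * G powr \<beta> * \<alpha> + F powr \<alpha> * G powr \<beta> * \<beta>)"
    using FG ab by (simp flip: ennreal_mult ennreal_plus)
  also have "F powr \<alpha> * G powr \<beta> * \<alpha> + F powr \<alpha> * G powr \<beta> * \<beta> = F powr \<alpha> * G powr \<beta>"
    using ab by (simp flip: distrib_left)
  finally show ?thesis .
qed

text \<open>Write each entry as its \<open>1/q\<close>-th times its \<open>1/p\<close>-th power,
  insert \<open>k j\<close> and its inverse, and apply Hoelder's inequality in \<open>j\<close>: the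
  first factor is the row bound. Raising to the power \<open>p\<close>, summing over
  \<open>i\<close> and exchanging the sums leaves the column bound.\<close>

lemma Schur_test:
  fixes M :: "'i \<Rightarrow> 'j \<Rightarrow> real" and x :: "'j \<Rightarrow> real"
  assumes p: "1 < p" "1/p + 1/q = 1" and fin: "finite I" "finite J"
    and M: "\<And>i j. i \<in> I \<Longrightarrow> j \<in> J \<Longrightarrow> 0 \<le> M i j"
    and h: "\<And>i. i \<in> I \<Longrightarrow> 0 < h i" and k: "\<And>j. j \<in> J \<Longrightarrow> 0 < k j"
    and C: "0 \<le> C1" "0 \<le> C2"
    and row: "\<And>i. i \<in> I \<Longrightarrow> (\<Sum>j\<in>J. M i j * k j powr q) \<le> C1 * h i powr q"
    and col: "\<And>j. j \<in> J \<Longrightarrow> (\<Sum>i\<in>I. M i j * h i powr p) \<le> C2 * k j powr p"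
    and x: "\<And>j. j \<in> J \<Longrightarrow> 0 \<le> x j"
  shows "(\<Sum>i\<in>I. (\<Sum>j\<in>J. M i j * x j) powr p) \<le> C1 powr (p/q) * C2 * (\<Sum>j\<in>J. x j powr p)"
proof -
  have q: "q > 0"
  proof -
    have "1/p < 1" using p by simp
    then have "0 < 1/q" using p(2) by linarith
    then show ?thesis by (simp only: zero_less_divide_1_iff)
  qed
  have pp: "p > 0" using p by simp
  have trm: "(\<Sum>j\<in>J. M i j * x j) powr p \<le> C1 powr (p/q) * (\<Sum>j\<in>J. M i j * h i powr p * (k j powr (-p) * x j powr p))" if i: "i \<in> I" for i
  proof -
    have "(\<Sum>j\<in>J. M i j * x j) = (\<Sum>j\<in>J. (M i j * k j powr q) powr (1/q) * (M i j * (k j powr (-p) * x j powr p)) powr (1/p))"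
    proof (rule sum.cong[OF refl])
      fix j assume j: "j \<in> J"
      have kj: "k j > 0" using k j by auto
      have "(M i j * k j powr q) powr (1/q) * (M i j * (k j powr (-p) * x j powr p)) powr (1/p)
          = (M i j powr (1/q) * M i j powr (1/p)) * (k j * (k j powr (-1))) * x j"
        using M[OF i j] x[OF j] kj q pp by (simp add: powr_mult powr_powr)
      also have "M i j powr (1/q) * M i j powr (1/p) = M i j"
        using p M[OF i j] by (simp add: powr_add[symmetric] add.commute)
      also have "k j * (k j powr (-1)) = 1" using kj by (simp add: powr_minus)
      finally show "M i j * x j = (M i j * k j powr q) powr (1/q) * (M i j * (k j powr (-p) * x j powr p)) powr (1/p)" by simp
    qed
    also have "\<dots> \<le> (\<Sum>j\<in>J. M i j * k j powr q) powr (1/q) * (\<Sum>j\<in>J. M i j * (k j powr (-p) * x j powr p)) powr (1/p)"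
      using p q fin M[OF i] by (intro Holder_sum_powr) (auto simp: add.commute)
    also have "\<dots> \<le> (C1 * h i powr q) powr (1/q) * (\<Sum>j\<in>J. M i j * (k j powr (-p) * x j powr p)) powr (1/p)"
      using row[OF i] q M[OF i] by (intro mult_right_mono powr_mono2 sum_nonneg) auto
    finally have "(\<Sum>j\<in>J. M i j * x j) powr p \<le> ((C1 * h i powr q) powr (1/q) * (\<Sum>j\<in>J. M i j * (k j powr (-p) * x j powr p)) powr (1/p)) powr p"
      using M[OF i] x pp by (intro powr_mono2 sum_nonneg) auto
    also have "\<dots> = C1 powr (p/q) * h i powr p * (\<Sum>j\<in>J. M i j * (k j powr (-p) * x j powr p))"
      using C h[OF i] q pp M[OF i] by (simp add: powr_mult powr_powr sum_nonneg)
    also have "\<dots> = C1 powr (p/q) * (\<Sum>j\<in>J. M i j * h i powr p * (k j powr (-p) * x j powr p))"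
      by (simp add: sum_distrib_left mult_ac)
    finally show ?thesis .
  qed
  have "(\<Sum>i\<in>I. (\<Sum>j\<in>J. M i j * x j) powr p) \<le> (\<Sum>i\<in>I. C1 powr (p/q) * (\<Sum>j\<in>J. M i j * h i powr p * (k j powr (-p) * x j powr p)))"
    by (intro sum_mono trm)
  also have "\<dots> = C1 powr (p/q) * (\<Sum>j\<in>J. (\<Sum>i\<in>I. M i j * h i powr p) * (k j powr (-p) * x j powr p))"
    unfolding sum_distrib_left[symmetric] by (subst sum.swap) (simp only: sum_distrib_right)
  also have "\<dots> \<le> C1 powr (p/q) * (\<Sum>j\<in>J. (C2 * k j powr p) * (k j powr (-p) * x j powr p))"
    by (intro mult_left_mono sum_mono mult_right_mono col) auto
  also have "(\<Sum>j\<in>J. (C2 * k j powr p) * (k j powr (-p) * x j powr p)) = (\<Sum>j\<in>J. C2 * x j powr p)"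
  proof (rule sum.cong[OF refl])
    fix j assume "j \<in> J"
    then have "k j powr p * k j powr (-p) = 1" using k by (simp add: powr_add[symmetric] less_imp_neq[symmetric])
    then show "(C2 * k j powr p) * (k j powr (-p) * x j powr p) = C2 * x j powr p" by (metis mult.assoc mult.right_neutral)
  qed
  finally show ?thesis by (simp add: sum_distrib_left mult_ac)
qed

section \<open>Sequences on the dyadic tree\<close>

text \<open>The pair \<open>(n, j)\<close> is the \<open>j\<close>-th dyadic arc of generation
  \<open>n\<close>. Truncation to \<open>N\<close> generations keeps all sums finite; the constants
  obtained below do not depend on \<open>N\<close>.\<close>

definition tiles :: "nat \<Rightarrow> (nat \<times> nat) set" where
  "tiles N = {(n, j). n < N \<and> j < 2 ^ n}"

text \<open>Passing to the parent drops the last binary digit of the index, so ancestry is integer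
  division by a power of 2. Every node counts as its own descendant.\<close>

definition desc :: "nat \<times> nat \<Rightarrow> nat \<times> nat \<Rightarrow> bool" where
  "desc Q R \<longleftrightarrow> fst Q \<le> fst R \<and> snd R div 2 ^ (fst R - fst Q) = snd Q"

definition dset :: "nat \<Rightarrow> nat \<times> nat \<Rightarrow> (nat \<times> nat) set" where
  "dset N Q = {R \<in> tiles N. desc Q R}"

lemma finite_tiles [simp, intro]: "finite (tiles N)"
proof (rule finite_subset)
  show "tiles N \<subseteq> {..<N} \<times> {..<2^N}"
    unfolding tiles_def using power_increasing[of _ N "2::nat"] by (auto intro: less_le_trans simp: less_imp_le)
qed simp

lemma finite_dset [simp, intro]: "finite (dset N Q)" by (simp add: dset_def)

lemma desc_refl [simp]: "desc Q Q" by (simp add: desc_def)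

lemma dset_empty: "N \<le> n \<Longrightarrow> dset N (n, j) = {}"
  by (auto simp: dset_def desc_def tiles_def)

lemma desc_child_iff:
  "desc (n, j) R \<longleftrightarrow> R = (n, j) \<or> desc (Suc n, 2*j) R \<or> desc (Suc n, 2*j+1) R"
proof -
  obtain m k where R: "R = (m, k)" by (cases R)
  consider "m < n" | "m = n" | "n < m" by linarith
  then show ?thesis
  proof cases
    case 3
    then obtain d where d: "m = Suc (n + d)" using less_iff_Suc_add by auto
    have "k div 2 ^ Suc d = k div 2 ^ d div 2" by (simp add: div_mult2_eq[symmetric] mult.commute)
    then show ?thesis by (auto simp: desc_def R d)
  qed (auto simp: desc_def R)
qed

lemma dset_split:
  assumes "(n, j) \<in> tiles N"
  shows "dset N (n, j) = insert (n, j) (dset N (Suc n, 2*j) \<union> dset N (Suc n, 2*j+1))"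
    and "(n, j) \<notin> dset N (Suc n, 2*j) \<union> dset N (Suc n, 2*j+1)"
    and "dset N (Suc n, 2*j) \<inter> dset N (Suc n, 2*j+1) = {}"
  using assms desc_child_iff[of n j] by (auto simp: dset_def) (auto simp: desc_def)

definition dsum :: "nat \<Rightarrow> (nat \<times> nat \<Rightarrow> real) \<Rightarrow> nat \<times> nat \<Rightarrow> real" where
  "dsum N f Q = (\<Sum>R\<in>dset N Q. f R)"

lemma dsum_zero: "N \<le> n \<Longrightarrow> dsum N f (n, j) = 0"
  by (simp add: dsum_def dset_empty)

lemma dsum_split:
  assumes "(n, j) \<in> tiles N"
  shows "dsum N f (n, j) = f (n, j) + dsum N f (Suc n, 2*j) + dsum N f (Suc n, 2*j+1)"
  unfolding dsum_def dset_split(1)[OF assms]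
  using dset_split(2,3)[OF assms] by (subst sum.insert) (auto simp: sum.union_disjoint)

lemma child_tiles: "(n, j) \<in> tiles N \<Longrightarrow> Suc n < N \<Longrightarrow> (Suc n, 2*j) \<in> tiles N \<and> (Suc n, 2*j+1) \<in> tiles N"
  by (auto simp: tiles_def)

lemma dsum_nonneg: "(\<And>R. R \<in> tiles N \<Longrightarrow> 0 \<le> f R) \<Longrightarrow> 0 \<le> dsum N f Q"
  unfolding dsum_def by (intro sum_nonneg) (auto simp: dset_def)

text \<open>Induction from the leaves to the root, on the number \<open>N - n\<close> of remaining
  generations. Nodes beyond the truncation serve as base cases because their subtrees are
  empty.\<close>

lemma tree_induct:
  assumes leaf: "\<And>n j. N \<le> n \<Longrightarrow> P (n, j)"
    and step: "\<And>n j. (n, j) \<in> tiles N \<Longrightarrow> P (Suc n, 2*j) \<Longrightarrow> P (Suc n, 2*j+1) \<Longrightarrow> P (n, j)"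
    and Q: "j < 2 ^ n"
  shows "P (n, j)"
  using Q
proof (induction "N - n" arbitrary: n j)
  case 0
  then show ?case by (simp add: leaf)
next
  case (Suc d)
  then have n: "n < N" by simp
  show ?case
  proof (rule step)
    show "(n, j) \<in> tiles N" using n Suc by (simp add: tiles_def)
    show "P (Suc n, 2*j)" "P (Suc n, 2*j+1)" using Suc by (auto intro!: Suc.hyps)
  qed
qed

text \<open>A positive sequence on the tree whose sum over every subtree is controlled by the value at
  its root: the two child subtrees then carry at most the fraction \<open>1 - 1/C\<close> of the total, so all
  quantities decay geometrically in the generation.\<close>

definition subtree_bounded :: "real \<Rightarrow> nat \<Rightarrow> (nat \<times> nat \<Rightarrow> real) \<Rightarrow> bool" where
  "subtree_bounded C N a \<longleftrightarrow> (\<forall>R\<in>tiles N. 0 < a R \<and> dsum N a R \<le> C * a R)"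

lemma dsum_children_le:
  assumes a: "\<And>R. R \<in> tiles N \<Longrightarrow> 0 < a R" and C: "1 \<le> C" and root: "\<And>R. R \<in> tiles N \<Longrightarrow> dsum N a R \<le> C * a R"
    and Q: "(n, j) \<in> tiles N"
  shows "dsum N a (Suc n, 2*j) + dsum N a (Suc n, 2*j+1) \<le> (1 - 1/C) * dsum N a (n, j)"
proof -
  have "dsum N a (n, j) / C \<le> a (n, j)" using root[OF Q] C by (simp add: divide_le_eq mult.commute)
  moreover have "(1 - 1/C) * dsum N a (n, j) = dsum N a (n, j) - dsum N a (n, j) / C" by (simp add: left_diff_distrib)
  ultimately show ?thesis using dsum_split[OF Q, of a] by linarith
qed

lemma root_le_dsum:
  assumes a: "\<And>R. R \<in> tiles N \<Longrightarrow> 0 < a R" and Q: "Q \<in> tiles N" shows "a Q \<le> dsum N a Q"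
proof -
  have "sum a {Q} \<le> sum a (dset N Q)" using a Q by (intro sum_mono2) (auto simp: dset_def less_imp_le)
  then show ?thesis by (simp add: dsum_def)
qed

text \<open>Passing to the power \<open>1 - \<eta>\<close> spoils additivity over the two children
  by at most the factor \<open>2 powr \<eta>\<close>, while the decay contributes
  \<open>\<theta> powr (1 - \<eta>)\<close>. The product tends to \<open>\<theta> < 1\<close> as
  \<open>\<eta>\<close> tends to 0, so for small \<open>\<eta>\<close> the sum over the subtree is
  still geometric.\<close>

lemma tree_power_sum:
  fixes C :: real assumes C: "2 \<le> C"
  obtains \<eta> K where "0 < \<eta>" "\<eta> < 1" "0 < K"
    "\<forall>N a Q. subtree_bounded C N a \<longrightarrow> Q \<in> tiles N
       \<longrightarrow> dsum N (\<lambda>R. a R powr (1 - \<eta>)) Q \<le> K * a Q powr (1 - \<eta>)"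
proof -
  define \<theta> where "\<theta> = 1 - 1/C"
  have \<theta>: "0 < \<theta>" "\<theta> < 1" using C by (auto simp: \<theta>_def)
  have "((\<lambda>\<eta>. 2 powr \<eta> * \<theta> powr (1 - \<eta>)) \<longlongrightarrow> 2 powr 0 * \<theta> powr (1 - 0)) (at_right (0::real))"
    using \<theta> by (intro tendsto_intros) auto
  then have "eventually (\<lambda>\<eta>. 2 powr \<eta> * \<theta> powr (1 - \<eta>) < 1) (at_right (0::real))"
    using \<theta> by (intro order_tendstoD(2)) auto
  moreover have "eventually (\<lambda>\<eta>. \<eta> \<in> {0<..<1}) (at_right (0::real))"
    by (rule eventually_at_right_real) simp
  ultimately have "eventually (\<lambda>\<eta>. 2 powr \<eta> * \<theta> powr (1 - \<eta>) < 1 \<and> \<eta> \<in> {0<..<1}) (at_right (0::real))"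
    by (rule eventually_conj)
  then obtain \<eta> :: real where \<eta>: "2 powr \<eta> * \<theta> powr (1 - \<eta>) < 1" "0 < \<eta>" "\<eta> < 1"
    using eventually_happens[of _ "at_right (0::real)"] by (auto simp: trivial_limit_at_right_real)
  define \<kappa> where "\<kappa> = 2 powr \<eta> * \<theta> powr (1 - \<eta>)"
  \<comment> \<open>The fixed point of \<open>K = 1 + K * \<kappa>\<close>: one term for the root
    and \<open>K * \<kappa>\<close> for the two child subtrees.\<close>
  define K where "K = 1 / (1 - \<kappa>)"
  have K: "K > 0" "1 + K * \<kappa> = K" using \<eta> by (auto simp: K_def \<kappa>_def field_simps)
  have two: "x powr (1 - \<eta>) + y powr (1 - \<eta>) \<le> 2 powr \<eta> * (x + y) powr (1 - \<eta>)" if "0 \<le> x" "0 \<le> y" for x y :: real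
    using Holder_sum_powr[of "1 - \<eta>" \<eta> "UNIV::bool set" "\<lambda>b. if b then x else y" "\<lambda>_. 1"] \<eta> that
    by (simp add: UNIV_bool add.commute mult.commute)
  show thesis
  proof (rule that[of \<eta> "K * C powr (1 - \<eta>)"]; (intro allI impI)?)
    fix N and a :: "nat \<times> nat \<Rightarrow> real" and Q
    assume "subtree_bounded C N a" and Q: "Q \<in> tiles N"
    then have a: "\<And>R. R \<in> tiles N \<Longrightarrow> 0 < a R" and root: "\<And>R. R \<in> tiles N \<Longrightarrow> dsum N a R \<le> C * a R"
      by (auto simp: subtree_bounded_def)
    have A0: "0 \<le> dsum N a R" for R using a by (intro dsum_nonneg) (auto simp: less_imp_le)
    have *: "dsum N (\<lambda>R. a R powr (1 - \<eta>)) (n, j) \<le> K * dsum N a (n, j) powr (1 - \<eta>)" if "j < 2 ^ n" for n j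
    proof (rule tree_induct[OF _ _ that])
      fix n j assume Q: "(n, j) \<in> tiles N"
       and IH: "dsum N (\<lambda>R. a R powr (1 - \<eta>)) (Suc n, 2*j) \<le> K * dsum N a (Suc n, 2*j) powr (1 - \<eta>)"
         "dsum N (\<lambda>R. a R powr (1 - \<eta>)) (Suc n, 2*j+1) \<le> K * dsum N a (Suc n, 2*j+1) powr (1 - \<eta>)"
      have "dsum N (\<lambda>R. a R powr (1 - \<eta>)) (n, j) \<le> a (n, j) powr (1 - \<eta>) + K * (dsum N a (Suc n, 2*j) powr (1 - \<eta>) + dsum N a (Suc n, 2*j+1) powr (1 - \<eta>))"
        unfolding dsum_split[OF Q] distrib_left using IH by linarith
      also have "\<dots> \<le> dsum N a (n, j) powr (1 - \<eta>) + K * (2 powr \<eta> * (\<theta> * dsum N a (n, j)) powr (1 - \<eta>))"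
      proof (intro add_mono mult_left_mono)
        show "a (n, j) powr (1 - \<eta>) \<le> dsum N a (n, j) powr (1 - \<eta>)"
          using root_le_dsum[OF a Q] a[OF Q] \<eta> by (intro powr_mono2) auto
        have "dsum N a (Suc n, 2*j) powr (1 - \<eta>) + dsum N a (Suc n, 2*j+1) powr (1 - \<eta>) \<le> 2 powr \<eta> * (dsum N a (Suc n, 2*j) + dsum N a (Suc n, 2*j+1)) powr (1 - \<eta>)"
          by (intro two A0)
        also have "\<dots> \<le> 2 powr \<eta> * (\<theta> * dsum N a (n, j)) powr (1 - \<eta>)"
          using dsum_children_le[OF a _ root Q] C \<eta> A0 unfolding \<theta>_def
          by (intro mult_left_mono powr_mono2) auto
        finally show "dsum N a (Suc n, 2*j) powr (1 - \<eta>) + dsum N a (Suc n, 2*j+1) powr (1 - \<eta>) \<le> 2 powr \<eta> * (\<theta> * dsum N a (n, j)) powr (1 - \<eta>)" .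
      qed (use K in auto)
      also have "\<dots> = (1 + K * \<kappa>) * dsum N a (n, j) powr (1 - \<eta>)"
        using \<theta> A0 by (simp add: powr_mult \<kappa>_def algebra_simps)
      finally show "dsum N (\<lambda>R. a R powr (1 - \<eta>)) (n, j) \<le> K * dsum N a (n, j) powr (1 - \<eta>)" using K by simp
    qed (simp add: dsum_zero)
    have "dsum N (\<lambda>R. a R powr (1 - \<eta>)) Q \<le> K * dsum N a Q powr (1 - \<eta>)"
      using * Q by (cases Q) (auto simp: tiles_def)
    also have "\<dots> \<le> K * (C * a Q) powr (1 - \<eta>)"
      using K \<eta> A0 root[OF Q] by (intro mult_left_mono powr_mono2) auto
    finally show "dsum N (\<lambda>R. a R powr (1 - \<eta>)) Q \<le> K * C powr (1 - \<eta>) * a Q powr (1 - \<eta>)"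
      using C a[OF Q] by (simp add: powr_mult mult_ac)
  qed (use \<eta> K C in auto)
qed

lemma desc_set_eq:
  "{Q \<in> tiles N. desc Q (m, k)} \<subseteq> (\<lambda>i. (i, k div 2 ^ (m - i))) ` {..m}"
  by (auto simp: desc_def image_iff)

text \<open>Climbing from \<open>R\<close> by one generation enlarges the subtree sum at least by
  the factor \<open>1/\<theta>\<close>, and subtree sums are comparable to the values at their
  roots. Negative powers along the chain of ancestors are therefore dominated by a geometric series
  starting at \<open>R\<close>.\<close>

lemma tree_ancestor_sum:
  fixes C \<epsilon> :: real assumes C: "2 \<le> C" and \<epsilon>: "0 < \<epsilon>"
  obtains K where "0 < K"
    "\<forall>N a R. subtree_bounded C N a \<longrightarrow> R \<in> tiles N
       \<longrightarrow> (\<Sum>Q | Q \<in> tiles N \<and> desc Q R. a Q powr (-\<epsilon>)) \<le> K * a R powr (-\<epsilon>)"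
proof -
  define \<theta> where "\<theta> = 1 - 1/C"
  have \<theta>: "0 < \<theta>" "\<theta> < 1" using C by (auto simp: \<theta>_def)
  define r where "r = \<theta> powr \<epsilon>"
  have r: "0 < r" "r < 1" using \<theta> \<epsilon> by (auto simp: r_def powr01_less_one)
  show thesis
  proof (rule that[of "C powr \<epsilon> / (1 - r)"]; (intro allI impI)?)
    fix N and a :: "nat \<times> nat \<Rightarrow> real" and R
    assume "subtree_bounded C N a" and R: "R \<in> tiles N"
    then have a: "\<And>R. R \<in> tiles N \<Longrightarrow> 0 < a R" and root: "\<And>R. R \<in> tiles N \<Longrightarrow> dsum N a R \<le> C * a R"
      by (auto simp: subtree_bounded_def)
    obtain m k where mk: "R = (m, k)" by (cases R)
    have mN: "m < N" and k: "k < 2 ^ m" using R by (auto simp: mk tiles_def)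
    define A where "A i = (i, k div 2 ^ (m - i))" for i
    have At: "A i \<in> tiles N" if "i \<le> m" for i
    proof -
      have "k div 2 ^ (m - i) < 2 ^ i" using k that by (simp add: less_mult_imp_div_less mult.commute power_add[symmetric])
      then show ?thesis using that mN by (simp add: A_def tiles_def)
    qed
    have A0: "0 \<le> dsum N a R" for R using a by (intro dsum_nonneg) (auto simp: less_imp_le)
    have step: "dsum N a (A (Suc i)) \<le> \<theta> * dsum N a (A i)" if "i < m" for i
    proof -
      obtain d where d: "m = Suc (i + d)" using less_imp_Suc_add[OF \<open>i < m\<close>] by auto
      have "k div 2 ^ Suc d = k div 2 ^ d div 2" by (simp add: div_mult2_eq[symmetric] mult.commute)
      then have "A (Suc i) = (Suc i, 2 * snd (A i)) \<or> A (Suc i) = (Suc i, 2 * snd (A i) + 1)"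
        by (auto simp: A_def d)
      moreover have "dsum N a (Suc i, 2 * snd (A i)) + dsum N a (Suc i, 2 * snd (A i) + 1) \<le> \<theta> * dsum N a (i, snd (A i))"
        unfolding \<theta>_def using At[of i] that C by (intro dsum_children_le a root) (auto simp: A_def)
      ultimately show ?thesis using A0[of "(Suc i, 2 * snd (A i))"] A0[of "(Suc i, 2 * snd (A i) + 1)"]
        by (auto simp: A_def)
    qed
    have chain: "dsum N a R \<le> \<theta> ^ (m - i) * dsum N a (A i)" if "i \<le> m" for i
      using that
    proof (induction rule: inc_induct)
      case base
      show ?case by (simp add: A_def mk)
    next
      case (step i)
      note step(3)
      also have "\<theta> ^ (m - Suc i) * dsum N a (A (Suc i)) \<le> \<theta> ^ (m - Suc i) * (\<theta> * dsum N a (A i))"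
        using \<theta> \<open>i < m\<close> by (intro mult_left_mono \<open>\<And>i. i < m \<Longrightarrow> dsum N a (A (Suc i)) \<le> \<theta> * dsum N a (A i)\<close>) auto
      also have "\<dots> = \<theta> ^ (m - i) * dsum N a (A i)"
        using \<open>i < m\<close> by (simp add: Suc_diff_Suc[symmetric] mult_ac)
      finally show ?case .
    qed
    have trm: "a (A i) powr (-\<epsilon>) \<le> C powr \<epsilon> * a R powr (-\<epsilon>) * r ^ (m - i)" if i: "i \<le> m" for i
    proof -
      have "a R \<le> dsum N a R" by (rule root_le_dsum[OF a R])
      also note chain[OF i]
      also have "\<theta> ^ (m - i) * dsum N a (A i) \<le> \<theta> ^ (m - i) * (C * a (A i))"
        using \<theta> by (intro mult_left_mono root At i) auto
      finally have "a R \<le> (\<theta> ^ (m - i) * C) * a (A i)" by (simp add: mult_ac)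
      then have "a R powr \<epsilon> \<le> ((\<theta> ^ (m - i) * C) * a (A i)) powr \<epsilon>"
        using a[OF R] \<epsilon> by (intro powr_mono2) auto
      also have "\<dots> = r ^ (m - i) * C powr \<epsilon> * a (A i) powr \<epsilon>"
        using \<theta> C a[OF At[OF i]] by (simp add: powr_mult r_def powr_powr mult_ac flip: powr_realpow)
      finally show ?thesis using a[OF R] a[OF At[OF i]] by (simp add: powr_minus field_simps)
    qed
    have "(\<Sum>Q | Q \<in> tiles N \<and> desc Q R. a Q powr (-\<epsilon>)) \<le> (\<Sum>Q\<in>A ` {..m}. a Q powr (-\<epsilon>))"
      using desc_set_eq[of N m k] unfolding mk A_def by (intro sum_mono2) auto
    also have "\<dots> = (\<Sum>i\<le>m. a (A i) powr (-\<epsilon>))"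
      by (subst sum.reindex) (auto simp: inj_on_def A_def)
    also have "\<dots> \<le> (\<Sum>i\<le>m. C powr \<epsilon> * a R powr (-\<epsilon>) * r ^ (m - i))"
      by (intro sum_mono trm) auto
    also have "\<dots> = C powr \<epsilon> * a R powr (-\<epsilon>) * (\<Sum>i\<le>m. r ^ i)"
      by (subst sum.nat_diff_reindex[of _ "Suc m", symmetric, simplified lessThan_Suc_atMost])
         (simp add: sum_distrib_left)
    also have "\<dots> \<le> C powr \<epsilon> * a R powr (-\<epsilon>) * (1 / (1 - r))"
      using r by (intro mult_left_mono, subst sum_gp0) (auto intro!: divide_right_mono)
    finally show "(\<Sum>Q | Q \<in> tiles N \<and> desc Q R. a Q powr (-\<epsilon>)) \<le> C powr \<epsilon> / (1 - r) * a R powr (-\<epsilon>)"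
      by (simp add: mult_ac)
  qed (use r C in auto)
qed

section \<open>Kernels adapted to a sequence on the tree\<close>

definition tree_kernel :: "real \<Rightarrow> (nat \<times> nat \<Rightarrow> real) \<Rightarrow> nat \<times> nat \<Rightarrow> nat \<times> nat \<Rightarrow> real" where
  "tree_kernel \<theta> a A Q = (if desc Q A then (a A / a Q) powr \<theta> else 0)"

lemma tree_kernel_nonneg: "0 \<le> tree_kernel \<theta> a A Q" by (simp add: tree_kernel_def)

lemma tree_kernel_column:
  assumes a: "\<And>R. R \<in> tiles N \<Longrightarrow> 0 < a R" and Q: "Q \<in> tiles N"
    and sum: "dsum N (\<lambda>R. a R powr (1 - \<eta>)) Q \<le> K * a Q powr (1 - \<eta>)"
  shows "(\<Sum>A\<in>tiles N. tree_kernel \<theta> a A Q * a A powr (1 - \<eta> - \<theta>)) \<le> K * a Q powr (1 - \<eta> - \<theta>)"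
proof -
  have "(\<Sum>A\<in>tiles N. tree_kernel \<theta> a A Q * a A powr (1 - \<eta> - \<theta>)) = (\<Sum>A\<in>dset N Q. (a A / a Q) powr \<theta> * a A powr (1 - \<eta> - \<theta>))"
    unfolding dset_def by (subst sum.inter_filter) (auto simp: tree_kernel_def intro!: sum.cong)
  also have "\<dots> = a Q powr (-\<theta>) * dsum N (\<lambda>R. a R powr (1 - \<eta>)) Q"
    unfolding dsum_def sum_distrib_left
  proof (rule sum.cong[OF refl])
    fix A assume "A \<in> dset N Q"
    then have "a A > 0" using a by (simp add: dset_def)
    then show "(a A / a Q) powr \<theta> * a A powr (1 - \<eta> - \<theta>) = a Q powr (-\<theta>) * a A powr (1 - \<eta>)"
      using a[OF Q] by (simp add: powr_divide powr_minus powr_diff powr_add field_simps)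
  qed
  also have "\<dots> \<le> a Q powr (-\<theta>) * (K * a Q powr (1 - \<eta>))"
    by (intro mult_left_mono sum) auto
  also have "\<dots> = K * a Q powr (1 - \<eta> - \<theta>)" using a[OF Q] by (simp add: powr_minus powr_diff powr_add field_simps)
  finally show ?thesis .
qed

lemma tree_kernel_row:
  assumes a: "\<And>R. R \<in> tiles N \<Longrightarrow> 0 < a R" and A: "A \<in> tiles N"
    and sum: "(\<Sum>Q | Q \<in> tiles N \<and> desc Q A. a Q powr (-(\<theta> - e))) \<le> K * a A powr (-(\<theta> - e))"
  shows "(\<Sum>Q\<in>tiles N. tree_kernel \<theta> a A Q * a Q powr e) \<le> K * a A powr e"
proof -
  have "(\<Sum>Q\<in>tiles N. tree_kernel \<theta> a A Q * a Q powr e) = (\<Sum>Q | Q \<in> tiles N \<and> desc Q A. (a A / a Q) powr \<theta> * a Q powr e)"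
    by (subst sum.inter_filter) (auto simp: tree_kernel_def intro!: sum.cong)
  also have "\<dots> = a A powr \<theta> * (\<Sum>Q | Q \<in> tiles N \<and> desc Q A. a Q powr (-(\<theta> - e)))"
    unfolding sum_distrib_left
  proof (rule sum.cong[OF refl])
    fix Q assume "Q \<in> {Q \<in> tiles N. desc Q A}"
    then have "a Q > 0" using a by simp
    then show "(a A / a Q) powr \<theta> * a Q powr e = a A powr \<theta> * a Q powr (-(\<theta> - e))"
      using a[OF A] by (simp add: powr_divide powr_diff field_simps)
  qed
  also have "\<dots> \<le> a A powr \<theta> * (K * a A powr (-(\<theta> - e)))"
    by (intro mult_left_mono sum) auto
  also have "\<dots> = K * a A powr e" using a[OF A] by (simp add: powr_diff field_simps)
  finally show ?thesis .
qed

text \<open>Both bounds are Schur tests with a power \<open>a powr \<gamma>\<close> as test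
  sequence. A sum over descendants is handled by \<open>tree_power_sum\<close>, a sum over ancestors
  by \<open>tree_ancestor_sum\<close>; \<open>\<eta>\<close> supplies the strict room that the
  second needs. The first bound concerns distributing from \<open>Q\<close> down to
  \<open>A\<close>, the second collecting from \<open>B\<close> up to \<open>Q\<close>.\<close>

lemma tree_kernel_bounded:
  assumes p: "1 < p" "1/p + 1/q = 1" and C: "2 \<le> (C::real)"
  obtains K where "0 < K"
    "\<forall>N a x. subtree_bounded C N a \<longrightarrow> (\<forall>R\<in>tiles N. 0 \<le> x R)
       \<longrightarrow> (\<Sum>A\<in>tiles N. (\<Sum>Q\<in>tiles N. tree_kernel (1/p) a A Q * x Q) powr p) \<le> K * (\<Sum>Q\<in>tiles N. x Q powr p)"
    "\<forall>N a x. subtree_bounded C N a \<longrightarrow> (\<forall>R\<in>tiles N. 0 \<le> x R)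
       \<longrightarrow> (\<Sum>Q\<in>tiles N. (\<Sum>B\<in>tiles N. tree_kernel (1/q) a B Q * x B) powr p) \<le> K * (\<Sum>B\<in>tiles N. x B powr p)"
proof -
  have q: "q > 0"
  proof -
    have "1/p < 1" using p by simp
    then have "0 < 1/q" using p(2) by linarith
    then show ?thesis by (simp only: zero_less_divide_1_iff)
  qed
  have pp: "p > 0" using p by simp
  obtain \<eta> K1 where \<eta>: "0 < \<eta>" "\<eta> < 1" "0 < K1" and K1:
    "\<forall>N a Q. subtree_bounded C N a \<longrightarrow> Q \<in> tiles N
       \<longrightarrow> dsum N (\<lambda>R. a R powr (1 - \<eta>)) Q \<le> K1 * a Q powr (1 - \<eta>)"
    using tree_power_sum[OF C] .
  obtain K2 where "0 < K2" and K2: "\<forall>N a R. subtree_bounded C N a \<longrightarrow> R \<in> tiles N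
       \<longrightarrow> (\<Sum>Q | Q \<in> tiles N \<and> desc Q R. a Q powr (-(\<eta> * q / p))) \<le> K2 * a R powr (-(\<eta> * q / p))"
    using tree_ancestor_sum[OF C, of "\<eta> * q / p", OF divide_pos_pos[OF mult_pos_pos[OF \<eta>(1) q] pp]] .
  obtain K3 where "0 < K3" and K3: "\<forall>N a R. subtree_bounded C N a \<longrightarrow> R \<in> tiles N
       \<longrightarrow> (\<Sum>Q | Q \<in> tiles N \<and> desc Q R. a Q powr (-(\<eta> * p / q))) \<le> K3 * a R powr (-(\<eta> * p / q))"
    using tree_ancestor_sum[OF C, of "\<eta> * p / q", OF divide_pos_pos[OF mult_pos_pos[OF \<eta>(1) pp] q]] .
  define K where "K = max (K2 powr (p/q) * K1) (K1 powr (p/q) * K3)"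
  show thesis
  proof (rule that[of K]; (intro allI impI)?)
    show "0 < K" using \<open>0 < K1\<close> \<open>0 < K2\<close> by (simp add: K_def less_max_iff_disj)
    fix N and a x :: "nat \<times> nat \<Rightarrow> real"
    assume sb: "subtree_bounded C N a" and "\<forall>R\<in>tiles N. 0 \<le> x R"
    then have a: "\<And>R. R \<in> tiles N \<Longrightarrow> 0 < a R" and x: "\<And>R. R \<in> tiles N \<Longrightarrow> 0 \<le> x R" by (auto simp: subtree_bounded_def)
    have xs: "0 \<le> (\<Sum>Q\<in>tiles N. x Q powr p)" by (intro sum_nonneg) auto
    have "(\<Sum>A\<in>tiles N. (\<Sum>Q\<in>tiles N. tree_kernel (1/p) a A Q * x Q) powr p) \<le> K2 powr (p/q) * K1 * (\<Sum>Q\<in>tiles N. x Q powr p)"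
    proof (rule Schur_test[OF p])
      \<comment> \<open>Chosen so that \<open>\<gamma> * p\<close> is the exponent
        \<open>1 - \<eta> - 1/p\<close> of the column lemma; the ancestors then carry the exponent
        \<open>1/p - \<gamma> * q = \<eta> * q / p\<close>, which is positive and is the one of
        \<open>K2\<close>.\<close>
      define \<gamma> where "\<gamma> = (1/q - \<eta>) / p"
      have "\<gamma> * q = 1/p - \<eta> * q / p" using q pp by (simp add: \<gamma>_def field_simps)
      moreover have "\<gamma> * p = 1/q - \<eta>" using pp by (simp add: \<gamma>_def)
      ultimately have g: "\<gamma> * q = 1/p - \<eta> * q / p" "\<gamma> * p = 1 - \<eta> - 1/p" using p(2) by linarith+
      show "0 < a i powr \<gamma>" if "i \<in> tiles N" for i using a[OF that] by simp
      then show "0 < a i powr \<gamma>" if "i \<in> tiles N" for i using that .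
      show "(\<Sum>Q\<in>tiles N. tree_kernel (1/p) a A Q * (a Q powr \<gamma>) powr q) \<le> K2 * (a A powr \<gamma>) powr q" if "A \<in> tiles N" for A
        unfolding powr_powr by (rule tree_kernel_row[OF a that]) (simp_all add: g K2[rule_format, OF sb that])
      show "(\<Sum>A\<in>tiles N. tree_kernel (1/p) a A Q * (a A powr \<gamma>) powr p) \<le> K1 * (a Q powr \<gamma>) powr p" if "Q \<in> tiles N" for Q
        unfolding powr_powr g by (rule tree_kernel_column[OF a that]) (simp_all add: K1[rule_format, OF sb that])
    qed (use \<open>0 < K1\<close> \<open>0 < K2\<close> x tree_kernel_nonneg in auto)
    also have "\<dots> \<le> K * (\<Sum>Q\<in>tiles N. x Q powr p)" by (intro mult_right_mono xs) (simp add: K_def)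
    finally show "(\<Sum>A\<in>tiles N. (\<Sum>Q\<in>tiles N. tree_kernel (1/p) a A Q * x Q) powr p) \<le> K * (\<Sum>Q\<in>tiles N. x Q powr p)" .
    have "(\<Sum>Q\<in>tiles N. (\<Sum>B\<in>tiles N. tree_kernel (1/q) a B Q * x B) powr p) \<le> K1 powr (p/q) * K3 * (\<Sum>B\<in>tiles N. x B powr p)"
    proof (rule Schur_test[OF p])
      \<comment> \<open>Rows and columns have exchanged their roles, so now
        \<open>\<gamma> * q\<close> is prescribed by the column lemma.\<close>
      define \<gamma> where "\<gamma> = (1/p - \<eta>) / q"
      have "\<gamma> * p = 1/q - \<eta> * p / q" using q pp by (simp add: \<gamma>_def field_simps)
      moreover have "\<gamma> * q = 1/p - \<eta>" using q by (simp add: \<gamma>_def)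
      ultimately have g: "\<gamma> * q = 1 - \<eta> - 1/q" "\<gamma> * p = 1/q - \<eta> * p / q" using p(2) by linarith+
      show "0 < a i powr \<gamma>" if "i \<in> tiles N" for i using a[OF that] by simp
      then show "0 < a i powr \<gamma>" if "i \<in> tiles N" for i using that .
      show "(\<Sum>B\<in>tiles N. tree_kernel (1/q) a B Q * (a B powr \<gamma>) powr q) \<le> K1 * (a Q powr \<gamma>) powr q" if "Q \<in> tiles N" for Q
        unfolding powr_powr g by (rule tree_kernel_column[OF a that]) (simp_all add: K1[rule_format, OF sb that])
      show "(\<Sum>Q\<in>tiles N. tree_kernel (1/q) a B Q * (a Q powr \<gamma>) powr p) \<le> K3 * (a B powr \<gamma>) powr p" if "B \<in> tiles N" for B
        unfolding powr_powr by (rule tree_kernel_row[OF a that]) (simp_all add: g K3[rule_format, OF sb that])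
    qed (use \<open>0 < K1\<close> \<open>0 < K3\<close> x tree_kernel_nonneg in auto)
    also have "\<dots> \<le> K * (\<Sum>Q\<in>tiles N. x Q powr p)" by (intro mult_right_mono xs) (simp add: K_def)
    finally show "(\<Sum>Q\<in>tiles N. (\<Sum>B\<in>tiles N. tree_kernel (1/q) a B Q * x B) powr p) \<le> K * (\<Sum>B\<in>tiles N. x B powr p)" .
  qed
qed

text \<open>The operator is dominated by a product of three maps: collect \<open>x\<close> from
  \<open>B\<close> to its ancestors \<open>Q'\<close> with the kernel of \<open>S\<close>, pass to
  the related nodes \<open>Q\<close>, and distribute to the descendants \<open>A\<close> with the
  kernel of \<open>W\<close>. The balance between \<open>L\<close>, \<open>W\<close> and
  \<open>S\<close> at related pairs is what turns the coefficients into these kernels.\<close>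

lemma tree_operator_bounded:
  fixes E :: "nat \<times> nat \<Rightarrow> nat \<times> nat \<Rightarrow> bool"
  assumes p: "1 < p" "1/p + 1/q = 1" and C: "2 \<le> (C::real)" and C0: "0 < C0"
    and E: "\<And>N Q. card {Q' \<in> tiles N. E Q Q'} \<le> d" "\<And>N Q'. card {Q \<in> tiles N. E Q Q'} \<le> d"
  obtains K where "0 < K"
    "\<forall>N W S L x. subtree_bounded C N W \<longrightarrow> subtree_bounded C N S \<longrightarrow>
      (\<forall>Q\<in>tiles N. \<forall>Q'\<in>tiles N. E Q Q' \<longrightarrow> L Q * (W Q powr (1/p) * S Q' powr (1/q)) \<le> C0) \<longrightarrow>
      (\<forall>R\<in>tiles N. 0 \<le> L R \<and> 0 \<le> x R)
       \<longrightarrow> (\<Sum>A\<in>tiles N. (W A powr (1/p) * (\<Sum>Q\<in>tiles N. \<Sum>Q'\<in>tiles N. \<Sum>B\<in>tiles N.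
               if desc Q A \<and> E Q Q' \<and> desc Q' B then L Q * (S B powr (1/q) * x B) else 0)) powr p)
           \<le> K * (\<Sum>B\<in>tiles N. x B powr p)"
proof -
  obtain K where K: "0 < K" and
    K1: "\<forall>N a x. subtree_bounded C N a \<longrightarrow> (\<forall>R\<in>tiles N. 0 \<le> x R)
       \<longrightarrow> (\<Sum>A\<in>tiles N. (\<Sum>Q\<in>tiles N. tree_kernel (1/p) a A Q * x Q) powr p) \<le> K * (\<Sum>Q\<in>tiles N. x Q powr p)" and
    K2: "\<forall>N a x. subtree_bounded C N a \<longrightarrow> (\<forall>R\<in>tiles N. 0 \<le> x R)
       \<longrightarrow> (\<Sum>Q\<in>tiles N. (\<Sum>B\<in>tiles N. tree_kernel (1/q) a B Q * x B) powr p) \<le> K * (\<Sum>B\<in>tiles N. x B powr p)"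
    using tree_kernel_bounded[OF p C] .
  define d' where "d' = real d + 1"
  have d': "0 < d'" "real d \<le> d'" by (auto simp: d'_def)
  show thesis
  proof (rule that[of "C0 powr p * (K * (d' powr (p/q) * d' * K))"]; (intro allI impI)?)
    show "0 < C0 powr p * (K * (d' powr (p/q) * d' * K))" using K C0 d' by simp
    fix N and W S L x :: "nat \<times> nat \<Rightarrow> real"
    assume sb: "subtree_bounded C N W" "subtree_bounded C N S"
      and "\<forall>Q\<in>tiles N. \<forall>Q'\<in>tiles N. E Q Q' \<longrightarrow> L Q * (W Q powr (1/p) * S Q' powr (1/q)) \<le> C0"
        "\<forall>R\<in>tiles N. 0 \<le> L R \<and> 0 \<le> x R"
    then have W: "\<And>R. R \<in> tiles N \<Longrightarrow> 0 < W R" and S: "\<And>R. R \<in> tiles N \<Longrightarrow> 0 < S R"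
     and L: "\<And>Q Q'. Q \<in> tiles N \<Longrightarrow> Q' \<in> tiles N \<Longrightarrow> E Q Q' \<Longrightarrow> L Q * (W Q powr (1/p) * S Q' powr (1/q)) \<le> C0"
     and L0: "\<And>R. R \<in> tiles N \<Longrightarrow> 0 \<le> L R" and x: "\<And>R. R \<in> tiles N \<Longrightarrow> 0 \<le> x R"
      by (auto simp: subtree_bounded_def)
    let ?T = "tiles N"
    define y where "y Q' = (\<Sum>B\<in>?T. tree_kernel (1/q) S B Q' * x B)" for Q'
    define v where "v Q = (\<Sum>Q'\<in>?T. (if E Q Q' then 1 else 0) * y Q')" for Q
    have y0: "0 \<le> y Q'" for Q' unfolding y_def by (intro sum_nonneg mult_nonneg_nonneg tree_kernel_nonneg x)
    have v0: "0 \<le> v Q" for Q unfolding v_def by (intro sum_nonneg mult_nonneg_nonneg y0) auto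
    have pt: "W A powr (1/p) * (\<Sum>Q\<in>?T. \<Sum>Q'\<in>?T. \<Sum>B\<in>?T. if desc Q A \<and> E Q Q' \<and> desc Q' B then L Q * (S B powr (1/q) * x B) else 0)
        \<le> C0 * (\<Sum>Q\<in>?T. tree_kernel (1/p) W A Q * v Q)" if A: "A \<in> ?T" for A
    proof -
      have "W A powr (1/p) * (\<Sum>Q\<in>?T. \<Sum>Q'\<in>?T. \<Sum>B\<in>?T. if desc Q A \<and> E Q Q' \<and> desc Q' B then L Q * (S B powr (1/q) * x B) else 0)
        = (\<Sum>Q\<in>?T. \<Sum>Q'\<in>?T. \<Sum>B\<in>?T. W A powr (1/p) * (if desc Q A \<and> E Q Q' \<and> desc Q' B then L Q * (S B powr (1/q) * x B) else 0))"
        by (simp only: sum_distrib_left)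
      also have "\<dots> \<le> (\<Sum>Q\<in>?T. \<Sum>Q'\<in>?T. \<Sum>B\<in>?T. C0 * (tree_kernel (1/p) W A Q * ((if E Q Q' then 1 else 0) * (tree_kernel (1/q) S B Q' * x B))))"
      proof (intro sum_mono)
        fix Q Q' B assume Q: "Q \<in> ?T" "Q' \<in> ?T" "B \<in> ?T"
        show "W A powr (1/p) * (if desc Q A \<and> E Q Q' \<and> desc Q' B then L Q * (S B powr (1/q) * x B) else 0)
          \<le> C0 * (tree_kernel (1/p) W A Q * ((if E Q Q' then 1 else 0) * (tree_kernel (1/q) S B Q' * x B)))"
        proof (cases "desc Q A \<and> E Q Q' \<and> desc Q' B")
          case True
          have pos: "0 < W Q powr (1/p)" "0 < S Q' powr (1/q)" using W[OF Q(1)] S[OF Q(2)] by simp_all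
          have "L Q \<le> C0 / (W Q powr (1/p) * S Q' powr (1/q))"
            using L[OF Q(1,2)] True pos by (simp add: pos_le_divide_eq)
          then have "L Q * (W A powr (1/p) * (S B powr (1/q) * x B)) \<le> C0 / (W Q powr (1/p) * S Q' powr (1/q)) * (W A powr (1/p) * (S B powr (1/q) * x B))"
            using x[OF Q(3)] by (intro mult_right_mono) auto
          also have "\<dots> = C0 * ((W A / W Q) powr (1/p) * ((S B / S Q') powr (1/q) * x B))"
            using W[OF A] W[OF Q(1)] S[OF Q(2)] S[OF Q(3)] by (simp add: powr_divide)
          finally show ?thesis using True by (simp add: tree_kernel_def mult_ac)
        next
          case False
          show ?thesis unfolding if_not_P[OF False] using C0 x[OF Q(3)] by (simp add: tree_kernel_nonneg)
        qed
      qed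
      also have "\<dots> = C0 * (\<Sum>Q\<in>?T. tree_kernel (1/p) W A Q * v Q)"
        unfolding v_def y_def by (simp only: sum_distrib_left)
      finally show ?thesis .
    qed
    have "(\<Sum>A\<in>?T. (W A powr (1/p) * (\<Sum>Q\<in>?T. \<Sum>Q'\<in>?T. \<Sum>B\<in>?T.
               if desc Q A \<and> E Q Q' \<and> desc Q' B then L Q * (S B powr (1/q) * x B) else 0)) powr p)
       \<le> (\<Sum>A\<in>?T. (C0 * (\<Sum>Q\<in>?T. tree_kernel (1/p) W A Q * v Q)) powr p)"
    proof (intro sum_mono)
      fix A assume A: "A \<in> ?T"
      show "(W A powr (1/p) * (\<Sum>Q\<in>?T. \<Sum>Q'\<in>?T. \<Sum>B\<in>?T.
               if desc Q A \<and> E Q Q' \<and> desc Q' B then L Q * (S B powr (1/q) * x B) else 0)) powr p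
        \<le> (C0 * (\<Sum>Q\<in>?T. tree_kernel (1/p) W A Q * v Q)) powr p"
        using p L0 x by (intro powr_mono2 pt A mult_nonneg_nonneg sum_nonneg) auto
    qed
    also have "\<dots> = C0 powr p * (\<Sum>A\<in>?T. (\<Sum>Q\<in>?T. tree_kernel (1/p) W A Q * v Q) powr p)"
    proof -
      have "(C0 * (\<Sum>Q\<in>?T. tree_kernel (1/p) W A Q * v Q)) powr p = C0 powr p * (\<Sum>Q\<in>?T. tree_kernel (1/p) W A Q * v Q) powr p" for A
        by (rule powr_mult)
      then show ?thesis by (simp only: sum_distrib_left[symmetric])
    qed
    also have "\<dots> \<le> C0 powr p * (K * (\<Sum>Q\<in>?T. v Q powr p))"
      by (intro mult_left_mono K1[rule_format] sb v0) auto
    also have "\<dots> \<le> C0 powr p * (K * (d' powr (p/q) * d' * (\<Sum>Q\<in>?T. y Q powr p)))"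
    proof (intro mult_left_mono)
      show "(\<Sum>Q\<in>?T. v Q powr p) \<le> d' powr (p/q) * d' * (\<Sum>Q\<in>?T. y Q powr p)"
        unfolding v_def
      \<comment> \<open>The middle map has at most \<open>d\<close> ones in each row and column, so
        constant test sequences suffice. Taking \<open>d' = d + 1\<close> keeps the constant
        positive when \<open>d = 0\<close>.\<close>
      proof (rule Schur_test[OF p, where h="\<lambda>_. 1" and k="\<lambda>_. 1"])
        show "(\<Sum>Q'\<in>?T. (if E Q Q' then 1 else 0) * 1 powr q) \<le> d' * 1 powr q" for Q
          using E(1)[of N Q] d' by (simp add: sum.If_cases Int_def)
        show "(\<Sum>Q\<in>?T. (if E Q Q' then 1 else 0) * 1 powr p) \<le> d' * 1 powr p" for Q'
          using E(2)[of N Q'] d' by (simp add: sum.If_cases Int_def)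
      qed (use y0 d' in auto)
    qed (use K in auto)
    also have "\<dots> \<le> C0 powr p * (K * (d' powr (p/q) * d' * (K * (\<Sum>B\<in>?T. x B powr p))))"
      unfolding y_def by (intro mult_left_mono K2[rule_format] sb x) (use K d' in auto)
    finally show "(\<Sum>A\<in>?T. (W A powr (1/p) * (\<Sum>Q\<in>?T. \<Sum>Q'\<in>?T. \<Sum>B\<in>?T.
               if desc Q A \<and> E Q Q' \<and> desc Q' B then L Q * (S B powr (1/q) * x B) else 0)) powr p)
           \<le> C0 powr p * (K * (d' powr (p/q) * d' * K)) * (\<Sum>B\<in>?T. x B powr p)"
      by (simp add: mult_ac)
  qed
qed

text \<open>From parent to child the ratio \<open>r\<close> grows at most by \<open>K1\<close>,
  while the masses of the two child subtrees together shrink by \<open>\<theta> < 1\<close>. For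
  \<open>\<epsilon>\<close> so small that \<open>K1 powr \<epsilon> * \<theta> < 1\<close> the mass
  weighted with \<open>r powr \<epsilon>\<close> still sums geometrically. In the application
  \<open>r\<close> is the average belonging to the mass \<open>a\<close>, so this is a gain of
  integrability along the tree.\<close>

lemma tree_reverse_Holder:
  fixes C K1 \<epsilon>1 :: real assumes C: "2 \<le> C" and K1: "1 \<le> K1" and \<epsilon>1: "0 < \<epsilon>1"
  obtains \<epsilon> K where "0 < \<epsilon>" "\<epsilon> < \<epsilon>1" "0 < K"
    "\<forall>N a r Q. subtree_bounded C N a \<longrightarrow> (\<forall>R\<in>tiles N. 0 < r R) \<longrightarrow>
       (\<forall>n j i. (n, j) \<in> tiles N \<longrightarrow> i \<in> {2*j, 2*j+1} \<longrightarrow> (Suc n, i) \<in> tiles N \<longrightarrow> r (Suc n, i) \<le> K1 * r (n, j)) \<longrightarrow> Q \<in> tiles N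
       \<longrightarrow> dsum N (\<lambda>R. r R powr \<epsilon> * a R) Q \<le> K * (r Q powr \<epsilon> * a Q)"
proof -
  define \<theta> where "\<theta> = 1 - 1/C"
  have \<theta>: "0 < \<theta>" "\<theta> < 1" using C by (auto simp: \<theta>_def)
  have "((\<lambda>\<epsilon>. K1 powr \<epsilon> * \<theta>) \<longlongrightarrow> K1 powr 0 * \<theta>) (at_right (0::real))"
    using K1 by (intro tendsto_intros) auto
  then have "eventually (\<lambda>\<epsilon>. K1 powr \<epsilon> * \<theta> < 1) (at_right (0::real))"
    using \<theta> K1 by (intro order_tendstoD(2)) auto
  moreover have "eventually (\<lambda>\<epsilon>. \<epsilon> \<in> {0<..<\<epsilon>1}) (at_right (0::real))"
    by (rule eventually_at_right_real[OF \<epsilon>1])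
  ultimately have "eventually (\<lambda>\<epsilon>. K1 powr \<epsilon> * \<theta> < 1 \<and> \<epsilon> \<in> {0<..<\<epsilon>1}) (at_right (0::real))"
    by (rule eventually_conj)
  then obtain \<epsilon> :: real where \<epsilon>: "K1 powr \<epsilon> * \<theta> < 1" "0 < \<epsilon>" "\<epsilon> < \<epsilon>1"
    using eventually_happens[of _ "at_right (0::real)"] by (auto simp: trivial_limit_at_right_real)
  define \<kappa> where "\<kappa> = K1 powr \<epsilon> * \<theta>"
  define K where "K = 1 / (1 - \<kappa>)"
  have K: "K > 0" "1 + K * \<kappa> = K" using \<epsilon> by (auto simp: K_def \<kappa>_def field_simps)
  show thesis
  proof (rule that[of \<epsilon> "K * C"]; (intro allI impI)?)
    fix N and a r :: "nat \<times> nat \<Rightarrow> real" and Q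
    assume "subtree_bounded C N a" "\<forall>R\<in>tiles N. 0 < r R"
      "\<forall>n j i. (n, j) \<in> tiles N \<longrightarrow> i \<in> {2*j, 2*j+1} \<longrightarrow> (Suc n, i) \<in> tiles N \<longrightarrow> r (Suc n, i) \<le> K1 * r (n, j)"
      and Q: "Q \<in> tiles N"
    then have a: "\<And>R. R \<in> tiles N \<Longrightarrow> 0 < a R" and r: "\<And>R. R \<in> tiles N \<Longrightarrow> 0 < r R" and root: "\<And>R. R \<in> tiles N \<Longrightarrow> dsum N a R \<le> C * a R"
      and ch: "\<And>n j i. (n, j) \<in> tiles N \<Longrightarrow> i \<in> {2*j, 2*j+1} \<Longrightarrow> (Suc n, i) \<in> tiles N \<Longrightarrow> r (Suc n, i) \<le> K1 * r (n, j)"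
      by (auto simp: subtree_bounded_def)
    let ?f = "\<lambda>R. r R powr \<epsilon> * a R"
    have A0: "0 \<le> dsum N a R" for R using a by (intro dsum_nonneg) (auto simp: less_imp_le)
    have *: "dsum N ?f (n, j) \<le> K * (r (n, j) powr \<epsilon> * dsum N a (n, j))" if "j < 2 ^ n" for n j
    proof (rule tree_induct[OF _ _ that])
      fix n j assume Q: "(n, j) \<in> tiles N"
       and IH: "dsum N ?f (Suc n, 2*j) \<le> K * (r (Suc n, 2*j) powr \<epsilon> * dsum N a (Suc n, 2*j))"
         "dsum N ?f (Suc n, 2*j+1) \<le> K * (r (Suc n, 2*j+1) powr \<epsilon> * dsum N a (Suc n, 2*j+1))"
      let ?r = "r (n, j) powr \<epsilon>"
      have c: "r (Suc n, i) powr \<epsilon> * dsum N a (Suc n, i) \<le> K1 powr \<epsilon> * ?r * dsum N a (Suc n, i)" if i: "i \<in> {2*j, 2*j+1}" for i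
      proof (cases "Suc n < N")
        case True
        then have t: "(Suc n, i) \<in> tiles N" using child_tiles[OF Q] i by auto
        have "r (Suc n, i) powr \<epsilon> \<le> (K1 * r (n, j)) powr \<epsilon>"
          using ch[OF Q i t] r[OF t] \<epsilon> by (intro powr_mono2) auto
        also have "\<dots> = K1 powr \<epsilon> * ?r" using K1 r[OF Q] by (simp add: powr_mult)
        finally show ?thesis by (intro mult_right_mono A0)
      next
        case False
        then show ?thesis by (simp add: dsum_zero)
      qed
      have "dsum N ?f (n, j) \<le> ?r * a (n, j) + K * (K1 powr \<epsilon> * ?r * dsum N a (Suc n, 2*j)) + K * (K1 powr \<epsilon> * ?r * dsum N a (Suc n, 2*j+1))"
        unfolding dsum_split[OF Q, of ?f]
      proof (intro add_mono)
        show "dsum N ?f (Suc n, 2*j) \<le> K * (K1 powr \<epsilon> * ?r * dsum N a (Suc n, 2*j))"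
          by (rule order_trans[OF IH(1)], intro mult_left_mono c) (use K in auto)
        show "dsum N ?f (Suc n, 2*j+1) \<le> K * (K1 powr \<epsilon> * ?r * dsum N a (Suc n, 2*j+1))"
          by (rule order_trans[OF IH(2)], intro mult_left_mono c) (use K in auto)
      qed simp
      also have "\<dots> = ?r * a (n, j) + K * (K1 powr \<epsilon> * ?r) * (dsum N a (Suc n, 2*j) + dsum N a (Suc n, 2*j+1))"
        by (simp add: algebra_simps)
      also have "\<dots> \<le> ?r * dsum N a (n, j) + K * (K1 powr \<epsilon> * ?r) * (\<theta> * dsum N a (n, j))"
        unfolding \<theta>_def using C K root_le_dsum[OF a Q]
        by (intro add_mono mult_left_mono dsum_children_le a root Q) auto
      also have "\<dots> = (1 + K * \<kappa>) * (?r * dsum N a (n, j))"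
        by (simp add: \<kappa>_def algebra_simps)
      finally show "dsum N ?f (n, j) \<le> K * (?r * dsum N a (n, j))" using K by simp
    qed (simp add: dsum_zero)
    have "dsum N ?f Q \<le> K * (r Q powr \<epsilon> * dsum N a Q)"
      using * Q by (cases Q) (auto simp: tiles_def)
    also have "\<dots> \<le> K * (r Q powr \<epsilon> * (C * a Q))"
      using K root[OF Q] by (intro mult_left_mono) auto
    finally show "dsum N ?f Q \<le> K * C * (r Q powr \<epsilon> * a Q)" by (simp add: mult_ac)
  qed (use \<epsilon> K C in auto)
qed

text \<open>Model area: a tile of generation \<open>n\<close> has height and width comparable to
  \<open>(1/2) ^ n\<close>; the factors between this value and Lebesgue measure go into
  constants.\<close>

definition tile_area :: "nat \<times> nat \<Rightarrow> real" where "tile_area Q = (1/4) ^ fst Q"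

lemma tile_area_pos [simp]: "0 < tile_area Q" by (simp add: tile_area_def)

abbreviation valid :: "nat \<times> nat \<Rightarrow> bool" where "valid Q \<equiv> snd Q < 2 ^ fst Q"

lemma tiles_mono: "Q \<in> tiles N \<Longrightarrow> N \<le> N' \<Longrightarrow> Q \<in> tiles N'" by (auto simp: tiles_def)

text \<open>Hoelder's inequality with exponents \<open>\<alpha>\<close> and \<open>\<beta>\<close>
  between the reverse Hoelder sum, which contains \<open>r powr (1 + \<epsilon>)\<close>, and the
  sum of \<open>U powr (-\<tau>)\<close>. The power of \<open>r\<close> forces
  \<open>\<alpha> = (1 - p * \<pi>0) / (1 + \<epsilon>)\<close>, and the power of \<open>U\<close>
  then forces \<open>\<tau>\<close>. With \<open>\<epsilon> = 0\<close> this \<open>\<tau>\<close>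
  would be critical (infinite if \<open>\<pi>0 = 0\<close>); a positive \<open>\<epsilon>\<close>
  makes it admissible.\<close>

lemma tree_weight_sum:
  fixes U r :: "nat \<times> nat \<Rightarrow> real" and \<pi>0 p :: real
  assumes p: "1 < p" "0 \<le> \<pi>0" "\<pi>0 < 1/2" "p * \<pi>0 < 1" and C: "2 \<le> C" and K1: "1 \<le> K1"
    and U: "\<And>N R. R \<in> tiles N \<Longrightarrow> 0 < U R" and r: "\<And>N R. R \<in> tiles N \<Longrightarrow> 0 < r R"
    and root: "\<And>N Q. Q \<in> tiles N \<Longrightarrow> dsum N (\<lambda>R. tile_area R * U R * r R) Q \<le> C * (tile_area Q * U Q * r Q)"
    and child: "\<And>N n j i. (n, j) \<in> tiles N \<Longrightarrow> i \<in> {2*j, 2*j+1} \<Longrightarrow> (Suc n, i) \<in> tiles N \<Longrightarrow> U (n, j) \<le> K1 * U (Suc n, i)"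
    and neg: "\<And>\<tau>. 0 < \<tau> \<Longrightarrow> \<tau> * (2 * \<pi>0) < 1 - 2 * \<pi>0 \<Longrightarrow>
      \<exists>C1>0. \<forall>N. \<forall>Q\<in>tiles N. dsum N (\<lambda>R. tile_area R * U R powr (-\<tau>)) Q \<le> C1 * (tile_area Q * U Q powr (-\<tau>))"
  obtains K where "0 < K" "\<And>N Q. Q \<in> tiles N \<Longrightarrow>
     dsum N (\<lambda>R. tile_area R * r R powr (1 - p * \<pi>0) * U R powr (1 - p/2)) Q \<le> K * (tile_area Q * r Q powr (1 - p * \<pi>0) * U Q powr (1 - p/2))"
proof -
  define a where "a R = tile_area R * U R * r R" for R
  define K2 where "K2 = 4 * C * K1"
  have K2: "1 \<le> K2"
  proof -
    have "1 * 1 \<le> (4 * C) * K1" using C K1 by (intro mult_mono) auto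
    then show ?thesis by (simp add: K2_def)
  qed
  have apos: "0 < a R" if "R \<in> tiles N" for N R using U[OF that] r[OF that] by (simp add: a_def)
  \<comment> \<open>A child lies in the subtree of its parent, so its mass is at most
    \<open>C\<close> times that of the parent. Dividing by the area, which changes by the factor 4,
    and by \<open>U\<close> leaves the ratio of the averages.\<close>
  have rch: "r (Suc n, i) \<le> K2 * r (n, j)" if Q: "(n, j) \<in> tiles N" "i \<in> {2*j, 2*j+1}" "(Suc n, i) \<in> tiles N" for N n j i
  proof -
    have "desc (n, j) (Suc n, i)" using Q(2) by (auto simp: desc_def)
    then have "a (Suc n, i) \<le> dsum N a (n, j)"
      unfolding dsum_def using Q(3) apos by (intro member_le_sum) (auto simp: dset_def less_imp_le)
    also have "\<dots> \<le> C * a (n, j)" using root[OF Q(1)] by (simp add: a_def[abs_def])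
    finally have "U (Suc n, i) * r (Suc n, i) \<le> 4 * C * r (n, j) * U (n, j)"
      by (simp add: a_def tile_area_def mult_ac)
    also have "\<dots> \<le> 4 * C * r (n, j) * (K1 * U (Suc n, i))"
      using child[OF Q] C r[OF Q(1)] by (intro mult_left_mono) auto
    finally have "U (Suc n, i) * r (Suc n, i) \<le> U (Suc n, i) * (K2 * r (n, j))" by (simp add: K2_def mult_ac)
    then show ?thesis using U[OF Q(3)] by simp
  qed
  \<comment> \<open>This upper limit for \<open>\<epsilon>\<close> keeps
    \<open>2 * \<beta> < p\<close>, that is, \<open>\<tau>\<close> positive.\<close>
  have e1: "0 < p * (1 - 2*\<pi>0) / 2" using p by simp
  obtain \<epsilon> K3 where \<epsilon>: "0 < \<epsilon>" "\<epsilon> < p * (1 - 2*\<pi>0) / 2" and K3: "0 < K3" and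
    rh: "\<forall>N a r Q. subtree_bounded C N a \<longrightarrow> (\<forall>R\<in>tiles N. 0 < r R) \<longrightarrow>
       (\<forall>n j i. (n, j) \<in> tiles N \<longrightarrow> i \<in> {2*j, 2*j+1} \<longrightarrow> (Suc n, i) \<in> tiles N \<longrightarrow> r (Suc n, i) \<le> K2 * r (n, j)) \<longrightarrow> Q \<in> tiles N
       \<longrightarrow> dsum N (\<lambda>R. r R powr \<epsilon> * a R) Q \<le> K3 * (r Q powr \<epsilon> * a Q)"
    using tree_reverse_Holder[OF C K2 e1] .
  define s where "s = 1 - p * \<pi>0"
  define \<alpha> where "\<alpha> = s / (1 + \<epsilon>)"
  define \<beta> where "\<beta> = 1 - \<alpha>"
  define \<tau> where "\<tau> = p / (2 * \<beta>) - 1"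
  have s: "0 < s" "s \<le> 1" using p by (auto simp: s_def)
  have \<beta>eq: "\<beta> = (\<epsilon> + p * \<pi>0) / (1 + \<epsilon>)" using \<epsilon> by (simp add: \<beta>_def \<alpha>_def s_def field_simps)
  have \<alpha>: "0 < \<alpha>" "0 < \<beta>" "\<alpha> + \<beta> = 1"
    using s \<epsilon> p by (auto simp: \<beta>eq \<alpha>_def add_pos_nonneg) (simp add: \<beta>_def \<alpha>_def \<beta>eq[symmetric])
  have \<tau>pos: "0 < \<tau>"
  proof -
    have "2 * \<epsilon> + 2 * (p * \<pi>0) < p" using \<epsilon>(2) by (simp add: algebra_simps)
    also have "p \<le> p * (1 + \<epsilon>)" using p \<epsilon> by simp
    finally have "2 * \<beta> < p" using \<epsilon> by (simp add: \<beta>eq divide_less_eq)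
    then show ?thesis using \<alpha> by (simp add: \<tau>_def)
  qed
  \<comment> \<open>\<open>\<beta> = (\<epsilon> + p * \<pi>0) / (1 + \<epsilon>)\<close> is a
    weighted mean of 1 and \<open>p * \<pi>0 < 1\<close>, hence strictly larger than
    \<open>p * \<pi>0\<close>; this strict inequality is the whole gain.\<close>
  have \<tau>2: "\<tau> * (2 * \<pi>0) < 1 - 2 * \<pi>0"
  proof -
    have "p * \<pi>0 * \<epsilon> < 1 * \<epsilon>" using p \<epsilon> by (intro mult_strict_right_mono) auto
    then have "p * \<pi>0 < \<beta>" using \<epsilon> by (simp add: \<beta>eq less_divide_eq algebra_simps)
    then have "p * \<pi>0 / \<beta> < 1" using \<alpha> by simp
    moreover have "\<tau> * (2 * \<pi>0) = p * \<pi>0 / \<beta> - 2 * \<pi>0" using \<alpha> by (simp add: \<tau>_def field_simps)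
    ultimately show ?thesis by simp
  qed
  obtain C1 where C1: "C1 > 0" and negs: "\<And>N Q. Q \<in> tiles N \<Longrightarrow> dsum N (\<lambda>R. tile_area R * U R powr (-\<tau>)) Q \<le> C1 * (tile_area Q * U Q powr (-\<tau>))"
    using neg[OF \<tau>pos \<tau>2] by blast
  have "\<tau> * \<beta> = p/2 - \<beta>" using \<alpha> by (simp add: \<tau>_def field_simps)
  then have eU: "\<alpha> - \<tau> * \<beta> = 1 - p/2" using \<alpha> by linarith
  have ident: "(r R powr \<epsilon> * a R) powr \<alpha> * (tile_area R * U R powr (-\<tau>)) powr \<beta> = tile_area R * r R powr (1 - p * \<pi>0) * U R powr (1 - p/2)"
    if R: "R \<in> tiles N" for N R
  proof -
    have pos: "0 < U R" "0 < r R" "0 < tile_area R" using U r R by auto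
    have "(r R powr \<epsilon> * a R) powr \<alpha> * (tile_area R * U R powr (-\<tau>)) powr \<beta>
      = (tile_area R powr \<alpha> * tile_area R powr \<beta>) * (r R powr (\<epsilon> * \<alpha>) * r R powr \<alpha>) * (U R powr \<alpha> * U R powr (-\<tau> * \<beta>))"
      using pos by (simp add: a_def powr_mult powr_powr mult_ac)
    also have "tile_area R powr \<alpha> * tile_area R powr \<beta> = tile_area R" using \<alpha> pos(3) by (simp add: powr_add[symmetric] abs_of_pos del: tile_area_pos)
    also have "r R powr (\<epsilon> * \<alpha>) * r R powr \<alpha> = r R powr (1 - p * \<pi>0)"
    proof -
      have "\<epsilon> * \<alpha> + \<alpha> = \<alpha> * (1 + \<epsilon>)" by (simp add: algebra_simps)
      also have "\<dots> = 1 - p * \<pi>0" using \<epsilon> by (simp add: \<alpha>_def s_def)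
      finally show ?thesis by (simp add: powr_add[symmetric])
    qed
    also have "U R powr \<alpha> * U R powr (-\<tau> * \<beta>) = U R powr (1 - p/2)" by (simp add: powr_add[symmetric] eU[symmetric])
    finally show ?thesis .
  qed
  show thesis
  proof (rule that[of "K3 powr \<alpha> * C1 powr \<beta>"])
    show "0 < K3 powr \<alpha> * C1 powr \<beta>" using K3 C1 by simp
    fix N Q assume Q: "Q \<in> tiles N"
    have "dsum N (\<lambda>R. tile_area R * r R powr (1 - p * \<pi>0) * U R powr (1 - p/2)) Q
      = (\<Sum>R\<in>dset N Q. (r R powr \<epsilon> * a R) powr \<alpha> * (tile_area R * U R powr (-\<tau>)) powr \<beta>)"
      unfolding dsum_def by (intro sum.cong refl ident[symmetric]) (auto simp: dset_def)
    also have "\<dots> \<le> dsum N (\<lambda>R. r R powr \<epsilon> * a R) Q powr \<alpha> * dsum N (\<lambda>R. tile_area R * U R powr (-\<tau>)) Q powr \<beta>"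
      unfolding dsum_def using apos by (intro Holder_sum_powr \<alpha>) (auto simp: dset_def less_imp_le)
    also have "\<dots> \<le> (K3 * (r Q powr \<epsilon> * a Q)) powr \<alpha> * (C1 * (tile_area Q * U Q powr (-\<tau>))) powr \<beta>"
    proof (intro mult_mono powr_mono2)
      show "dsum N (\<lambda>R. r R powr \<epsilon> * a R) Q \<le> K3 * (r Q powr \<epsilon> * a Q)"
        using apos r root rch Q by (intro rh[rule_format]) (auto simp: a_def[abs_def] subtree_bounded_def)
      show "dsum N (\<lambda>R. tile_area R * U R powr (-\<tau>)) Q \<le> C1 * (tile_area Q * U Q powr (-\<tau>))" by (rule negs[OF Q])
    qed (use \<alpha> apos in \<open>auto intro!: dsum_nonneg simp: less_imp_le\<close>)
    also have "\<dots> = K3 powr \<alpha> * C1 powr \<beta> * ((r Q powr \<epsilon> * a Q) powr \<alpha> * (tile_area Q * U Q powr (-\<tau>)) powr \<beta>)"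
      using K3 C1 apos[OF Q] by (subst (1 2) powr_mult) (auto simp: less_imp_le mult_ac)
    also have "\<dots> = K3 powr \<alpha> * C1 powr \<beta> * (tile_area Q * r Q powr (1 - p * \<pi>0) * U Q powr (1 - p/2))"
      unfolding ident[OF Q] ..
    finally show "dsum N (\<lambda>R. tile_area R * r R powr (1 - p * \<pi>0) * U R powr (1 - p/2)) Q \<le> K3 powr \<alpha> * C1 powr \<beta> * (tile_area Q * r Q powr (1 - p * \<pi>0) * U Q powr (1 - p/2))" .
  qed
qed

section \<open>Dyadic tiles of the disc\<close>

definition turn :: "complex \<Rightarrow> real" where "turn z = Arg2pi z / (2 * pi)"

text \<open>Angles are measured in full turns so that dyadic arcs have dyadic endpoints. Half-open
  ranges in both directions make the tiles a partition of the disc; the origin, with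
  \<open>Arg2pi 0 = 0\<close>, falls into the root tile.\<close>

definition tile :: "nat \<times> nat \<Rightarrow> complex set" where
  "tile Q = {z. (1/2) ^ Suc (fst Q) < 1 - cmod z \<and> 1 - cmod z \<le> (1/2) ^ fst Q \<and>
     real (snd Q) \<le> 2 ^ fst Q * turn z \<and> 2 ^ fst Q * turn z < real (snd Q) + 1}"

text \<open>A Carleson box that contains the whole dyadic box below a tile together with its neighbours.
  Carleson boxes have \<open>l \<le> 1\<close>, which excludes the first five generations; there the whole disc
  serves, all constants being finite because finitely many boxes with \<open>l = 1\<close> cover the disc.\<close>

definition big_box :: "nat \<times> nat \<Rightarrow> complex set" where
  "big_box Q = (if fst Q < 5 then ball 0 1
     else carleson_box (2 * pi * (real (snd Q) + 1/2) / 2 ^ fst Q) (32 * (1/2) ^ fst Q))"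

text \<open>The integer \<open>k\<close> accounts for the wrap-around of the angle.\<close>

definition nbr :: "nat \<times> nat \<Rightarrow> nat \<times> nat \<Rightarrow> bool" where
  "nbr Q R \<longleftrightarrow> fst Q = fst R \<and> (\<exists>k::int. \<bar>int (snd Q) - int (snd R) + k * 2 ^ fst Q\<bar> \<le> 1)"

lemma carleson_boxI:
  "z = of_real r * cis t \<Longrightarrow> 0 \<le> r \<Longrightarrow> r < 1 \<Longrightarrow> 1 - r \<le> l \<Longrightarrow> \<bar>t - th\<bar> \<le> l / 2 \<Longrightarrow> z \<in> carleson_box th l"
  unfolding carleson_box_def by blast

lemma turn_bounds: "0 \<le> turn z" "turn z < 1"
  using Arg2pi_ge_0[of z] Arg2pi_lt_2pi[of z] by (auto simp: turn_def)

lemma polar_turn: "z = of_real (cmod z) * cis (2 * pi * turn z)"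
  using Arg2pi_eq[of z] by (simp add: turn_def cis_conv_exp)

lemma polar_unique_turn:
  assumes "z = of_real (cmod z) * cis (2 * pi * t)" "z \<noteq> 0" "0 \<le> t" "t < 1"
  shows "turn z = t"
  using Arg2pi_unique[of "cmod z" "2 * pi * t" z] assms by (simp add: turn_def cis_conv_exp)

lemma turn_measurable [measurable]: "turn \<in> borel_measurable borel"
proof -
  have "Arg2pi \<in> borel_measurable borel"
    unfolding borel_measurable_iff_le using closed_Arg2pi2pi_le by auto
  then show ?thesis unfolding turn_def by measurable
qed

lemma tile_borel [measurable]: "tile Q \<in> sets borel"
  unfolding tile_def by measurable

lemma tile_subset_ball: "tile Q \<subseteq> ball 0 1"
proof
  fix z assume "z \<in> tile Q"
  then have "(1/2) ^ Suc (fst Q) < 1 - cmod z" by (simp add: tile_def)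
  moreover have "0 < (1/2::real) ^ Suc (fst Q)" by simp
  ultimately have "cmod z < 1" by linarith
  then show "z \<in> ball 0 1" by simp
qed

lemma tile_ancestor:
  assumes "z \<in> tile R" "desc Q R"
  shows "real (snd Q) \<le> 2 ^ fst Q * turn z" "2 ^ fst Q * turn z < real (snd Q) + 1" "1 - cmod z \<le> (1/2) ^ fst Q"
proof -
  obtain n j m k where Q: "Q = (n, j)" and R: "R = (m, k)" by (cases Q, cases R)
  obtain d where d: "m = n + d" using assms(2) by (auto simp: desc_def Q R le_iff_add)
  have kd: "k div 2 ^ d = j" using assms(2) by (simp add: desc_def Q R d)
  have z: "real k \<le> 2 ^ m * turn z" "2 ^ m * turn z < real k + 1" "1 - cmod z \<le> (1/2) ^ m"
    using assms(1) by (auto simp: tile_def R)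
  have "k = j * 2 ^ d + k mod 2 ^ d" using div_mult_mod_eq[of k "2 ^ d"] kd by simp
  moreover have "k mod 2 ^ d < 2 ^ d" by simp
  ultimately have "j * 2 ^ d \<le> k" "k + 1 \<le> j * 2 ^ d + 2 ^ d" by linarith+
  then have "real (j * 2 ^ d) \<le> real k" "real (k + 1) \<le> real (j * 2 ^ d + 2 ^ d)" by (simp_all only: of_nat_le_iff)
  then have *: "real j * 2 ^ d \<le> real k" "real k + 1 \<le> (real j + 1) * 2 ^ d" by (simp_all add: algebra_simps)
  have "2 ^ m * turn z = 2 ^ d * (2 ^ n * turn z)" by (simp add: d power_add)
  have "real j * 2 ^ d \<le> 2 ^ d * (2 ^ n * turn z)" "2 ^ d * (2 ^ n * turn z) < (real j + 1) * 2 ^ d"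
    using z * \<open>2 ^ m * turn z = 2 ^ d * (2 ^ n * turn z)\<close> by linarith+
  then show "real (snd Q) \<le> 2 ^ fst Q * turn z" "2 ^ fst Q * turn z < real (snd Q) + 1"
    by (auto simp: Q mult.commute)
  have "(1/2::real) ^ m \<le> (1/2) ^ n" by (rule power_decreasing) (auto simp: d)
  with z(3) show "1 - cmod z \<le> (1/2) ^ fst Q" unfolding Q fst_conv by linarith
qed

lemma tile_index:
  assumes "z \<in> tile Q" shows "Q = (fst Q, nat \<lfloor>2 ^ fst Q * turn z\<rfloor>)" "valid Q"
proof -
  have "\<lfloor>2 ^ fst Q * turn z\<rfloor> = int (snd Q)"
    using assms by (intro floor_unique) (auto simp: tile_def)
  then show "Q = (fst Q, nat \<lfloor>2 ^ fst Q * turn z\<rfloor>)" by simp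
  have "real (snd Q) \<le> 2 ^ fst Q * turn z" using assms by (simp add: tile_def)
  also have "\<dots> < 2 ^ fst Q * 1" using turn_bounds by (intro mult_strict_left_mono) auto
  finally show "valid Q" by (metis mult.right_neutral of_nat_less_iff of_nat_numeral of_nat_power)
qed

lemma tile_level_unique:
  assumes "z \<in> tile Q" "z \<in> tile R" shows "fst Q = fst R"
proof -
  have "\<not> m < n" if "z \<in> tile (m, j)" "z \<in> tile (n, k)" for m n j k
  proof
    assume "m < n"
    then have "(1/2::real) ^ n \<le> (1/2) ^ Suc m" by (intro power_decreasing) auto
    with that show False by (auto simp: tile_def)
  qed
  from this[of "fst Q" "snd Q" "fst R" "snd R"] this[of "fst R" "snd R" "fst Q" "snd Q"] assms
  show ?thesis by simp
qed

lemma tile_disjoint: "Q \<noteq> R \<Longrightarrow> tile Q \<inter> tile R = {}"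
  using tile_index(1) tile_level_unique by (metis disjoint_iff)

lemma tile_exists:
  assumes "z \<in> ball 0 1" obtains Q where "valid Q" "z \<in> tile Q"
proof -
  have "0 < 1 - cmod z" using assms by simp
  then obtain n0 :: nat where "(1/2) ^ n0 < 1 - cmod z" using real_arch_pow_inv[of "1 - cmod z" "1/2"] by auto
  then have ex: "\<exists>n. (1/2) ^ Suc n < 1 - cmod z"
    by (intro exI[of _ n0]) (smt (verit) power_Suc zero_less_power field_sum_of_halves mult_less_cancel_right2)
  define n where "n = (LEAST n. (1/2) ^ Suc n < 1 - cmod z)"
  have n: "(1/2) ^ Suc n < 1 - cmod z" unfolding n_def by (rule LeastI_ex[OF ex])
  have n2: "1 - cmod z \<le> (1/2) ^ n"
  proof (cases n)
    case 0 then show ?thesis by simp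
  next
    case (Suc m)
    have "\<not> (1/2) ^ Suc m < 1 - cmod z" unfolding n_def by (rule not_less_Least) (use Suc n_def in simp)
    then show ?thesis by (simp add: Suc)
  qed
  define j where "j = nat \<lfloor>2 ^ n * turn z\<rfloor>"
  have "0 \<le> 2 ^ n * turn z" using turn_bounds by simp
  then have "real j \<le> 2 ^ n * turn z" "2 ^ n * turn z < real j + 1" unfolding j_def by linarith+
  then have "z \<in> tile (n, j)" using n n2 by (simp add: tile_def)
  with tile_index(2)[OF this] show ?thesis by (intro that[of "(n, j)"]) auto
qed

text \<open>Angular deviations are measured in units of \<open>(1/2) ^ n\<close> turns from the
  middle of the arc. A point of the arc deviates by at most 1/2, a point of a neighbour or of a
  small disc around a point of the tile by at most 3/2, so the allowance 2 serves all uses.\<close>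

lemma in_big_box:
  assumes "5 \<le> n" "cmod z < 1" "1 - cmod z \<le> 32 * (1/2) ^ n" "z = of_real (cmod z) * cis (2 * pi * t)"
    "\<bar>2 ^ n * t - (real j + 1/2)\<bar> \<le> 2"
  shows "z \<in> big_box (n, j)"
proof -
  have "2 * pi * t - 2 * pi * (real j + 1/2) / 2 ^ n = 2 * pi / 2 ^ n * (2 ^ n * t - (real j + 1/2))"
    by (simp add: field_simps)
  then have "\<bar>2 * pi * t - 2 * pi * (real j + 1/2) / 2 ^ n\<bar> = 2 * pi / 2 ^ n * \<bar>2 ^ n * t - (real j + 1/2)\<bar>"
    by (simp add: abs_mult)
  also have "\<dots> \<le> 2 * pi / 2 ^ n * 2" by (intro mult_left_mono assms) auto
  also have "\<dots> \<le> 32 * (1/2) ^ n / 2" using pi_less_4 by (simp add: field_simps)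
  finally have "z \<in> carleson_box (2 * pi * (real j + 1/2) / 2 ^ n) (32 * (1/2) ^ n)"
    by (intro carleson_boxI[OF assms(4)] assms) auto
  then show ?thesis using assms(1) unfolding big_box_def by simp
qed

lemma carleson_box_subset_ball: "carleson_box th l \<subseteq> ball 0 1"
  by (auto simp: carleson_box_def norm_mult)

lemma big_box_subset_ball: "big_box Q \<subseteq> ball 0 1"
  using carleson_box_subset_ball by (auto simp: big_box_def)

lemma desc_tile_subset: assumes "desc Q R" shows "tile R \<subseteq> big_box Q"
proof
  fix z assume z: "z \<in> tile R"
  note a = tile_ancestor[OF z assms]
  have z1: "cmod z < 1" using z tile_subset_ball[of R] by auto
  show "z \<in> big_box Q"
  proof (cases "fst Q < 5")
    case True then show ?thesis using z1 by (simp add: big_box_def)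
  next
    case False
    have "(1/2) ^ fst Q \<le> 32 * (1/2::real) ^ fst Q" by simp
    then have "z \<in> big_box (fst Q, snd Q)"
      using a z1 False by (intro in_big_box[OF _ _ _ polar_turn]) (auto simp: abs_le_iff)
    then show ?thesis by simp
  qed
qed

lemma nbr_tile_subset: assumes "nbr Q R" shows "tile R \<subseteq> big_box Q"
proof
  fix z assume z: "z \<in> tile R"
  obtain n j j' where Q: "Q = (n, j)" and R: "R = (n, j')" using assms by (cases Q, cases R) (auto simp: nbr_def)
  obtain k :: int where k: "\<bar>int j - int j' + k * 2 ^ n\<bar> \<le> 1" using assms by (auto simp: nbr_def Q R)
  have zz: "1 - cmod z \<le> (1/2) ^ n" "real j' \<le> 2 ^ n * turn z" "2 ^ n * turn z < real j' + 1"
    using z by (auto simp: tile_def R)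
  have z1: "cmod z < 1" using z tile_subset_ball[of R] by auto
  show "z \<in> big_box Q"
  proof (cases "n < 5")
    case True then show ?thesis using z1 by (simp add: big_box_def Q)
  next
    case False
    have "\<bar>real_of_int (int j - int j' + k * 2 ^ n)\<bar> \<le> 1" using k by linarith
    then have k': "\<bar>real j - real j' + real_of_int k * 2 ^ n\<bar> \<le> 1" by simp
    have "cis (2 * pi * (turn z - of_int k)) = cis (2 * pi * turn z)"
    proof -
      have "cis (2 * pi * (turn z - of_int k)) = cis (2 * pi * turn z) * cis (2 * pi * of_int (-k))"
        by (simp add: cis_mult algebra_simps)
      also have "cis (2 * pi * of_int (-k)) = 1" by (rule cis_multiple_2pi) simp
      finally show ?thesis by simp
    qed
    then have pol: "z = of_real (cmod z) * cis (2 * pi * (turn z - of_int k))" using polar_turn[of z] by simp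
    have "(1/2) ^ n \<le> 32 * (1/2::real) ^ n" by simp
    then show ?thesis unfolding Q
      using zz z1 False k' by (intro in_big_box[OF _ _ _ pol]) (auto simp: algebra_simps)
  qed
qed

text \<open>With \<open>w = z * (1 + \<epsilon>)\<close> the angle changes by the imaginary part of
  \<open>Ln (1 + \<epsilon>)\<close>. The result speaks of some angle of \<open>w\<close> close to
  \<open>t\<close>, not of its principal argument, and is therefore insensitive to the branch
  cut.\<close>

lemma polar_perturb:
  assumes z: "z = of_real (cmod z) * cis t" "z \<noteq> 0" and e: "cmod (w - z) < cmod z / 2"
  obtains d where "w = of_real (cmod w) * cis (t + d)" "\<bar>d\<bar> \<le> 2 * cmod (w - z) / cmod z" "w \<noteq> 0"
proof -
  define \<epsilon> where "\<epsilon> = (w - z) / z"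
  have n\<epsilon>: "cmod \<epsilon> = cmod (w - z) / cmod z" by (simp add: \<epsilon>_def norm_divide)
  have \<epsilon>: "cmod \<epsilon> < 1/2" using e z(2) by (simp add: n\<epsilon> divide_less_eq)
  have w: "w = z * (1 + \<epsilon>)" using z(2) by (simp add: \<epsilon>_def field_simps)
  have nz: "1 + \<epsilon> \<noteq> 0"
  proof
    assume "1 + \<epsilon> = 0" then have "\<epsilon> = -1" by (simp add: add_eq_0_iff)
    with \<epsilon> show False by simp
  qed
  define d where "d = Im (Ln (1 + \<epsilon>))"
  have "1 + \<epsilon> = exp (Ln (1 + \<epsilon>))" using nz by simp
  also have "\<dots> = of_real (exp (Re (Ln (1 + \<epsilon>)))) * cis d"
    by (simp add: exp_eq_polar d_def)
  also have "exp (Re (Ln (1 + \<epsilon>))) = cmod (1 + \<epsilon>)" using nz by simp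
  finally have "1 + \<epsilon> = of_real (cmod (1 + \<epsilon>)) * cis d" .
  then have "w = (of_real (cmod z) * cis t) * (of_real (cmod (1 + \<epsilon>)) * cis d)" using w z(1) by metis
  also have "\<dots> = of_real (cmod w) * cis (t + d)" by (simp add: w norm_mult cis_mult[symmetric])
  finally have 1: "w = of_real (cmod w) * cis (t + d)" .
  have "\<bar>d\<bar> \<le> cmod (Ln (1 + \<epsilon>))" unfolding d_def by (rule abs_Im_le_cmod)
  also have "\<dots> \<le> 2 * cmod \<epsilon>" by (rule norm_Ln_le[OF \<epsilon>])
  finally have 2: "\<bar>d\<bar> \<le> 2 * cmod (w - z) / cmod z" by (simp add: n\<epsilon>)
  show thesis by (rule that[OF 1 2]) (use w nz z(2) in auto)
qed

text \<open>The radius is a quarter of \<open>(1/2) ^ n\<close>, while the tile keeps half of it as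
  distance to the circle. From generation 5 on the tile is far from the origin, so the angle moves
  by a controlled amount as well. On these discs the sub-mean value properties will be
  applied.\<close>

lemma tile_ball_subset:
  assumes z: "z \<in> tile (n, j)" and n: "5 \<le> n"
  shows "ball z ((1/2) ^ (n + 2)) \<subseteq> big_box (n, j)"
proof
  fix w assume "w \<in> ball z ((1/2) ^ (n + 2))"
  then have w: "cmod (w - z) < (1/2) ^ n / 4" by (simp add: dist_norm norm_minus_commute power_add power2_eq_square)
  have z': "(1/2) ^ n / 2 < 1 - cmod z" "1 - cmod z \<le> (1/2) ^ n" "real j \<le> 2 ^ n * turn z" "2 ^ n * turn z < real j + 1"
    using z by (auto simp: tile_def)
  have "(1/2::real) ^ n \<le> (1/2) ^ 5" using n by (intro power_decreasing) auto
  also have "(1/2::real) ^ 5 = 1/32" by (simp add: power_divide)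
  finally have n5: "(1/2::real) ^ n \<le> 1/32" .
  have n0: "(0::real) < (1/2) ^ n" by simp
  have cz: "cmod z \<ge> 1/2" using z'(2) n5 by linarith
  have "cmod (w - z) < cmod z / 2" using w n5 cz by linarith
  then obtain d where d: "w = of_real (cmod w) * cis (2 * pi * turn z + d)" "\<bar>d\<bar> \<le> 2 * cmod (w - z) / cmod z"
    using polar_perturb[OF polar_turn[of z]] cz by (metis norm_zero not_le zero_less_divide_1_iff zero_less_numeral)
  have "2 * cmod (w - z) / cmod z \<le> 2 * ((1/2) ^ n / 4) / (1/2)"
    using w cz by (intro frac_le) auto
  with d(2) have d2: "\<bar>d\<bar> \<le> (1/2) ^ n" by simp
  have pol: "w = of_real (cmod w) * cis (2 * pi * (turn z + d / (2 * pi)))"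
    using d(1) by (simp add: distrib_left)
  have tri: "cmod w \<le> cmod z + cmod (w - z)" "cmod z \<le> cmod w + cmod (w - z)"
    by norm+
  have "\<bar>2 ^ n * (d / (2 * pi))\<bar> = 2 ^ n * \<bar>d\<bar> / (2 * pi)" by (simp add: abs_mult)
  also have "\<dots> \<le> 2 ^ n * (1/2) ^ n / (2 * pi)" using d2 by (intro divide_right_mono mult_left_mono) auto
  also have "\<dots> = 1 / (2 * pi)" by (simp add: power_divide)
  also have "\<dots> \<le> 1" using pi_ge_two by simp
  finally have d3: "\<bar>2 ^ n * (d / (2 * pi))\<bar> \<le> 1" .
  show "w \<in> big_box (n, j)"
  proof (rule in_big_box[OF n _ _ pol])
    show "cmod w < 1" "1 - cmod w \<le> 32 * (1/2) ^ n" using tri w z' n0 by linarith+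
    show "\<bar>2 ^ n * (turn z + d / (2 * pi)) - (real j + 1/2)\<bar> \<le> 2"
      using d3 z' unfolding distrib_left by linarith
  qed
qed

section \<open>Areas of tiles and boxes\<close>

lemma emeasure_ball_complex: "0 \<le> r \<Longrightarrow> emeasure lborel (ball (c::complex) r) = ennreal (pi * r\<^sup>2)"
  by (simp add: emeasure_ball eval_unit_ball_vol)

lemma emeasure_tile_ge:
  assumes j: "j < 2 ^ n" shows "ennreal ((1/4) ^ n / 256) \<le> emeasure lborel (tile (n, j))"
proof -
  \<comment> \<open>Polar coordinates of the middle of the tile. The extreme case is
    \<open>n = 0\<close> with \<open>rc = 1/4\<close>, where a disc of radius 1/16 still
    fits.\<close>
  define rc where "rc = 1 - 3/4 * (1/2::real) ^ n"
  define tc where "tc = (real j + 1/2) / 2 ^ n"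
  define c where "c = of_real rc * cis (2 * pi * tc)"
  have n0: "(0::real) < (1/2) ^ n" "(1/2::real) ^ n \<le> 1" by (auto simp: power_le_one)
  have rc: "1/4 \<le> rc" using n0 by (simp add: rc_def)
  have cc: "cmod c = rc" using rc by (simp add: c_def norm_mult)
  have sub: "ball c ((1/2) ^ n / 16) \<subseteq> tile (n, j)"
  proof
    fix w assume "w \<in> ball c ((1/2) ^ n / 16)"
    then have w: "cmod (w - c) < (1/2) ^ n / 16" by (simp add: dist_norm norm_minus_commute)
    have c1: "c = of_real (cmod c) * cis (2 * pi * tc)" unfolding cc by (simp add: c_def)
    have "cmod (w - c) < cmod c / 2" using w n0 rc cc by simp
    moreover have "c \<noteq> 0" using cc rc by auto
    ultimately obtain d where d: "w = of_real (cmod w) * cis (2 * pi * tc + d)" "\<bar>d\<bar> \<le> 2 * cmod (w - c) / cmod c" "w \<noteq> 0"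
      using polar_perturb[OF c1] by metis
    have "2 * cmod (w - c) / cmod c \<le> 2 * ((1/2) ^ n / 16) / (1/4)"
      using w cc rc by (intro frac_le) auto
    with d(2) have d2: "\<bar>d\<bar> \<le> (1/2) ^ n / 2" by simp
    have "\<bar>2 ^ n * (d / (2 * pi))\<bar> = 2 ^ n * \<bar>d\<bar> / (2 * pi)" by (simp add: abs_mult)
    also have "\<dots> \<le> 2 ^ n * ((1/2) ^ n / 2) / (2 * pi)" using d2 by (intro divide_right_mono mult_left_mono) auto
    also have "\<dots> = 1 / (4 * pi)" by (simp add: power_divide)
    also have "\<dots> < 1/2" using pi_ge_two by simp
    finally have d3: "\<bar>2 ^ n * (d / (2 * pi))\<bar> < 1/2" .
    define t where "t = tc + d / (2 * pi)"
    have "2 ^ n * tc = real j + 1/2" by (simp add: tc_def)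
    then have nt: "2 ^ n * t = real j + 1/2 + 2 ^ n * (d / (2 * pi))" by (simp only: t_def distrib_left)
    have t: "real j < 2 ^ n * t" "2 ^ n * t < real j + 1" using d3 unfolding nt abs_less_iff by linarith+
    have "0 < 2 ^ n * t" using t(1) by (rule order.strict_trans1[rotated]) simp
    then have t0: "0 < t" by (simp add: zero_less_mult_iff)
    have "real j + 1 \<le> 2 ^ n" using j by (metis Suc_leI of_nat_Suc of_nat_le_iff of_nat_numeral of_nat_power add.commute)
    with t(2) have "2 ^ n * t < 2 ^ n" by linarith
    then have t1: "t < 1" by (simp add: mult_less_cancel_left2)
    have "turn w = t"
      by (rule polar_unique_turn) (use d t0 t1 in \<open>auto simp: t_def distrib_left\<close>)
    moreover have "cmod w \<le> cmod c + cmod (w - c)" "cmod c \<le> cmod w + cmod (w - c)" by norm+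
    ultimately show "w \<in> tile (n, j)" using t w cc n0 by (auto simp: tile_def rc_def)
  qed
  have "(1/4::real) ^ n / 256 = ((1/2) ^ n / 16)\<^sup>2"
    by (simp add: power_divide power_mult_distrib power2_eq_square power_mult[symmetric] flip: power_mult_distrib)
  also have "\<dots> \<le> pi * ((1/2) ^ n / 16)\<^sup>2" using pi_ge_two by (intro mult_le_cancel_right1[THEN iffD2]) auto
  finally have "ennreal ((1/4) ^ n / 256) \<le> emeasure lborel (ball c ((1/2) ^ n / 16))"
    by (subst emeasure_ball_complex) (auto intro!: ennreal_leI)
  also have "\<dots> \<le> emeasure lborel (tile (n, j))" by (intro emeasure_mono sub) simp
  finally show ?thesis .
qed

lemma norm_cis_diff_le: "cmod (cis a - cis b) \<le> \<bar>a - b\<bar>"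
proof -
  have "cis a - cis b = cis b * (exp (\<i> * of_real (a - b)) - 1)"
    by (simp add: right_diff_distrib cis_conv_exp flip: exp_add)
  then have "cmod (cis a - cis b) = 2 * \<bar>sin ((a - b) / 2)\<bar>" by (simp add: norm_mult flip: dist_exp_i_1)
  also have "\<dots> \<le> \<bar>a - b\<bar>" using abs_sin_x_le_abs_x[of "(a - b) / 2"] by simp
  finally show ?thesis .
qed

lemma carleson_box_subset_cball: "carleson_box th l \<subseteq> cball (cis th) (3/2 * l)"
proof
  fix z assume "z \<in> carleson_box th l"
  then obtain r t where z: "z = of_real r * cis t" "0 \<le> r" "r < 1" "1 - r \<le> l" "\<bar>t - th\<bar> \<le> l / 2"
    by (auto simp: carleson_box_def)
  have "cis th - z = (cis th - cis t) + of_real (1 - r) * cis t" by (simp add: z(1) algebra_simps)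
  then have "cmod (cis th - z) \<le> cmod (cis th - cis t) + cmod (of_real (1 - r) * cis t)" by (metis norm_triangle_ineq)
  also have "cmod (of_real (1 - r) * cis t) = 1 - r"
    using z by (simp only: norm_mult norm_of_real norm_cis) simp
  also have "cmod (cis th - cis t) + (1 - r) \<le> \<bar>th - t\<bar> + (1 - r)" using norm_cis_diff_le[of th t] by simp
  also have "\<dots> \<le> 3/2 * l" using z by (simp add: abs_minus_commute)
  finally show "z \<in> cball (cis th) (3/2 * l)" by (simp add: dist_norm)
qed

text \<open>Allowing radii only up to \<open>1 - 1/(m + 1)\<close> gives compact images of
  rectangles, whose union over \<open>m\<close> is the box.\<close>

lemma carleson_box_borel [measurable]: "carleson_box th l \<in> sets borel"
proof -
  define K where "K m = (\<lambda>(r, t). of_real r * cis t) ` ({max 0 (1 - l) .. 1 - 1 / real (Suc m)} \<times> {th - l/2 .. th + l/2})" for m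
  have "compact (K m)" for m unfolding K_def
    by (intro compact_continuous_image compact_Times compact_Icc) (auto simp: split_def intro!: continuous_intros)
  moreover have "carleson_box th l = (\<Union>m. K m)"
  proof
    show "(\<Union>m. K m) \<subseteq> carleson_box th l"
    proof
      fix z assume "z \<in> (\<Union>m. K m)"
      then obtain m r t where "z = of_real r * cis t" "0 \<le> r" "1 - l \<le> r" "r \<le> 1 - 1 / real (Suc m)" "th - l/2 \<le> t" "t \<le> th + l/2"
        by (auto simp: K_def)
      moreover have "1 / real (Suc m) > 0" by simp
      ultimately show "z \<in> carleson_box th l" by (intro carleson_boxI[of z r t]) (linarith | simp add: abs_le_iff)+
    qed
    show "carleson_box th l \<subseteq> (\<Union>m. K m)"
    proof
      fix z assume "z \<in> carleson_box th l"
      then obtain r t where z: "z = of_real r * cis t" "0 \<le> r" "r < 1" "1 - r \<le> l" "\<bar>t - th\<bar> \<le> l / 2"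
        by (auto simp: carleson_box_def)
      obtain m where "1 / real (Suc m) < 1 - r" using nat_approx_posE[of "1 - r"] z by auto
      moreover have "th - l/2 \<le> t" "t \<le> th + l/2" using z(5) by linarith+
      ultimately have "z \<in> K m" unfolding K_def using z by (auto intro!: image_eqI[of _ _ "(r, t)"])
      then show "z \<in> (\<Union>m. K m)" by blast
    qed
  qed
  ultimately show ?thesis by (auto intro: borel_compact)
qed

lemma big_box_borel [measurable]: "big_box Q \<in> sets borel"
  by (simp add: big_box_def)

lemma emeasure_big_box_le: "emeasure lborel (big_box Q) \<le> ennreal (10000 * (1/4) ^ fst Q)"
proof (cases "fst Q < 5")
  case True
  then have "(1/4::real) ^ 4 \<le> (1/4) ^ fst Q" by (intro power_decreasing) auto
  moreover have "(1/4::real) ^ 4 = 1/256" by (simp add: power_divide)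
  ultimately have "pi \<le> 10000 * (1/4) ^ fst Q" using pi_less_4 by linarith
  then show ?thesis using True by (simp add: big_box_def emeasure_ball_complex ennreal_leI)
next
  case False
  define c where "c = cis (2 * pi * (real (snd Q) + 1/2) / 2 ^ fst Q)"
  define l where "l = (1/2::real) ^ fst Q"
  have l0: "0 < l" by (simp add: l_def)
  have "big_box Q \<subseteq> cball c (3/2 * (32 * l))"
    using carleson_box_subset_cball[of "2 * pi * (real (snd Q) + 1/2) / 2 ^ fst Q" "32 * l"] False
    by (simp add: big_box_def c_def l_def)
  \<comment> \<open>The radius 50 exceeds \<open>3/2 * 32 = 48\<close>, and with
    \<open>pi < 4\<close> it accounts for the constant \<open>4 * 50 * 50 = 10000\<close>.\<close>
  also have "\<dots> \<subseteq> ball c (50 * l)" using l0 by auto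
  finally have "emeasure lborel (big_box Q) \<le> emeasure lborel (ball c (50 * l))" by (intro emeasure_mono) auto
  also have "\<dots> = ennreal (pi * (50 * l)\<^sup>2)" by (rule emeasure_ball_complex) (use l0 in simp)
  also have "\<dots> \<le> ennreal (10000 * (1/4) ^ fst Q)"
  proof (rule ennreal_leI)
    have "l\<^sup>2 = (1/4) ^ fst Q" by (simp add: l_def power2_eq_square flip: power_mult_distrib)
    then show "pi * (50 * l)\<^sup>2 \<le> 10000 * (1/4) ^ fst Q" using pi_less_4 by (simp add: power_mult_distrib)
  qed
  finally show ?thesis .
qed

lemma big_box_cases: "big_box Q = ball 0 1 \<or> big_box Q \<in> carleson_boxes"
proof (cases "fst Q < 5")
  case False
  then have "(1/2::real) ^ fst Q \<le> (1/2) ^ 5" by (intro power_decreasing) auto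
  then have "0 < 32 * (1/2::real) ^ fst Q \<and> 32 * (1/2::real) ^ fst Q \<le> 1" by (simp add: power_divide)
  then show ?thesis using False unfolding big_box_def carleson_boxes_def by auto
qed (simp add: big_box_def)

text \<open>A box with \<open>l = 1\<close> has angular width one radian and radii starting at 0.
  Rounding an argument below \<open>2 * pi < 6.4\<close> gives an integer at most 6.\<close>

lemma ball_covered_by_boxes: "ball 0 1 \<subseteq> (\<Union>k\<le>6::nat. carleson_box (real k) 1)"
proof
  fix z :: complex assume z: "z \<in> ball 0 1"
  define k where "k = nat (round (Arg2pi z))"
  have "0 \<le> Arg2pi z" "Arg2pi z < 2 * pi" by (auto simp: Arg2pi_ge_0 Arg2pi_lt_2pi)
  moreover have "2 * pi < 6.4" using pi_approx by simp
  ultimately have "0 \<le> round (Arg2pi z)" "round (Arg2pi z) \<le> 6" unfolding round_def by linarith+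
  then have k: "k \<le> 6" "real k = of_int (round (Arg2pi z))" by (auto simp: k_def)
  have "\<bar>Arg2pi z - real k\<bar> \<le> 1/2" using of_int_round_abs_le[of "Arg2pi z"] k by (simp add: abs_minus_commute)
  then have "z \<in> carleson_box (real k) 1"
    using z Arg2pi_eq[of z] by (intro carleson_boxI[of _ "cmod z" "Arg2pi z"]) (auto simp: cis_conv_exp)
  with k show "z \<in> (\<Union>k\<le>6::nat. carleson_box (real k) 1)" by blast
qed

section \<open>The kernel on pairs of tiles\<close>

lemma abs_le_pi_abs_sin:
  fixes t :: real assumes "\<bar>t\<bar> \<le> pi / 2" shows "\<bar>t\<bar> \<le> pi * \<bar>sin t\<bar>"
proof -
  have *: "t \<le> pi * sin t" if t: "0 \<le> t" "t \<le> pi / 2" for t :: real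
  proof (cases "t \<le> pi / 6")
    case True
    have "2 * sin 0 - 0 \<le> 2 * sin t - t"
    proof (rule DERIV_nonneg_imp_nondecreasing[OF t(1)])
      fix x assume x: "0 \<le> x" "x \<le> t"
      have "cos (pi / 3) \<le> cos x" using x True pi_gt_zero by (intro cos_monotone_0_pi_le) auto
      then have "0 \<le> 2 * cos x - 1" by (simp add: cos_60)
      moreover have "((\<lambda>x. 2 * sin x - x) has_real_derivative 2 * cos x - 1) (at x)"
        by (auto intro!: derivative_eq_intros)
      ultimately show "\<exists>y. ((\<lambda>x. 2 * sin x - x) has_real_derivative y) (at x) \<and> 0 \<le> y" by blast
    qed
    then have "t \<le> 2 * sin t" by simp
    also have "\<dots> \<le> pi * sin t" using t pi_ge_two sin_ge_zero[of t] by (intro mult_right_mono) auto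
    finally show ?thesis .
  next
    case False
    have "sin (pi / 6) \<le> sin t" using t False pi_gt_zero by (intro sin_monotone_2pi_le) auto
    then have "pi * (1/2) \<le> pi * sin t" by (intro mult_left_mono) (auto simp: sin_30)
    then show ?thesis using t by linarith
  qed
  show ?thesis
  proof (cases "0 \<le> t")
    case True
    then have "0 \<le> sin t" using assms by (intro sin_ge_zero) auto
    then show ?thesis using *[of t] True assms by simp
  next
    case False
    then have "0 \<le> sin (-t)" using assms by (intro sin_ge_zero) auto
    then show ?thesis using *[of "-t"] False assms by simp
  qed
qed

lemma angle_le_dist:
  assumes "0 \<le> x" "\<bar>t\<bar> \<le> pi" shows "\<bar>t\<bar> \<le> pi * cmod (1 - of_real x * cis t)"
proof (cases "\<bar>t\<bar> \<le> pi / 2")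
  case True
  \<comment> \<open>Rotating by \<open>-t\<close> makes the term with \<open>x\<close> real, so the
    imaginary part no longer depends on \<open>x\<close>.\<close>
  have "\<bar>sin t\<bar> = \<bar>Im ((1 - of_real x * cis t) * cis (-t))\<bar>"
    by (simp add: left_diff_distrib mult.assoc cis_mult)
  also have "\<dots> \<le> cmod ((1 - of_real x * cis t) * cis (-t))" by (rule abs_Im_le_cmod)
  also have "\<dots> = cmod (1 - of_real x * cis t)" by (simp add: norm_mult)
  finally have "pi * \<bar>sin t\<bar> \<le> pi * cmod (1 - of_real x * cis t)" by simp
  with abs_le_pi_abs_sin[OF True] show ?thesis by linarith
next
  case False
  have "cos t \<le> 0"
  proof -
    have "cos \<bar>t\<bar> \<le> cos (pi / 2)" using False assms pi_gt_zero by (intro cos_monotone_0_pi_le) auto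
    then show ?thesis by simp
  qed
  then have "1 \<le> Re (1 - of_real x * cis t)" using assms by (simp add: mult_nonneg_nonpos)
  also have "\<dots> \<le> cmod (1 - of_real x * cis t)" by (rule complex_Re_le_cmod)
  finally have "pi * 1 \<le> pi * cmod (1 - of_real x * cis t)" by (intro mult_left_mono) auto
  then show ?thesis using assms by linarith
qed

lemma nbr_floor:
  fixes x y :: real and k :: int
  assumes "0 \<le> x" "0 \<le> y" "\<bar>x - y + k * 2 ^ n\<bar> < 1"
  shows "nbr (n, nat \<lfloor>x\<rfloor>) (n, nat \<lfloor>y\<rfloor>)"
proof -
  have "\<lfloor>x\<rfloor> \<le> x" "x < \<lfloor>x\<rfloor> + 1" "\<lfloor>y\<rfloor> \<le> y" "y < \<lfloor>y\<rfloor> + 1" by linarith+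
  then have "\<bar>real_of_int (\<lfloor>x\<rfloor> - \<lfloor>y\<rfloor> + k * 2 ^ n)\<bar> < 2" using assms by simp linarith
  then have "\<bar>\<lfloor>x\<rfloor> - \<lfloor>y\<rfloor> + k * 2 ^ n\<bar> \<le> 1" by linarith
  then show ?thesis using assms(1,2) by (auto simp: nbr_def)
qed

lemma tile_ancestor_eq:
  assumes "z \<in> tile R" "n \<le> fst R"
  obtains "desc (n, nat \<lfloor>2 ^ n * turn z\<rfloor>) R"
proof -
  define Q where "Q = (n, snd R div 2 ^ (fst R - n))"
  have d: "desc Q R" using assms(2) by (simp add: Q_def desc_def)
  note a = tile_ancestor(1,2)[OF assms(1) d]
  have "\<lfloor>2 ^ n * turn z\<rfloor> = int (snd Q)" using a by (intro floor_unique) (auto simp: Q_def)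
  then have "Q = (n, nat \<lfloor>2 ^ n * turn z\<rfloor>)" by (simp add: Q_def)
  with d that show thesis by simp
qed

text \<open>Generation \<open>n\<close> is the scale of
  \<open>\<delta> = cmod (1 - cnj z * w)\<close>. As \<open>\<delta>\<close> dominates the distances
  of both points to the circle, \<open>n\<close> is at most their generations; as it dominates the
  angular distance, the ancestors in generation \<open>n\<close> are neighbours. This trades the
  kernel for the tree coefficient \<open>4 ^ n\<close>.\<close>

lemma kernel_tile_bound:
  assumes z: "z \<in> tile A" and w: "w \<in> tile B"
  obtains Q Q' where "desc Q A" "desc Q' B" "nbr Q Q'" "1 / (cmod (1 - cnj z * w))\<^sup>2 \<le> 4 * 4 ^ fst Q"
proof -
  define \<delta> where "\<delta> = cmod (1 - cnj z * w)"
  have z1: "cmod z < 1" "cmod w < 1" using z w tile_subset_ball[of A] tile_subset_ball[of B] by auto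
  have \<delta>1: "1 - cmod z * cmod w \<le> \<delta>"
    using norm_triangle_ineq2[of 1 "cnj z * w"] by (simp add: \<delta>_def norm_mult)
  have zw: "cmod z * cmod w \<le> cmod z" "cmod z * cmod w \<le> cmod w"
    using z1 by (auto simp: mult_left_le mult_left_le_one_le)
  have \<delta>z: "(1/2) ^ Suc (fst A) < \<delta>" "(1/2) ^ Suc (fst B) < \<delta>"
    using z w \<delta>1 zw by (auto simp: tile_def)
  then have \<delta>0: "0 < \<delta>" using zero_less_power[of "1/2::real" "Suc (fst A)"] by linarith
  define n where "n = (LEAST n. (1/2) ^ Suc n < \<delta>)"
  have n: "(1/2) ^ Suc n < \<delta>" unfolding n_def by (rule LeastI[of _ "fst A"]) (rule \<delta>z)
  have nA: "n \<le> fst A" "n \<le> fst B" unfolding n_def by (intro Least_le \<delta>z)+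
  define t where "t = turn w - turn z"
  have t: "-1 < t" "t < 1" using turn_bounds[of z] turn_bounds[of w] by (auto simp: t_def)
  \<comment> \<open>Adding an integer number of turns brings the angular difference into
    \<open>[-pi, pi]\<close>, where it is controlled by the chord.\<close>
  have "\<exists>k::int. \<bar>t + k\<bar> \<le> 1/2"
  proof -
    consider "t < -1/2" | "-1/2 \<le> t" "t \<le> 1/2" | "1/2 < t" by linarith
    then show ?thesis
    proof cases
      case 1 then show ?thesis using t by (intro exI[of _ 1]) auto
    next
      case 2 then show ?thesis by (intro exI[of _ 0]) auto
    next
      case 3 then show ?thesis using t by (intro exI[of _ "-1"]) auto
    qed
  qed
  then obtain k :: int where k: "\<bar>t + k\<bar> \<le> 1/2" by blast
  have nz2: "2 ^ n * \<bar>t + k\<bar> < 1"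
  \<comment> \<open>Minimality gives \<open>\<delta> \<le> (1/2) ^ n\<close> only if there is a
    smaller generation; for \<open>n = 0\<close> the bound on the angle is automatic.\<close>
  proof (cases n)
    case 0
    then show ?thesis using k by simp
  next
    case (Suc m)
    have "\<not> (1/2) ^ Suc m < \<delta>" unfolding n_def by (rule not_less_Least) (use Suc n_def in simp)
    then have \<delta>n: "\<delta> \<le> (1/2) ^ n" by (simp add: Suc)
    have "cnj z * w = of_real (cmod z * cmod w) * cis (2 * pi * (t + k))"
    proof -
      have "cnj z * w = cnj (of_real (cmod z) * cis (2 * pi * turn z)) * (of_real (cmod w) * cis (2 * pi * turn w))"
        using polar_turn[of z] polar_turn[of w] by simp
      also have "\<dots> = of_real (cmod z * cmod w) * (cis (- (2 * pi * turn z)) * cis (2 * pi * turn w))"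
        by (simp add: cis_cnj)
      also have "cis (- (2 * pi * turn z)) * cis (2 * pi * turn w) = cis (2 * pi * t)"
        by (simp add: cis_mult t_def algebra_simps)
      also have "cis (2 * pi * t) = cis (2 * pi * t) * cis (2 * pi * of_int k)"
        using cis_multiple_2pi[of "of_int k"] by (simp only: Ints_of_int mult_1_right)
      also have "\<dots> = cis (2 * pi * (t + k))" by (simp only: cis_mult distrib_left)
      finally show ?thesis .
    qed
    then have "\<delta> = cmod (1 - of_real (cmod z * cmod w) * cis (2 * pi * (t + k)))" by (simp add: \<delta>_def)
    then have "\<bar>2 * pi * (t + k)\<bar> \<le> pi * \<delta>"
      using angle_le_dist[of "cmod z * cmod w" "2 * pi * (t + k)"] k by (simp add: abs_mult)
    moreover have "\<bar>2 * pi * (t + k)\<bar> = pi * (2 * \<bar>t + k\<bar>)" by (simp add: abs_mult)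
    ultimately have "pi * (2 * \<bar>t + k\<bar>) \<le> pi * \<delta>" by simp
    then have "2 * \<bar>t + k\<bar> \<le> \<delta>" by (simp only: mult_le_cancel_left_pos pi_gt_zero)
    also note \<delta>n
    finally have "2 ^ n * (2 * \<bar>t + k\<bar>) \<le> 2 ^ n * (1/2) ^ n" by (intro mult_left_mono) auto
    then show ?thesis by (simp add: power_divide)
  qed
  have "2 ^ n * turn z - 2 ^ n * turn w + (-k) * 2 ^ n = - (2 ^ n * (t + k))" by (simp add: t_def algebra_simps)
  then have "\<bar>2 ^ n * turn z - 2 ^ n * turn w + real_of_int (-k) * 2 ^ n\<bar> < 1" using nz2 by (simp add: abs_mult)
  then have nb: "nbr (n, nat \<lfloor>2 ^ n * turn z\<rfloor>) (n, nat \<lfloor>2 ^ n * turn w\<rfloor>)"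
    using turn_bounds by (intro nbr_floor[where k = "-k"]) auto
  have "1 / \<delta> \<le> 2 * 2 ^ n" using n \<delta>0 by (simp add: field_simps power_divide)
  then have "(1 / \<delta>)\<^sup>2 \<le> (2 * 2 ^ n)\<^sup>2" using \<delta>0 by (intro power_mono) auto
  also have "\<dots> = 4 * 4 ^ n" by (simp add: power2_eq_square mult_ac flip: power_mult_distrib)
  finally have "1 / \<delta>\<^sup>2 \<le> 4 * 4 ^ n" by (simp add: power_divide)
  show thesis
    by (rule tile_ancestor_eq[OF z nA(1)], rule tile_ancestor_eq[OF w nA(2)], rule that)
      (use nb \<open>1 / \<delta>\<^sup>2 \<le> 4 * 4 ^ n\<close> in \<open>auto simp: \<delta>_def\<close>)
qed

lemma nbr_sym: "nbr Q R \<Longrightarrow> nbr R Q"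
proof -
  assume "nbr Q R"
  then obtain k :: int where k: "\<bar>int (snd Q) - int (snd R) + k * 2 ^ fst Q\<bar> \<le> 1" "fst Q = fst R" unfolding nbr_def by blast
  have "int (snd R) - int (snd Q) + (-k) * 2 ^ fst R = - (int (snd Q) - int (snd R) + k * 2 ^ fst Q)" using k(2) by simp
  then show ?thesis using k unfolding nbr_def by (intro conjI exI[of _ "-k"]) simp_all
qed

lemma nbr_card:
  shows "card {Q' \<in> tiles N. nbr Q Q'} \<le> 3" "card {Q \<in> tiles N. nbr Q Q'} \<le> 3"
proof -
  have sym: "nbr Q Q' \<longleftrightarrow> nbr Q' Q" for Q Q'
    using nbr_sym[of Q Q'] nbr_sym[of Q' Q] by blast
  have 1: "card {Q' \<in> tiles N. nbr Q Q'} \<le> 3" for Q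
  proof -
    define f where "f e = (fst Q, nat ((int (snd Q) + e) mod 2 ^ fst Q))" for e :: int
    have "{Q' \<in> tiles N. nbr Q Q'} \<subseteq> f ` {-1, 0, 1}"
    proof
      fix Q' assume "Q' \<in> {Q' \<in> tiles N. nbr Q Q'}"
      then have t: "Q' \<in> tiles N" and nb: "nbr Q Q'" by blast+
      have q: "snd Q' < 2 ^ fst Q'" using t by (cases Q') (simp add: tiles_def)
      have q2: "fst Q' = fst Q" using nb by (simp add: nbr_def)
      obtain k :: int where k: "\<bar>int (snd Q) - int (snd Q') + k * 2 ^ fst Q\<bar> \<le> 1"
        using nb unfolding nbr_def by blast
      define e where "e = - (int (snd Q) - int (snd Q') + k * 2 ^ fst Q)"
      have "\<bar>e\<bar> \<le> 1" using k unfolding e_def abs_minus_cancel .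
      then have e: "e \<in> {-1, 0, 1}" by auto
      have "(int (snd Q) + e) mod 2 ^ fst Q = (int (snd Q') + (-k) * 2 ^ fst Q) mod 2 ^ fst Q" by (simp add: e_def)
      also have "\<dots> = int (snd Q') mod 2 ^ fst Q" by (rule mod_mult_self1)
      also have "\<dots> = int (snd Q')"
      proof (rule mod_pos_pos_trivial)
        show "int (snd Q') < 2 ^ fst Q" using q q2 by (metis of_nat_less_iff of_nat_numeral of_nat_power)
      qed simp
      finally have "f e = Q'" by (simp add: f_def prod_eq_iff q2)
      with e show "Q' \<in> f ` {-1, 0, 1}" by blast
    qed
    then have "card {Q' \<in> tiles N. nbr Q Q'} \<le> card (f ` {-1, 0, 1})" by (intro card_mono) auto
    also have "\<dots> \<le> card {-1, 0, 1 :: int}" by (rule card_image_le) simp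
    finally show ?thesis by simp
  qed
  show "card {Q' \<in> tiles N. nbr Q Q'} \<le> 3" by (rule 1)
  show "card {Q \<in> tiles N. nbr Q Q'} \<le> 3" using 1[of Q'] unfolding sym[of _ Q'] .
qed

section \<open>Weights on the disc\<close>

lemma tile_area_simps [simp]: "tile_area Q \<noteq> 0" "0 \<le> tile_area Q" "\<bar>tile_area Q\<bar> = tile_area Q"
  by (auto simp: tile_area_def)

lemma powr_root_le:
  fixes x y K \<tau> :: real
  assumes "0 < \<tau>" "0 < x" "0 < y" "0 \<le> K" "x powr \<tau> \<le> K * y powr \<tau>"
  shows "x \<le> K powr (1/\<tau>) * y"
proof -
  have "(x powr \<tau>) powr (1/\<tau>) \<le> (K * y powr \<tau>) powr (1/\<tau>)" using assms by (intro powr_mono2) auto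
  then show ?thesis using assms by (simp add: powr_mult powr_powr)
qed

lemma unit_box: "carleson_box th 1 \<in> carleson_boxes"
  unfolding carleson_boxes_def by (intro CollectI exI[of _ th] exI[of _ 1]) simp

section \<open>Integrals over tiles and boxes\<close>

definition nnI :: "(complex \<Rightarrow> real) \<Rightarrow> complex set \<Rightarrow> ennreal" where
  "nnI f X = (\<integral>\<^sup>+z\<in>X. ennreal (f z) \<partial>lborel)"

text \<open>\<open>enn2real\<close> sends infinity to 0, so a bound on \<open>rI\<close> is
  informative only together with finiteness of \<open>nnI\<close>; the two are carried side by
  side.\<close>

definition rI :: "(complex \<Rightarrow> real) \<Rightarrow> complex set \<Rightarrow> real" where
  "rI f X = enn2real (nnI f X)"

lemma rI_nonneg [simp]: "0 \<le> rI f X" by (simp add: rI_def)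

lemma nnI_eq_rI: "nnI f X < \<infinity> \<Longrightarrow> nnI f X = ennreal (rI f X)"
  by (simp add: rI_def less_top)

lemma nnI_mono_set: "X \<subseteq> Y \<Longrightarrow> nnI f X \<le> nnI f Y"
  unfolding nnI_def by (intro nn_integral_mono) (auto simp: indicator_def)

lemma nnI_finite_subset: "X \<subseteq> Y \<Longrightarrow> nnI f Y < \<infinity> \<Longrightarrow> nnI f X < \<infinity>"
  using nnI_mono_set by (rule order.strict_trans1)

lemma rI_mono_set: "X \<subseteq> Y \<Longrightarrow> nnI f Y < \<infinity> \<Longrightarrow> rI f X \<le> rI f Y"
  unfolding rI_def by (intro enn2real_mono nnI_mono_set) (auto simp: less_top)

lemma nnI_mono: "(\<And>z. z \<in> X \<Longrightarrow> f z \<le> g z) \<Longrightarrow> nnI f X \<le> nnI g X"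
  unfolding nnI_def by (intro nn_integral_mono) (auto simp: indicator_def ennreal_leI)

lemma nnI_const: "X \<in> sets borel \<Longrightarrow> 0 \<le> c \<Longrightarrow> nnI (\<lambda>_. c) X = ennreal c * emeasure lborel X"
  unfolding nnI_def by (simp add: nn_integral_cmult)

lemma rI_tile_ge:
  assumes "valid Q" "0 \<le> c" "\<And>z. z \<in> tile Q \<Longrightarrow> c \<le> f z" "nnI f (tile Q) < \<infinity>"
  shows "c * (tile_area Q / 256) \<le> rI f (tile Q)"
proof -
  have "ennreal (c * (tile_area Q / 256)) = ennreal c * ennreal ((1/4) ^ fst Q / 256)"
    using assms(2) by (simp add: tile_area_def flip: ennreal_mult)
  also have "\<dots> \<le> ennreal c * emeasure lborel (tile Q)"
    using emeasure_tile_ge[OF assms(1)] by (intro mult_left_mono) auto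
  also have "\<dots> = nnI (\<lambda>_. c) (tile Q)" using assms(2) by (simp add: nnI_const)
  also have "\<dots> \<le> nnI f (tile Q)" by (rule nnI_mono[OF assms(3)])
  also have "\<dots> = ennreal (rI f (tile Q))" by (rule nnI_eq_rI[OF assms(4)])
  finally show ?thesis by simp
qed

lemma rI_tile_le:
  assumes "0 \<le> c" "\<And>z. z \<in> tile Q \<Longrightarrow> f z \<le> c"
  shows "nnI f (tile Q) < \<infinity>" "rI f (tile Q) \<le> c * (10000 * tile_area Q)"
proof -
  have "nnI f (tile Q) \<le> nnI (\<lambda>_. c) (tile Q)" by (rule nnI_mono[OF assms(2)])
  also have "\<dots> = ennreal c * emeasure lborel (tile Q)" using assms(1) by (simp add: nnI_const)
  also have "\<dots> \<le> ennreal c * ennreal (10000 * (1/4) ^ fst Q)"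
    by (intro mult_left_mono order_trans[OF emeasure_mono emeasure_big_box_le] desc_tile_subset) auto
  also have "\<dots> = ennreal (c * (10000 * tile_area Q))" using assms(1) by (simp add: tile_area_def flip: ennreal_mult)
  finally have *: "nnI f (tile Q) \<le> ennreal (c * (10000 * tile_area Q))" .
  then show "nnI f (tile Q) < \<infinity>" by (rule order.strict_trans1) simp
  show "rI f (tile Q) \<le> c * (10000 * tile_area Q)" unfolding rI_def
    using enn2real_mono[OF *] assms(1) by (simp add: less_imp_le)
qed

lemma dsum_rI_le:
  assumes "nnI f (big_box Q) < \<infinity>" "f \<in> borel_measurable borel"
  shows "dsum N (\<lambda>R. rI f (tile R)) Q \<le> rI f (big_box Q)"
proof -
  have fin: "nnI f (tile R) < \<infinity>" if "R \<in> dset N Q" for R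
    using that by (intro nnI_finite_subset[OF desc_tile_subset assms(1)]) (simp add: dset_def)
  have "ennreal (dsum N (\<lambda>R. rI f (tile R)) Q) = (\<Sum>R\<in>dset N Q. nnI f (tile R))"
    unfolding dsum_def using fin by (subst sum_ennreal[symmetric]) (auto intro!: sum.cong simp: nnI_eq_rI)
  also have "\<dots> = (\<integral>\<^sup>+z. (\<Sum>R\<in>dset N Q. ennreal (f z) * indicator (tile R) z) \<partial>lborel)"
    unfolding nnI_def using assms(2) by (subst nn_integral_sum) auto
  also have "\<dots> \<le> nnI f (big_box Q)"
    unfolding nnI_def
  proof (intro nn_integral_mono)
    fix z
    show "(\<Sum>R\<in>dset N Q. ennreal (f z) * indicator (tile R) z) \<le> ennreal (f z) * indicator (big_box Q) z"
    proof (cases "\<exists>R\<in>dset N Q. z \<in> tile R")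
      case True
      then obtain R where R: "R \<in> dset N Q" "z \<in> tile R" by blast
      have "(\<Sum>R\<in>dset N Q. ennreal (f z) * indicator (tile R) z) = (\<Sum>R'\<in>{R}. ennreal (f z) * indicator (tile R') z)"
      proof (intro sum.mono_neutral_right ballI)
        fix R' assume "R' \<in> dset N Q - {R}"
        then have "tile R' \<inter> tile R = {}" by (intro tile_disjoint) auto
        then have "z \<notin> tile R'" using R by blast
        then show "ennreal (f z) * indicator (tile R') z = 0" by simp
      qed (use R in auto)
      moreover have "z \<in> big_box Q" using desc_tile_subset[of Q R] R by (auto simp: dset_def)
      ultimately show ?thesis using R by simp
    next
      case False
      then have eq: "(\<Sum>R\<in>dset N Q. ennreal (f z) * indicator (tile R) z) = 0" by (intro sum.neutral) (auto simp: indicator_def)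
      show ?thesis unfolding eq by simp
    qed
  qed
  also have "\<dots> = ennreal (rI f (big_box Q))" by (rule nnI_eq_rI[OF assms(1)])
  finally show ?thesis by simp
qed

lemma nnI_ball_finite:
  assumes "f \<in> borel_measurable borel" "\<And>X. X \<in> carleson_boxes \<Longrightarrow> nnI f X < \<infinity>"
  shows "nnI f (ball 0 1) < \<infinity>"
proof -
  have "nnI f (ball 0 1) \<le> (\<integral>\<^sup>+z. (\<Sum>k\<le>6::nat. ennreal (f z) * indicator (carleson_box (real k) 1) z) \<partial>lborel)"
    unfolding nnI_def
  proof (intro nn_integral_mono)
    fix z
    show "ennreal (f z) * indicator (ball 0 1) z \<le> (\<Sum>k\<le>6::nat. ennreal (f z) * indicator (carleson_box (real k) 1) z)"
    proof (cases "z \<in> ball 0 1")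
      case True
      then obtain k :: nat where k: "k \<le> 6" "z \<in> carleson_box (real k) 1" using ball_covered_by_boxes by blast
      have "ennreal (f z) * indicator (ball 0 1) z = ennreal (f z) * indicator (carleson_box (real k) 1) z" using True k by simp
      also have "\<dots> \<le> (\<Sum>k\<le>6::nat. ennreal (f z) * indicator (carleson_box (real k) 1) z)"
        by (rule member_le_sum) (use k in auto)
      finally show ?thesis .
    qed simp
  qed
  also have "\<dots> = (\<Sum>k\<le>6::nat. nnI f (carleson_box (real k) 1))"
    unfolding nnI_def using assms(1) by (subst nn_integral_sum) auto
  also have "\<dots> = (\<Sum>k\<le>6::nat. ennreal (rI f (carleson_box (real k) 1)))"
    by (intro sum.cong refl nnI_eq_rI assms(2) unit_box)
  also have "\<dots> < \<infinity>" by (subst sum_ennreal) auto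
  finally show ?thesis .
qed

lemma nnI_box_finite:
  assumes "f \<in> borel_measurable borel" "\<And>X. X \<in> carleson_boxes \<Longrightarrow> nnI f X < \<infinity>"
  shows "nnI f (big_box Q) < \<infinity>"
  using nnI_finite_subset[OF big_box_subset_ball nnI_ball_finite[OF assms]] .

lemma rI_pos:
  assumes "f \<in> borel_measurable borel" "X \<in> sets borel" "\<And>z. z \<in> X \<Longrightarrow> 0 < f z" "0 < emeasure lborel X" "nnI f X < \<infinity>"
  shows "0 < rI f X"
proof (rule ccontr)
  assume "\<not> 0 < rI f X"
  then have "rI f X = 0" using rI_nonneg[of f X] by linarith
  then have "nnI f X = 0" using nnI_eq_rI[OF assms(5)] by simp
  then have "AE z in lborel. ennreal (f z) * indicator X z = 0"
    unfolding nnI_def using assms(1,2) by (subst (asm) nn_integral_0_iff_AE) auto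
  then have "AE z in lborel. z \<notin> X"
  proof eventually_elim
    case (elim z)
    show ?case
    proof
      assume z: "z \<in> X"
      then have "f z \<le> 0" using elim by (simp add: ennreal_eq_0_iff)
      with assms(3)[OF z] show False by simp
    qed
  qed
  then have "emeasure lborel X = 0" using assms(2) by (subst emeasure_eq_0_AE[symmetric]) auto
  with assms(4) show False by simp
qed

lemma tile_emeasure_pos: "valid Q \<Longrightarrow> 0 < emeasure lborel (tile Q)"
proof -
  assume "valid Q"
  have "0 < ennreal ((1/4) ^ fst Q / 256)" by simp
  also have "\<dots> \<le> emeasure lborel (tile Q)" using emeasure_tile_ge[OF \<open>valid Q\<close>] by simp
  finally show ?thesis .
qed

text \<open>The exponents of the theorem are encoded by \<open>\<pi>0 = 1/p0'\<close>; the weight on the disc is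
  \<open>g powr (1 - p * \<pi>0) * u powr (1 - p/2)\<close> with \<open>u = |\<psi>'|\<^sup>2\<close> and \<open>g = (\<sigma> \<circ> \<psi>) powr s\<close>, \<open>1/s = 1 - p * \<pi>0\<close>.\<close>

locale disc_weight =
  fixes u g :: "complex \<Rightarrow> real" and \<pi>0 p q P1 :: real
  assumes p: "1 < p" "1/p + 1/q = 1" and \<pi>0: "0 \<le> \<pi>0" "\<pi>0 < 1/2" "p * \<pi>0 < 1" "q * \<pi>0 < 1"
    and P1: "P1 = (p * (1 - \<pi>0) - 1) / (1 - p * \<pi>0)"
    and u_meas [measurable]: "u \<in> borel_measurable borel" and g_meas [measurable]: "g \<in> borel_measurable borel"
    and u_pos: "\<And>z. z \<in> ball 0 1 \<Longrightarrow> 0 < u z" and g_pos: "\<And>z. z \<in> ball 0 1 \<Longrightarrow> 0 < g z"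
    and u_cont: "continuous_on (ball 0 1) u"
    and u_sub: "\<And>z r. 0 < r \<Longrightarrow> ball z r \<subseteq> ball 0 1 \<Longrightarrow> ennreal (pi * r\<^sup>2 * u z) \<le> nnI u (ball z r)"
    and u_neg_sub: "\<And>z r \<tau>. 0 < \<tau> \<Longrightarrow> 0 < r \<Longrightarrow> ball z r \<subseteq> ball 0 1 \<Longrightarrow>
          ennreal (pi * r\<^sup>2 * u z powr (-\<tau>)) \<le> nnI (\<lambda>z. u z powr (-\<tau>)) (ball z r)"
    and u_box: "\<And>\<tau>. 0 < \<tau> \<Longrightarrow> \<tau> * (2 * \<pi>0) < 1 - 2 * \<pi>0 \<Longrightarrow> \<exists>C. \<forall>X\<in>carleson_boxes.
          nnI u X < \<infinity> \<and> nnI (\<lambda>z. u z powr (-\<tau>)) X < \<infinity> \<and>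
          rI u X * rI (\<lambda>z. u z powr (-\<tau>)) X powr (1/\<tau>) \<le> C * measure lborel X powr (1 + 1/\<tau>)"
    and g_box: "\<exists>C. \<forall>X\<in>carleson_boxes. nnI (\<lambda>z. g z * u z) X < \<infinity> \<and> nnI (\<lambda>z. g z powr (-1/P1) * u z) X < \<infinity> \<and>
          rI (\<lambda>z. g z * u z) X * rI (\<lambda>z. g z powr (-1/P1) * u z) X powr P1 \<le> C * rI u X powr (1 + P1)"
begin

section \<open>The size of \<open>u\<close> on tiles and boxes\<close>

lemma tile_ball: "z \<in> tile Q \<Longrightarrow> z \<in> ball 0 1" using tile_subset_ball by blast

lemma q: "1 < q" "0 < q"
proof -
  have "1/p < 1" "0 < 1/p" using p by auto
  then have "0 < 1/q" "1/q < 1" using p(2) by linarith+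
  then show "0 < q" by (simp only: zero_less_divide_1_iff)
  with \<open>1/q < 1\<close> show "1 < q" by simp
qed

text \<open>\<open>1 + P1\<close> is the Bekolle exponent of \<open>g\<close> with respect to the
  measure \<open>u dA\<close>. The numerator of \<open>P1\<close> is positive because
  \<open>q * \<pi>0 < 1\<close> means \<open>p * \<pi>0 < p - 1\<close>.\<close>

lemma P1_pos: "0 < P1"
proof -
  have "q = p / (p - 1)" using p q by (simp add: field_simps)
  then have "p * \<pi>0 / (p - 1) < 1" using \<pi>0(4) by simp
  then have "p * \<pi>0 < p - 1" using p(1) by (simp add: pos_divide_less_eq)
  then have "0 < p * (1 - \<pi>0) - 1" by (simp add: algebra_simps)
  then show ?thesis using \<pi>0 by (simp add: P1)
qed

text \<open>Big boxes are Carleson boxes, except that the first generations use the whole disc; one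
  additional ratio in the maximum extends a box estimate to them. Positivity of \<open>G\<close> is
  what allows the constant to be enlarged.\<close>

lemma box_const:
  assumes "\<And>X. X \<in> carleson_boxes \<Longrightarrow> (F X :: real) \<le> C * G X"
    and "\<And>Q. valid Q \<Longrightarrow> G (big_box Q) > 0"
  obtains C' where "1 \<le> C'" "\<forall>Q. valid Q \<longrightarrow> F (big_box Q) \<le> C' * G (big_box Q)"
proof -
  define C' where "C' = Max {1, C, F (ball 0 1) / G (ball 0 1)}"
  have C': "1 \<le> C'" "C \<le> C'" "F (ball 0 1) / G (ball 0 1) \<le> C'" by (auto simp: C'_def)
  have G0: "G (ball 0 1) > 0" using assms(2)[of "(0,0)"] by (simp add: big_box_def)
  show thesis
  proof (rule that[OF C'(1)]; intro allI impI)
    fix Q :: "nat \<times> nat" assume Q: "valid Q"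
    consider "big_box Q = ball 0 1" | "big_box Q \<in> carleson_boxes" using big_box_cases by blast
    then show "F (big_box Q) \<le> C' * G (big_box Q)"
    proof cases
      case 1 then show ?thesis using C'(3) G0 by (simp add: pos_divide_le_eq)
    next
      case 2
      have "F (big_box Q) \<le> C * G (big_box Q)" by (rule assms(1)[OF 2])
      also have "\<dots> \<le> C' * G (big_box Q)" using C'(2) assms(2)[OF Q] by (intro mult_right_mono) auto
      finally show ?thesis .
    qed
  qed
qed

lemma tile_subset_big_box: "tile Q \<subseteq> big_box Q" by (rule desc_tile_subset) simp

lemma big_box_emeasure:
  assumes "valid Q"
  shows "0 < emeasure lborel (big_box Q)" "0 < measure lborel (big_box Q)" "measure lborel (big_box Q) \<le> 10000 * tile_area Q"
proof -
  have "emeasure lborel (tile Q) \<le> emeasure lborel (big_box Q)" by (intro emeasure_mono tile_subset_big_box) simp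
  then show *: "0 < emeasure lborel (big_box Q)" using tile_emeasure_pos[OF assms] by (rule order.strict_trans2[rotated])
  have le: "emeasure lborel (big_box Q) \<le> ennreal (10000 * tile_area Q)"
    using emeasure_big_box_le by (simp add: tile_area_def)
  then have "emeasure lborel (big_box Q) < \<infinity>" by (rule order.strict_trans1) simp
  then have eq: "emeasure lborel (big_box Q) = ennreal (measure lborel (big_box Q))"
    by (intro emeasure_eq_ennreal_measure) (simp add: less_top)
  show "0 < measure lborel (big_box Q)" using * unfolding eq by simp
  show "measure lborel (big_box Q) \<le> 10000 * tile_area Q" using le unfolding eq by (simp add: less_imp_le)
qed

text \<open>One fixed admissible exponent, for the places where any negative power of
  \<open>u\<close> will do.\<close>

definition \<tau>0 :: real where "\<tau>0 = (1 - 2 * \<pi>0) / 2"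

lemma \<tau>0: "0 < \<tau>0" "\<tau>0 * (2 * \<pi>0) < 1 - 2 * \<pi>0"
proof -
  show "0 < \<tau>0" using \<pi>0 by (simp add: \<tau>0_def)
  have "(1 - 2 * \<pi>0) * \<pi>0 < (1 - 2 * \<pi>0) * 1" using \<pi>0 by (intro mult_strict_left_mono) auto
  then show "\<tau>0 * (2 * \<pi>0) < 1 - 2 * \<pi>0" by (simp add: \<tau>0_def)
qed

lemma u_fin: "nnI u (big_box Q) < \<infinity>"
proof (rule nnI_box_finite[OF u_meas])
  show "nnI u X < \<infinity>" if "X \<in> carleson_boxes" for X using u_box[OF \<tau>0] that by blast
qed

lemma u_neg_fin: "0 < \<tau> \<Longrightarrow> \<tau> * (2 * \<pi>0) < 1 - 2 * \<pi>0 \<Longrightarrow> nnI (\<lambda>z. u z powr (-\<tau>)) (big_box Q) < \<infinity>"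
proof (rule nnI_box_finite)
  assume "0 < \<tau>" "\<tau> * (2 * \<pi>0) < 1 - 2 * \<pi>0"
  from u_box[OF this] show "nnI (\<lambda>z. u z powr (-\<tau>)) X < \<infinity>" if "X \<in> carleson_boxes" for X using that by blast
qed measurable

text \<open>The average of \<open>u\<close> over the big box up to bounded factors, the model area
  being comparable to the area of the box.\<close>

definition U :: "nat \<times> nat \<Rightarrow> real" where "U Q = rI u (big_box Q) / tile_area Q"

lemma rI_u: "rI u (big_box Q) = tile_area Q * U Q"
  using tile_area_pos[of Q] by (simp add: U_def)

lemma U_pos: "valid Q \<Longrightarrow> 0 < U Q"
  unfolding U_def using big_box_subset_ball[of Q]
  by (intro divide_pos_pos rI_pos u_fin big_box_emeasure tile_area_pos) (auto intro: u_pos)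

lemma u_neg_box:
  assumes \<tau>: "0 < \<tau>" "\<tau> * (2 * \<pi>0) < 1 - 2 * \<pi>0"
  obtains C where "1 \<le> C" "\<forall>Q. valid Q \<longrightarrow> rI (\<lambda>z. u z powr (-\<tau>)) (big_box Q) \<le> C * (tile_area Q * U Q powr (-\<tau>))"
proof -
  let ?J = "\<lambda>X. rI (\<lambda>z. u z powr (-\<tau>)) X"
  obtain C0 where C0: "\<And>X. X \<in> carleson_boxes \<Longrightarrow> rI u X * ?J X powr (1/\<tau>) \<le> C0 * measure lborel X powr (1 + 1/\<tau>)"
    using u_box[OF \<tau>] by blast
  have "\<exists>C1. 1 \<le> C1 \<and> (\<forall>Q. valid Q \<longrightarrow> rI u (big_box Q) * ?J (big_box Q) powr (1/\<tau>) \<le> C1 * measure lborel (big_box Q) powr (1 + 1/\<tau>))"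
  proof (rule box_const[of "\<lambda>X. rI u X * ?J X powr (1/\<tau>)" C0 "\<lambda>X. measure lborel X powr (1 + 1/\<tau>)"], goal_cases)
    case (1 X) then show ?case by (rule C0)
  next
    case (2 Q) then show ?case using big_box_emeasure(2)[OF 2] by simp
  next
    case (3 C') then show ?case by blast
  qed
  then obtain C1 where C1: "1 \<le> C1" and
    le: "\<forall>Q. valid Q \<longrightarrow> rI u (big_box Q) * ?J (big_box Q) powr (1/\<tau>) \<le> C1 * measure lborel (big_box Q) powr (1 + 1/\<tau>)"
    by blast
  define C where "C = C1 * 10000 powr (1 + 1/\<tau>)"
  have C: "1 \<le> C"
  proof -
    have "1 * 1 \<le> C1 * 10000 powr (1 + 1/\<tau>)" using C1 \<tau> by (intro mult_mono ge_one_powr_ge_zero) auto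
    then show ?thesis by (simp add: C_def)
  qed
  show thesis
  proof (rule that[of "C powr \<tau>"]; (intro allI impI)?)
    show "1 \<le> C powr \<tau>" using C \<tau> by (intro ge_one_powr_ge_zero) auto
    fix Q :: "nat \<times> nat" assume Q: "valid Q"
    let ?t = "tile_area Q"
    have t: "0 < ?t" by simp
    have "?t * U Q * ?J (big_box Q) powr (1/\<tau>) \<le> C1 * measure lborel (big_box Q) powr (1 + 1/\<tau>)"
      using le[rule_format, OF Q] by (simp add: rI_u)
    also have "\<dots> \<le> C1 * (10000 * ?t) powr (1 + 1/\<tau>)"
      using big_box_emeasure[OF Q] C1 \<tau> by (intro mult_left_mono powr_mono2) auto
    also have "\<dots> = C * (?t * ?t powr (1/\<tau>))"
      by (simp add: powr_mult C_def powr_add abs_mult)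
    finally have "?t * (U Q * ?J (big_box Q) powr (1/\<tau>)) \<le> ?t * (C * ?t powr (1/\<tau>))" by (simp add: mult_ac)
    then have "U Q * ?J (big_box Q) powr (1/\<tau>) \<le> C * ?t powr (1/\<tau>)" using t by (simp only: mult_le_cancel_left_pos)
    then have "?J (big_box Q) powr (1/\<tau>) \<le> C * ?t powr (1/\<tau>) / U Q" using U_pos[OF Q] by (simp add: pos_le_divide_eq mult_ac)
    then have "(?J (big_box Q) powr (1/\<tau>)) powr \<tau> \<le> (C * ?t powr (1/\<tau>) / U Q) powr \<tau>"
      using \<tau> by (intro powr_mono2) auto
    also have "(C * ?t powr (1/\<tau>) / U Q) powr \<tau> = C powr \<tau> * (?t * U Q powr (-\<tau>))"
      using \<tau> U_pos[OF Q] C t by (simp add: powr_mult powr_divide powr_powr powr_minus field_simps)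
    also have "(?J (big_box Q) powr (1/\<tau>)) powr \<tau> = ?J (big_box Q)" using \<tau> by (simp add: powr_powr)
    finally show "?J (big_box Q) \<le> C powr \<tau> * (?t * U Q powr (-\<tau>))" .
  qed
qed

text \<open>The sub-mean value property on a disc around \<open>z\<close> inside the big box; 16 is
  the ratio of the model area to the square of the radius of the disc.\<close>

lemma u_tile_deep:
  assumes Q: "valid Q" "5 \<le> fst Q" and z: "z \<in> tile Q"
  shows "u z \<le> 16 * U Q"
    and "0 < \<tau> \<Longrightarrow> \<tau> * (2 * \<pi>0) < 1 - 2 * \<pi>0 \<Longrightarrow> tile_area Q * u z powr (-\<tau>) \<le> 16 * rI (\<lambda>z. u z powr (-\<tau>)) (big_box Q)"
proof -
  define r where "r = (1/2::real) ^ (fst Q + 2)"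
  have r: "0 < r" by (simp add: r_def)
  have "(1/2::real) ^ fst Q * (1/2) ^ fst Q = (1/4) ^ fst Q" by (simp flip: power_mult_distrib)
  then have r2: "r\<^sup>2 = tile_area Q / 16" by (simp add: r_def tile_area_def power2_eq_square power_add)
  have sub: "ball z r \<subseteq> big_box Q" using tile_ball_subset[of z "fst Q" "snd Q"] z Q(2) by (simp add: r_def)
  then have sub1: "ball z r \<subseteq> ball 0 1" using big_box_subset_ball by blast
  have key: "tile_area Q * f z \<le> 16 * rI f (big_box Q)"
    if f: "ennreal (pi * r\<^sup>2 * f z) \<le> nnI f (ball z r)" "nnI f (big_box Q) < \<infinity>" "0 \<le> f z" for f :: "complex \<Rightarrow> real"
  proof -
    have "ennreal (pi * r\<^sup>2 * f z) \<le> nnI f (big_box Q)" using f(1) nnI_mono_set[OF sub] by (rule order_trans)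
    then have "pi * r\<^sup>2 * f z \<le> rI f (big_box Q)" unfolding nnI_eq_rI[OF f(2)] by simp
    moreover have "1 * (r\<^sup>2 * f z) \<le> pi * (r\<^sup>2 * f z)" using f(3) pi_ge_two by (intro mult_right_mono) auto
    ultimately have "r\<^sup>2 * f z \<le> rI f (big_box Q)" by (simp only: mult.assoc mult_1_left)
    then show ?thesis unfolding r2 by simp
  qed
  have "tile_area Q * u z \<le> tile_area Q * (16 * U Q)"
    using key[of u, OF u_sub[OF r sub1] u_fin] u_pos[OF tile_ball[OF z]] unfolding rI_u by simp
  then show "u z \<le> 16 * U Q" by (simp only: mult_le_cancel_left_pos tile_area_pos)
  show "tile_area Q * u z powr (-\<tau>) \<le> 16 * rI (\<lambda>z. u z powr (-\<tau>)) (big_box Q)" if "0 < \<tau>" "\<tau> * (2 * \<pi>0) < 1 - 2 * \<pi>0"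
    using key[of "\<lambda>z. u z powr (-\<tau>)", OF u_neg_sub[OF that(1) r sub1] u_neg_fin[OF that]] by simp
qed

text \<open>In deep generations the sub-mean value property for \<open>u\<close> bounds it above by
  its average, and the one for \<open>u powr (-\<tau>0)\<close>, combined with the box condition,
  bounds it below. The tiles of the first five generations lie in a compact disc, on which the
  continuous positive \<open>u\<close> is bounded above and away from 0.\<close>

lemma u_tile_comparable:
  obtains C where "1 \<le> C" "\<forall>Q z. valid Q \<longrightarrow> z \<in> tile Q \<longrightarrow> u z \<le> C * U Q \<and> U Q \<le> C * u z"
proof -
  obtain C1 where C1: "1 \<le> C1" "\<forall>Q. valid Q \<longrightarrow> rI (\<lambda>z. u z powr (-\<tau>0)) (big_box Q) \<le> C1 * (tile_area Q * U Q powr (-\<tau>0))"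
    using u_neg_box[OF \<tau>0] .
  \<comment> \<open>Points of a tile of generation at most 4 satisfy
    \<open>1 - cmod z > (1/2) ^ 5 = 1/32\<close>.\<close>
  let ?K = "cball (0::complex) (31/32)"
  have Ksub: "?K \<subseteq> ball 0 1" by auto
  have Kc: "continuous_on ?K u" using u_cont Ksub by (rule continuous_on_subset)
  obtain zm where zm: "zm \<in> ?K" "\<And>z. z \<in> ?K \<Longrightarrow> u zm \<le> u z"
    using continuous_attains_inf[OF compact_cball _ Kc] by auto
  obtain zM where zM: "zM \<in> ?K" "\<And>z. z \<in> ?K \<Longrightarrow> u z \<le> u zM"
    using continuous_attains_sup[OF compact_cball _ Kc] by auto
  define m M D where "m = u zm" and "M = u zM" and "D = rI u (ball 0 1)"
  have pos: "0 < m" "0 < M" using zm(1) zM(1) Ksub by (auto simp: m_def M_def intro!: u_pos)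
  have D: "0 < D" using U_pos[of "(0,0)"] by (simp add: U_def D_def big_box_def tile_area_def)
  define C where "C = Max {16, (16 * C1) powr (1/\<tau>0), M / D, 256 * D / m}"
  have C: "16 \<le> C" "(16 * C1) powr (1/\<tau>0) \<le> C" "M / D \<le> C" "256 * D / m \<le> C" by (auto simp: C_def)
  show thesis
  proof (rule that[of C]; (intro allI impI)?)
    show "1 \<le> C" using C(1) by simp
    fix Q :: "nat \<times> nat" and z assume Q: "valid Q" and z: "z \<in> tile Q"
    note UQ = U_pos[OF Q] and uz = u_pos[OF tile_ball[OF z]]
    show "u z \<le> C * U Q \<and> U Q \<le> C * u z"
    proof (cases "5 \<le> fst Q")
      case True
      have 1: "u z \<le> C * U Q" using u_tile_deep(1)[OF Q True z] mult_right_mono[OF C(1), of "U Q"] UQ by linarith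
      have "tile_area Q * u z powr (-\<tau>0) \<le> 16 * (C1 * (tile_area Q * U Q powr (-\<tau>0)))"
        using u_tile_deep(2)[OF Q True z \<tau>0] C1(2)[rule_format, OF Q] by linarith
      then have "tile_area Q * (u z powr (-\<tau>0)) \<le> tile_area Q * (16 * C1 * U Q powr (-\<tau>0))" by (simp add: mult_ac)
      then have "u z powr (-\<tau>0) \<le> 16 * C1 * U Q powr (-\<tau>0)" by (simp only: mult_le_cancel_left_pos tile_area_pos)
      then have "U Q powr \<tau>0 \<le> 16 * C1 * u z powr \<tau>0" using UQ uz by (simp add: powr_minus field_simps)
      then have "U Q \<le> (16 * C1) powr (1/\<tau>0) * u z"
        using \<tau>0 UQ uz C1(1) by (intro powr_root_le) auto
      also have "\<dots> \<le> C * u z" using C(2) uz by (intro mult_right_mono) auto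
      finally show ?thesis using 1 by simp
    next
      case False
      then have n: "fst Q \<le> 4" by simp
      have "(1/2::real) ^ 5 \<le> (1/2) ^ Suc (fst Q)" using n by (intro power_decreasing) auto
      moreover have "(1/2::real) ^ 5 = 1/32" by (simp add: power_divide)
      moreover have "(1/2) ^ Suc (fst Q) < 1 - cmod z" using z by (simp add: tile_def)
      ultimately have "z \<in> ?K" by simp
      then have um: "m \<le> u z" "u z \<le> M" using zm zM by (auto simp: m_def M_def)
      have UD: "U Q = D / tile_area Q" using False by (simp add: U_def D_def big_box_def)
      have "(1/4::real) ^ 4 \<le> tile_area Q" unfolding tile_area_def using n by (intro power_decreasing) auto
      then have ta: "1/256 \<le> tile_area Q" "tile_area Q \<le> 1" by (auto simp: power_divide tile_area_def power_le_one)
      have "D / 1 \<le> D / tile_area Q" using D ta by (intro divide_left_mono) auto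
      then have U1: "D \<le> U Q" by (simp add: UD)
      have "D / tile_area Q \<le> D / (1/256)" using D ta by (intro divide_left_mono) auto
      then have U2: "U Q \<le> 256 * D" by (simp add: UD)
      have "u z \<le> M / D * D" using um D by simp
      also have "\<dots> \<le> C * U Q" using C(1,3) U1 D pos by (intro mult_mono) auto
      finally have 1: "u z \<le> C * U Q" .
      have "U Q \<le> 256 * D / m * m" using U2 pos by simp
      also have "\<dots> \<le> C * u z" using C(1,4) um D pos by (intro mult_mono) auto
      finally show ?thesis using 1 by simp
    qed
  qed
qed

text \<open>Fixing one constant makes it available to all later estimates in the context.\<close>

definition Cu :: real where "Cu = (SOME C. 1 \<le> C \<and> (\<forall>Q z. valid Q \<longrightarrow> z \<in> tile Q \<longrightarrow> u z \<le> C * U Q \<and> U Q \<le> C * u z))"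

lemma Cu: "1 \<le> Cu" "valid Q \<Longrightarrow> z \<in> tile Q \<Longrightarrow> u z \<le> Cu * U Q" "valid Q \<Longrightarrow> z \<in> tile Q \<Longrightarrow> U Q \<le> Cu * u z"
proof -
  have ex: "\<exists>C. 1 \<le> C \<and> (\<forall>Q z. valid Q \<longrightarrow> z \<in> tile Q \<longrightarrow> u z \<le> C * U Q \<and> U Q \<le> C * u z)"
  proof (rule u_tile_comparable)
    fix C assume "1 \<le> C" "\<forall>Q z. valid Q \<longrightarrow> z \<in> tile Q \<longrightarrow> u z \<le> C * U Q \<and> U Q \<le> C * u z"
    then show ?thesis by (intro exI[of _ C] conjI)
  qed
  note * = someI_ex[OF ex, folded Cu_def]
  show "1 \<le> Cu" by (rule *[THEN conjunct1])
  show "u z \<le> Cu * U Q" "U Q \<le> Cu * u z" if "valid Q" "z \<in> tile Q"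
    using *[THEN conjunct2, rule_format, OF that] by simp_all
qed

lemma u_powr_tile_le:
  assumes "valid Q" "z \<in> tile Q"
  shows "u z powr e \<le> Cu powr \<bar>e\<bar> * U Q powr e" "U Q powr e \<le> Cu powr \<bar>e\<bar> * u z powr e"
proof -
  have *: "x powr e \<le> Cu powr \<bar>e\<bar> * y powr e" if "0 < x" "0 < y" "x \<le> Cu * y" "y \<le> Cu * x" for x y
  proof (cases "0 \<le> e")
    case True
    have "x powr e \<le> (Cu * y) powr e" using that True by (intro powr_mono2) auto
    then show ?thesis using True that Cu(1) by (simp add: powr_mult)
  next
    case False
    have "y powr (-e) \<le> (Cu * x) powr (-e)" using that False by (intro powr_mono2) auto
    also have "\<dots> = Cu powr \<bar>e\<bar> * x powr (-e)" using False that Cu(1) by (simp add: powr_mult)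
    finally have "1 / y powr e \<le> Cu powr \<bar>e\<bar> * (1 / x powr e)" by (simp add: powr_minus_divide)
    then show ?thesis using that by (simp add: field_simps)
  qed
  note a = U_pos[OF assms(1)] u_pos[OF tile_ball[OF assms(2)]] Cu(2,3)[OF assms]
  show "u z powr e \<le> Cu powr \<bar>e\<bar> * U Q powr e" by (rule *) (rule a)+
  show "U Q powr e \<le> Cu powr \<bar>e\<bar> * u z powr e" by (rule *) (rule a)+
qed

lemma tile_neg_ge:
  assumes \<tau>: "0 < \<tau>" "\<tau> * (2 * \<pi>0) < 1 - 2 * \<pi>0" and R: "valid R"
  shows "tile_area R * U R powr (-\<tau>) \<le> 256 * Cu powr \<tau> * rI (\<lambda>z. u z powr (-\<tau>)) (tile R)"
proof -
  have "(U R powr (-\<tau>) / Cu powr \<tau>) * (tile_area R / 256) \<le> rI (\<lambda>z. u z powr (-\<tau>)) (tile R)"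
  proof (rule rI_tile_ge[OF R])
    show "0 \<le> U R powr (-\<tau>) / Cu powr \<tau>" by simp
    show "U R powr (-\<tau>) / Cu powr \<tau> \<le> u z powr (-\<tau>)" if "z \<in> tile R" for z
      using u_powr_tile_le(2)[OF R that, of "-\<tau>"] \<tau> Cu(1) by (simp add: pos_divide_le_eq mult.commute)
    show "nnI (\<lambda>z. u z powr (-\<tau>)) (tile R) < \<infinity>"
      by (rule nnI_finite_subset[OF tile_subset_big_box u_neg_fin[OF \<tau>]])
  qed
  then show ?thesis using Cu(1) by (simp add: field_simps)
qed

lemma tiles_valid: "R \<in> tiles N \<Longrightarrow> valid R" by (cases R) (simp add: tiles_def)

lemma neg_sum:
  assumes \<tau>: "0 < \<tau>" "\<tau> * (2 * \<pi>0) < 1 - 2 * \<pi>0"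
  shows "\<exists>C1>0. \<forall>N. \<forall>Q\<in>tiles N. dsum N (\<lambda>R. tile_area R * U R powr (-\<tau>)) Q \<le> C1 * (tile_area Q * U Q powr (-\<tau>))"
proof -
  obtain C where C: "1 \<le> C" "\<forall>Q. valid Q \<longrightarrow> rI (\<lambda>z. u z powr (-\<tau>)) (big_box Q) \<le> C * (tile_area Q * U Q powr (-\<tau>))"
    using u_neg_box[OF \<tau>] .
  define K where "K = 256 * Cu powr \<tau>"
  have K: "0 < K" using Cu(1) by (simp add: K_def)
  show ?thesis
  proof (intro exI[of _ "K * C"] conjI allI ballI)
    show "0 < K * C" using K C(1) by simp
    fix N Q assume Q: "Q \<in> tiles N"
    have "dsum N (\<lambda>R. tile_area R * U R powr (-\<tau>)) Q \<le> K * dsum N (\<lambda>R. rI (\<lambda>z. u z powr (-\<tau>)) (tile R)) Q"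
      unfolding dsum_def sum_distrib_left K_def
      by (intro sum_mono tile_neg_ge \<tau> tiles_valid[of _ N]) (simp add: dset_def)
    also have "\<dots> \<le> K * rI (\<lambda>z. u z powr (-\<tau>)) (big_box Q)"
      using K by (intro mult_left_mono dsum_rI_le u_neg_fin \<tau>) auto
    also have "\<dots> \<le> K * (C * (tile_area Q * U Q powr (-\<tau>)))"
      using K by (intro mult_left_mono C(2)[rule_format] tiles_valid[OF Q]) auto
    finally show "dsum N (\<lambda>R. tile_area R * U R powr (-\<tau>)) Q \<le> K * C * (tile_area Q * U Q powr (-\<tau>))" by (simp add: mult_ac)
  qed
qed

text \<open>Inclusion alone bounds the mass of the smaller set by that of the larger one; negative
  powers turn this around. The integral of \<open>u powr (-\<tau>0)\<close> is at least its model
  value on the tile \<open>R\<close> and at most its model value on the box of \<open>Q\<close>. The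
  restriction on generations keeps the areas comparable.\<close>

lemma U_compare:
  obtains C where "1 \<le> C" "\<forall>Q R. valid Q \<longrightarrow> valid R \<longrightarrow> tile R \<subseteq> big_box Q \<longrightarrow> fst R \<le> Suc (fst Q) \<longrightarrow> U Q \<le> C * U R"
proof -
  obtain C where C: "1 \<le> C" "\<forall>Q. valid Q \<longrightarrow> rI (\<lambda>z. u z powr (-\<tau>0)) (big_box Q) \<le> C * (tile_area Q * U Q powr (-\<tau>0))"
    using u_neg_box[OF \<tau>0] .
  define K where "K = 4 * (256 * Cu powr \<tau>0) * C"
  have K: "1 \<le> K"
  proof -
    have "1 * 1 \<le> (4 * (256 * Cu powr \<tau>0)) * C"
    proof (intro mult_mono)
      have "1 \<le> Cu powr \<tau>0" using Cu(1) \<tau>0 by (intro ge_one_powr_ge_zero) auto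
      then show "1 \<le> 4 * (256 * Cu powr \<tau>0)" by simp
    qed (use C(1) in auto)
    then show ?thesis by (simp add: K_def)
  qed
  show thesis
  proof (rule that[of "K powr (1/\<tau>0)"]; (intro allI impI)?)
    show "1 \<le> K powr (1/\<tau>0)" using K \<tau>0 by (intro ge_one_powr_ge_zero) auto
    fix Q R :: "nat \<times> nat" assume Q: "valid Q" and R: "valid R" and sub: "tile R \<subseteq> big_box Q" and lev: "fst R \<le> Suc (fst Q)"
    have "(1/4::real) ^ Suc (fst Q) \<le> (1/4) ^ fst R" using lev by (intro power_decreasing) auto
    then have ta: "tile_area Q \<le> 4 * tile_area R" by (simp add: tile_area_def)
    have "tile_area Q * U R powr (-\<tau>0) \<le> 4 * tile_area R * U R powr (-\<tau>0)" using ta by (intro mult_right_mono) auto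
    also have "\<dots> \<le> 4 * (256 * Cu powr \<tau>0 * rI (\<lambda>z. u z powr (-\<tau>0)) (tile R))"
      using tile_neg_ge[OF \<tau>0 R] by simp
    also have "\<dots> \<le> 4 * (256 * Cu powr \<tau>0 * (C * (tile_area Q * U Q powr (-\<tau>0))))"
      using rI_mono_set[OF sub u_neg_fin[OF \<tau>0]] C(2)[rule_format, OF Q] by (intro mult_left_mono) auto
    finally have "tile_area Q * (U R powr (-\<tau>0)) \<le> tile_area Q * (K * U Q powr (-\<tau>0))" by (simp add: K_def mult_ac)
    then have "U R powr (-\<tau>0) \<le> K * U Q powr (-\<tau>0)" by (simp only: mult_le_cancel_left_pos tile_area_pos)
    then have "U Q powr \<tau>0 \<le> K * U R powr \<tau>0" using U_pos[OF Q] U_pos[OF R] by (simp add: powr_minus field_simps)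
    then show "U Q \<le> K powr (1/\<tau>0) * U R"
      using \<tau>0 U_pos[OF Q] U_pos[OF R] K by (intro powr_root_le) auto
  qed
qed

end

section \<open>The weight \<open>g\<close> and its dual\<close>

context disc_weight begin

text \<open>The dual weight of \<open>g\<close> with respect to the measure \<open>u dA\<close> for
  the exponent \<open>1 + P1\<close>.\<close>

definition gd :: "complex \<Rightarrow> real" where "gd z = g z powr (-1/P1)"

lemma gd_meas [measurable]: "gd \<in> borel_measurable borel" unfolding gd_def by measurable

lemma gd_pos: "z \<in> ball 0 1 \<Longrightarrow> 0 < gd z" using g_pos by (simp add: gd_def less_imp_neq[symmetric])

definition mass :: "(complex \<Rightarrow> real) \<Rightarrow> nat \<times> nat \<Rightarrow> real" where
  "mass h Q = rI (\<lambda>z. h z * u z) (tile Q)"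

text \<open>An average with respect to \<open>u dA\<close> up to bounded factors, since
  \<open>tile_area Q * U Q\<close> is comparable to the \<open>u\<close>-mass of the tile.\<close>

definition avg :: "(complex \<Rightarrow> real) \<Rightarrow> nat \<times> nat \<Rightarrow> real" where
  "avg h Q = mass h Q / (tile_area Q * U Q)"

lemma g_fin: "nnI (\<lambda>z. g z * u z) (big_box Q) < \<infinity>" "nnI (\<lambda>z. gd z * u z) (big_box Q) < \<infinity>"
  unfolding gd_def by (rule nnI_box_finite; (use g_box in blast | measurable))+

lemma mass_pos:
  assumes "h \<in> borel_measurable borel" "\<And>z. z \<in> ball 0 1 \<Longrightarrow> 0 < h z" "nnI (\<lambda>z. h z * u z) (big_box Q) < \<infinity>" "valid Q"
  shows "0 < mass h Q"
  unfolding mass_def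
proof (rule rI_pos)
  show "(\<lambda>z. h z * u z) \<in> borel_measurable borel" using assms(1) by measurable
  show "0 < h z * u z" if "z \<in> tile Q" for z using assms(2) u_pos tile_ball[OF that] by simp
  show "nnI (\<lambda>z. h z * u z) (tile Q) < \<infinity>" by (rule nnI_finite_subset[OF tile_subset_big_box assms(3)])
qed (use tile_emeasure_pos[OF assms(4)] in auto)

lemma avg_pos: "0 < mass h Q \<Longrightarrow> valid Q \<Longrightarrow> 0 < avg h Q"
  unfolding avg_def using U_pos by simp

lemma mass_eq: "valid Q \<Longrightarrow> tile_area Q * U Q * avg h Q = mass h Q"
  unfolding avg_def using U_pos[of Q] by simp

lemma Holder_tile:
  assumes "0 < \<alpha>" "0 < \<beta>" "\<alpha> + \<beta> = 1" and [measurable]: "h1 \<in> borel_measurable borel" "h2 \<in> borel_measurable borel"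
    and nn: "\<And>z. z \<in> tile Q \<Longrightarrow> 0 \<le> h1 z" "\<And>z. z \<in> tile Q \<Longrightarrow> 0 \<le> h2 z"
    and fin: "nnI h1 (tile Q) < \<infinity>" "nnI h2 (tile Q) < \<infinity>"
  shows "nnI (\<lambda>z. h1 z powr \<alpha> * h2 z powr \<beta>) (tile Q) \<le> ennreal (rI h1 (tile Q) powr \<alpha> * rI h2 (tile Q) powr \<beta>)"
proof -
  let ?f = "\<lambda>z. indicator (tile Q) z * h1 z" and ?g = "\<lambda>z. indicator (tile Q) z * h2 z"
  have eq: "(\<integral>\<^sup>+z. ennreal (indicator (tile Q) z * h z) \<partial>lborel) = nnI h (tile Q)" for h
    unfolding nnI_def by (intro nn_integral_cong) (auto simp: indicator_def)
  have "nnI (\<lambda>z. h1 z powr \<alpha> * h2 z powr \<beta>) (tile Q) = (\<integral>\<^sup>+z. ennreal (?f z powr \<alpha> * ?g z powr \<beta>) \<partial>lborel)"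
    unfolding nnI_def by (intro nn_integral_cong) (auto simp: indicator_def)
  also have "\<dots> \<le> ennreal (rI h1 (tile Q) powr \<alpha> * rI h2 (tile Q) powr \<beta>)"
  proof (rule Holder_nn_integral_powr[OF assms(1-3)])
    show "(\<integral>\<^sup>+z. ennreal (?f z) \<partial>lborel) \<le> ennreal (rI h1 (tile Q))" "(\<integral>\<^sup>+z. ennreal (?g z) \<partial>lborel) \<le> ennreal (rI h2 (tile Q))"
      unfolding eq using nnI_eq_rI[OF fin(1)] nnI_eq_rI[OF fin(2)] by simp_all
  qed (use nn in \<open>auto simp: indicator_def\<close>)
  finally show ?thesis .
qed

lemma g_box_big:
  obtains C where "1 \<le> C" "\<forall>Q. valid Q \<longrightarrow> rI (\<lambda>z. g z * u z) (big_box Q) * rI (\<lambda>z. gd z * u z) (big_box Q) powr P1 \<le> C * (tile_area Q * U Q) powr (1 + P1)"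
proof -
  obtain C0 where C0: "\<And>X. X \<in> carleson_boxes \<Longrightarrow> rI (\<lambda>z. g z * u z) X * rI (\<lambda>z. gd z * u z) X powr P1 \<le> C0 * rI u X powr (1 + P1)"
    using g_box unfolding gd_def by blast
  show thesis
  proof (rule box_const[of "\<lambda>X. rI (\<lambda>z. g z * u z) X * rI (\<lambda>z. gd z * u z) X powr P1" C0 "\<lambda>X. rI u X powr (1 + P1)"], goal_cases)
    case (1 X) then show ?case by (rule C0)
  next
    case (2 Q) then show ?case using U_pos[OF 2] by (simp add: rI_u)
  next
    case (3 C') then show ?case using that[of C'] by (simp add: rI_u)
  qed
qed

lemma u_mass_ge:
  assumes Q: "valid Q"
  shows "tile_area Q * U Q \<le> 256 * Cu * rI u (tile Q)"
proof -
  have "(U Q / Cu) * (tile_area Q / 256) \<le> rI u (tile Q)"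
  proof (rule rI_tile_ge[OF Q])
    show "0 \<le> U Q / Cu" using U_pos[OF Q] Cu(1) by simp
    show "U Q / Cu \<le> u z" if "z \<in> tile Q" for z using Cu(3)[OF Q that] Cu(1) by (simp add: pos_divide_le_eq mult.commute)
    show "nnI u (tile Q) < \<infinity>" by (rule nnI_finite_subset[OF tile_subset_big_box u_fin])
  qed
  then show ?thesis using Cu(1) by (simp add: field_simps)
qed

text \<open>The exponents are chosen so that \<open>g\<close> and \<open>gd\<close> cancel in the
  product. This is the half of the duality that holds for every weight, opposite in direction to the
  box condition.\<close>

lemma u_mass_Holder:
  assumes Q: "valid Q"
  shows "rI u (tile Q) powr (1 + P1) \<le> mass g Q * mass gd Q powr P1"
proof -
  define \<alpha> \<beta> where "\<alpha> = 1 / (1 + P1)" and "\<beta> = P1 / (1 + P1)"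
  have ab: "0 < \<alpha>" "0 < \<beta>" "\<alpha> + \<beta> = 1" using P1_pos by (auto simp: \<alpha>_def \<beta>_def add_divide_distrib[symmetric])
  have "nnI u (tile Q) = nnI (\<lambda>z. (g z * u z) powr \<alpha> * (gd z * u z) powr \<beta>) (tile Q)"
    unfolding nnI_def
  proof (intro nn_integral_cong)
    fix z
    show "ennreal (u z) * indicator (tile Q) z = ennreal ((g z * u z) powr \<alpha> * (gd z * u z) powr \<beta>) * indicator (tile Q) z"
    proof (cases "z \<in> tile Q")
      case True
      note pos = g_pos[OF tile_ball[OF True]] u_pos[OF tile_ball[OF True]]
      have "-1/P1 * \<beta> = -\<alpha>" using P1_pos by (simp add: \<alpha>_def \<beta>_def)
      then have "gd z powr \<beta> = g z powr (-\<alpha>)" by (simp add: gd_def powr_powr)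
      then have "(g z * u z) powr \<alpha> * (gd z * u z) powr \<beta> = (g z powr \<alpha> * g z powr (-\<alpha>)) * (u z powr \<alpha> * u z powr \<beta>)"
        using pos by (simp add: powr_mult mult_ac)
      also have "\<dots> = u z" using pos ab by (simp add: powr_add[symmetric])
      finally show ?thesis by simp
    qed simp
  qed
  also have "\<dots> \<le> ennreal (mass g Q powr \<alpha> * mass gd Q powr \<beta>)"
    unfolding mass_def
  proof (rule Holder_tile[OF ab])
    show "nnI (\<lambda>z. g z * u z) (tile Q) < \<infinity>" "nnI (\<lambda>z. gd z * u z) (tile Q) < \<infinity>"
      by (rule nnI_finite_subset[OF tile_subset_big_box g_fin(1)], rule nnI_finite_subset[OF tile_subset_big_box g_fin(2)])
    show "0 \<le> g z * u z" if "z \<in> tile Q" for z using g_pos[OF tile_ball[OF that]] u_pos[OF tile_ball[OF that]] by simp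
    show "0 \<le> gd z * u z" if "z \<in> tile Q" for z using gd_pos[OF tile_ball[OF that]] u_pos[OF tile_ball[OF that]] by simp
  qed measurable
  finally have "ennreal (rI u (tile Q)) \<le> ennreal (mass g Q powr \<alpha> * mass gd Q powr \<beta>)"
    using nnI_eq_rI[OF nnI_finite_subset[OF tile_subset_big_box u_fin]] by simp
  then have "rI u (tile Q) \<le> mass g Q powr \<alpha> * mass gd Q powr \<beta>" by simp
  then have "rI u (tile Q) powr (1 + P1) \<le> (mass g Q powr \<alpha> * mass gd Q powr \<beta>) powr (1 + P1)"
    using P1_pos by (intro powr_mono2) auto
  also have "\<dots> = mass g Q * mass gd Q powr P1"
    using P1_pos by (simp add: powr_mult powr_powr \<alpha>_def \<beta>_def mass_def)
  finally show ?thesis .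
qed

lemma g_mass_pos: "valid Q \<Longrightarrow> 0 < mass g Q" "valid Q \<Longrightarrow> 0 < mass gd Q"
  by (rule mass_pos[OF g_meas g_pos g_fin(1)], assumption+) (rule mass_pos[OF gd_meas gd_pos g_fin(2)], assumption+)

text \<open>The box condition bounds the product of the two box masses by a power of the
  \<open>u\<close>-mass of the top tile, and Hoelder's inequality bounds this power by the product
  of the two tile masses. As each tile mass is at most the corresponding box mass, one factor
  cancels and the other is compared alone.\<close>

lemma g_root:
  obtains C where "2 \<le> C" "\<forall>Q. valid Q \<longrightarrow> rI (\<lambda>z. g z * u z) (big_box Q) \<le> C * mass g Q \<and> rI (\<lambda>z. gd z * u z) (big_box Q) \<le> C * mass gd Q"
proof -
  obtain C1 where C1: "1 \<le> C1" "\<forall>Q. valid Q \<longrightarrow> rI (\<lambda>z. g z * u z) (big_box Q) * rI (\<lambda>z. gd z * u z) (big_box Q) powr P1 \<le> C1 * (tile_area Q * U Q) powr (1 + P1)"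
    using g_box_big .
  define K where "K = C1 * (256 * Cu) powr (1 + P1)"
  have K: "0 < K" using C1(1) Cu(1) by (simp add: K_def)
  define C where "C = Max {2, K, K powr (1/P1)}"
  have C: "2 \<le> C" "K \<le> C" "K powr (1/P1) \<le> C" by (auto simp: C_def)
  show thesis
  proof (rule that[of C]; (intro allI impI)?)
    fix Q :: "nat \<times> nat" assume Q: "valid Q"
    let ?a = "rI (\<lambda>z. g z * u z) (big_box Q)" and ?b = "rI (\<lambda>z. gd z * u z) (big_box Q)"
    have ma: "0 < mass g Q" "0 < mass gd Q" using g_mass_pos[OF Q] by auto
    have ab: "mass g Q \<le> ?a" "mass gd Q \<le> ?b"
      unfolding mass_def by (intro rI_mono_set tile_subset_big_box g_fin)+
    have "?a * ?b powr P1 \<le> C1 * (tile_area Q * U Q) powr (1 + P1)" using C1(2) Q by blast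
    also have "\<dots> \<le> C1 * (256 * Cu * rI u (tile Q)) powr (1 + P1)"
      using u_mass_ge[OF Q] C1(1) P1_pos U_pos[OF Q] by (intro mult_left_mono powr_mono2) auto
    also have "\<dots> = K * rI u (tile Q) powr (1 + P1)"
      using Cu(1) by (simp add: K_def powr_mult)
    also have "\<dots> \<le> K * (mass g Q * mass gd Q powr P1)" using u_mass_Holder[OF Q] K by (intro mult_left_mono) auto
    finally have le: "?a * ?b powr P1 \<le> K * (mass g Q * mass gd Q powr P1)" .
    have "?a * ?b powr P1 \<le> (K * mass g Q) * ?b powr P1"
    proof (rule order_trans[OF le])
      have "mass gd Q powr P1 \<le> ?b powr P1" using ab ma P1_pos by (intro powr_mono2) auto
      then show "K * (mass g Q * mass gd Q powr P1) \<le> (K * mass g Q) * ?b powr P1"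
        using K ma by (simp add: mult.assoc mult_left_mono)
    qed
    moreover have "0 < ?b powr P1" using ab ma by simp
    ultimately have "?a \<le> K * mass g Q" by simp
    also have "\<dots> \<le> C * mass g Q" using C(2) ma by (intro mult_right_mono) auto
    finally have 1: "?a \<le> C * mass g Q" .
    have "?a * ?b powr P1 \<le> ?a * (K * mass gd Q powr P1)"
    proof (rule order_trans[OF le])
      have "mass g Q * (K * mass gd Q powr P1) \<le> ?a * (K * mass gd Q powr P1)" using ab K by (intro mult_right_mono) auto
      then show "K * (mass g Q * mass gd Q powr P1) \<le> ?a * (K * mass gd Q powr P1)" by (simp add: mult_ac)
    qed
    then have "?b powr P1 \<le> K * mass gd Q powr P1" using ab ma by (simp add: mult_le_cancel_left)
    then have "?b \<le> K powr (1/P1) * mass gd Q" using P1_pos ab ma K by (intro powr_root_le) auto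
    also have "\<dots> \<le> C * mass gd Q" using C(3) ma by (intro mult_right_mono) auto
    finally show "?a \<le> C * mass g Q \<and> ?b \<le> C * mass gd Q" using 1 by simp
  qed (rule C(1))
qed

text \<open>Hoelder's inequality with exponents \<open>s\<close> and \<open>1 - s\<close> on a
  single tile, after the power \<open>-e/2\<close> of the essentially constant \<open>u\<close> has
  been taken out. For \<open>\<pi>0 = 0\<close> the second exponent is 0 and there is nothing to
  interpolate, which is the separate case.\<close>

lemma tile_weight:
  assumes e: "1 < e" "e * \<pi>0 < 1" and [measurable]: "h \<in> borel_measurable borel" and hpos: "\<And>z. z \<in> ball 0 1 \<Longrightarrow> 0 < h z"
    and fin: "\<And>Q. nnI (\<lambda>z. h z * u z) (big_box Q) < \<infinity>"
  obtains C where "0 < C" "\<forall>Q. valid Q \<longrightarrow> nnI (\<lambda>z. h z powr (1 - e * \<pi>0) * u z powr (1 - e/2)) (tile Q) \<le>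
     ennreal (C * (tile_area Q * avg h Q powr (1 - e * \<pi>0) * U Q powr (1 - e/2)))"
proof -
  define s where "s = 1 - e * \<pi>0"
  have s: "0 < s" "s \<le> 1" using e \<pi>0(1) by (auto simp: s_def)
  define C where "C = Cu powr (e/2) * (10000 * Cu) powr (1 - s)"
  show thesis
  proof (rule that[of C]; (intro allI impI)?)
    show "0 < C" using Cu(1) by (simp add: C_def)
    fix Q :: "nat \<times> nat" assume Q: "valid Q"
    note UQ = U_pos[OF Q]
    have mpos: "0 < mass h Q" by (rule mass_pos[OF _ hpos fin Q]) auto
    have finT: "nnI (\<lambda>z. h z * u z) (tile Q) < \<infinity>" by (rule nnI_finite_subset[OF tile_subset_big_box fin])
    have ufinT: "nnI u (tile Q) < \<infinity>" by (rule nnI_finite_subset[OF tile_subset_big_box u_fin])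
    have um: "rI u (tile Q) \<le> Cu * U Q * (10000 * tile_area Q)"
      by (rule rI_tile_le(2)) (use Cu(1) Cu(2)[OF Q] UQ in auto)
    have hold: "nnI (\<lambda>z. (h z * u z) powr s * u z powr (1 - s)) (tile Q) \<le> ennreal (mass h Q powr s * rI u (tile Q) powr (1 - s))"
    proof (cases "s < 1")
      case True
      show ?thesis unfolding mass_def
      proof (rule Holder_tile)
        fix z assume z: "z \<in> tile Q"
        show "0 \<le> h z * u z" "0 \<le> u z" using hpos[OF tile_ball[OF z]] u_pos[OF tile_ball[OF z]] by simp_all
      qed (use s True finT ufinT in auto)
    next
      case False
      then have s1: "s = 1" using s by simp
      have up: "0 < rI u (tile Q)"
        using u_mass_ge[OF Q] UQ Cu(1) rI_nonneg[of u "tile Q"] tile_area_pos[of Q]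
        by (metis less_eq_real_def mult_pos_pos mult_zero_right not_le)
      have "nnI (\<lambda>z. (h z * u z) powr s * u z powr (1 - s)) (tile Q) = nnI (\<lambda>z. h z * u z) (tile Q)"
        unfolding nnI_def
      proof (intro nn_integral_cong)
        fix z show "ennreal ((h z * u z) powr s * u z powr (1 - s)) * indicator (tile Q) z = ennreal (h z * u z) * indicator (tile Q) z"
          using hpos[OF tile_ball, of z Q] u_pos[OF tile_ball, of z Q] by (cases "z \<in> tile Q") (auto simp: s1)
      qed
      also have "\<dots> = ennreal (mass h Q powr s * rI u (tile Q) powr (1 - s))"
        using nnI_eq_rI[OF finT] mpos up by (simp add: s1 mass_def)
      finally show ?thesis by simp
    qed
    have "nnI (\<lambda>z. h z powr s * u z powr (1 - e/2)) (tile Q) \<le> nnI (\<lambda>z. (Cu powr (e/2) * U Q powr (-(e/2))) * ((h z * u z) powr s * u z powr (1 - s))) (tile Q)"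
    proof (rule nnI_mono)
      fix z assume z: "z \<in> tile Q"
      note pos = hpos[OF tile_ball[OF z]] u_pos[OF tile_ball[OF z]]
      have "h z powr s * u z powr (1 - e/2) = u z powr (-(e/2)) * ((h z * u z) powr s * u z powr (1 - s))"
      proof -
        have "u z powr (1 - e/2) = u z powr (-(e/2)) * (u z powr s * u z powr (1 - s))" unfolding powr_add[symmetric] by simp
        then show ?thesis using pos by (simp add: powr_mult mult_ac)
      qed
      also have "\<dots> \<le> (Cu powr (e/2) * U Q powr (-(e/2))) * ((h z * u z) powr s * u z powr (1 - s))"
        using u_powr_tile_le(1)[OF Q z, of "-(e/2)"] e by (intro mult_right_mono) auto
      finally show "h z powr s * u z powr (1 - e/2) \<le> (Cu powr (e/2) * U Q powr (-(e/2))) * ((h z * u z) powr s * u z powr (1 - s))" .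
    qed
    also have "\<dots> = ennreal (Cu powr (e/2) * U Q powr (-(e/2))) * nnI (\<lambda>z. (h z * u z) powr s * u z powr (1 - s)) (tile Q)"
      unfolding nnI_def by (subst nn_integral_cmult[symmetric]) (auto intro!: nn_integral_cong simp: ennreal_mult mult_ac)
    also have "\<dots> \<le> ennreal (Cu powr (e/2) * U Q powr (-(e/2))) * ennreal (mass h Q powr s * rI u (tile Q) powr (1 - s))"
      by (intro mult_left_mono hold) auto
    also have "\<dots> = ennreal (Cu powr (e/2) * U Q powr (-(e/2)) * (mass h Q powr s * rI u (tile Q) powr (1 - s)))"
      by (simp flip: ennreal_mult)
    also have "\<dots> \<le> ennreal (C * (tile_area Q * avg h Q powr s * U Q powr (1 - e/2)))"
    proof (rule ennreal_leI)
      have "Cu powr (e/2) * U Q powr (-(e/2)) * (mass h Q powr s * rI u (tile Q) powr (1 - s))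
        \<le> Cu powr (e/2) * U Q powr (-(e/2)) * ((tile_area Q * U Q * avg h Q) powr s * (Cu * U Q * (10000 * tile_area Q)) powr (1 - s))"
        unfolding mass_eq[OF Q] using um s by (intro mult_left_mono powr_mono2) auto
      also have "\<dots> = C * ((tile_area Q powr s * tile_area Q powr (1 - s)) * avg h Q powr s * (U Q powr (-(e/2)) * (U Q powr s * U Q powr (1 - s))))"
        using UQ Cu(1) avg_pos[OF mpos Q] by (simp add: C_def powr_mult mult_ac)
      also have "tile_area Q powr s * tile_area Q powr (1 - s) = tile_area Q" unfolding powr_add[symmetric] by simp
      also have "U Q powr (-(e/2)) * (U Q powr s * U Q powr (1 - s)) = U Q powr (1 - e/2)" unfolding powr_add[symmetric] by simp
      finally show "Cu powr (e/2) * U Q powr (-(e/2)) * (mass h Q powr s * rI u (tile Q) powr (1 - s)) \<le> C * (tile_area Q * avg h Q powr s * U Q powr (1 - e/2))" .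
    qed
    finally show "nnI (\<lambda>z. h z powr (1 - e * \<pi>0) * u z powr (1 - e/2)) (tile Q) \<le>
     ennreal (C * (tile_area Q * avg h Q powr (1 - e * \<pi>0) * U Q powr (1 - e/2)))" unfolding s_def .
  qed
qed

lemma U_nbr:
  obtains C where "1 \<le> C" "\<forall>Q R. valid Q \<longrightarrow> valid R \<longrightarrow> nbr Q R \<longrightarrow> U Q \<le> C * U R"
proof -
  obtain C where C: "1 \<le> C" "\<forall>Q R. valid Q \<longrightarrow> valid R \<longrightarrow> tile R \<subseteq> big_box Q \<longrightarrow> fst R \<le> Suc (fst Q) \<longrightarrow> U Q \<le> C * U R"
    using U_compare .
  show thesis
  proof (rule that[OF C(1)], intro allI impI)
    fix Q R :: "nat \<times> nat" assume a: "valid Q" "valid R" "nbr Q R"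
    have "fst R \<le> Suc (fst Q)" using a(3) by (simp add: nbr_def)
    then show "U Q \<le> C * U R" using C(2)[rule_format, OF a(1,2) nbr_tile_subset[OF a(3)]] by simp
  qed
qed

text \<open>The tile of a neighbour lies in the same big box, so the box condition for
  \<open>Q\<close> also controls the mass of \<open>gd\<close> on \<open>R\<close>; the change from
  \<open>U Q\<close> to \<open>U R\<close> costs a constant.\<close>

lemma avg_nbr:
  obtains C where "1 \<le> C" "\<forall>Q R. valid Q \<longrightarrow> valid R \<longrightarrow> nbr Q R \<longrightarrow> avg g Q * avg gd R powr P1 \<le> C"
proof -
  obtain C1 where C1: "1 \<le> C1" "\<forall>Q. valid Q \<longrightarrow> rI (\<lambda>z. g z * u z) (big_box Q) * rI (\<lambda>z. gd z * u z) (big_box Q) powr P1 \<le> C1 * (tile_area Q * U Q) powr (1 + P1)"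
    using g_box_big .
  obtain C2 where C2: "1 \<le> C2" "\<forall>Q R. valid Q \<longrightarrow> valid R \<longrightarrow> nbr Q R \<longrightarrow> U Q \<le> C2 * U R"
    using U_nbr .
  show thesis
  proof (rule that[of "C1 * C2 powr P1"]; (intro allI impI)?)
    have "1 * 1 \<le> C1 * C2 powr P1" using C1 C2 P1_pos by (intro mult_mono ge_one_powr_ge_zero) auto
    then show "1 \<le> C1 * C2 powr P1" by simp
    fix Q R :: "nat \<times> nat" assume a: "valid Q" "valid R" "nbr Q R"
    let ?t = "tile_area Q"
    have tR: "tile_area R = ?t" using a(3) by (simp add: nbr_def tile_area_def)
    note U = U_pos[OF a(1)] U_pos[OF a(2)]
    have "mass g Q * mass gd R powr P1 \<le> rI (\<lambda>z. g z * u z) (big_box Q) * rI (\<lambda>z. gd z * u z) (big_box Q) powr P1"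
      unfolding mass_def using P1_pos
      by (intro mult_mono powr_mono2 rI_mono_set nbr_tile_subset[OF a(3)] tile_subset_big_box g_fin) auto
    also have "\<dots> \<le> C1 * (?t * U Q) powr (1 + P1)" using C1(2) a(1) by blast
    also have "\<dots> = C1 * ((?t * U Q) * (?t * U Q) powr P1)" using U by (simp add: powr_add)
    also have "\<dots> \<le> C1 * ((?t * U Q) * (?t * (C2 * U R)) powr P1)"
    proof -
      have "U Q \<le> C2 * U R" using C2(2) a by blast
      then show ?thesis using C1(1) U P1_pos by (intro mult_left_mono powr_mono2) auto
    qed
    also have "\<dots> = (C1 * C2 powr P1) * ((?t * U Q) * (?t * U R) powr P1)"
      using U C2(1) by (simp add: powr_mult mult_ac)
    finally have le: "mass g Q * mass gd R powr P1 \<le> (C1 * C2 powr P1) * ((?t * U Q) * (?t * U R) powr P1)" .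
    have "avg g Q * avg gd R powr P1 = mass g Q * mass gd R powr P1 / ((?t * U Q) * (?t * U R) powr P1)"
      using U g_mass_pos[OF a(2)] by (simp add: avg_def tR powr_divide)
    also have "\<dots> \<le> C1 * C2 powr P1" using le U by (simp add: pos_divide_le_eq)
    finally show "avg g Q * avg gd R powr P1 \<le> C1 * C2 powr P1" .
  qed
qed

end

section \<open>The tree estimates for the weight and its dual\<close>

lemma desc_tiles:
  assumes "A \<in> tiles N" "desc Q A" shows "Q \<in> tiles N"
proof -
  obtain m k n j where A: "A = (m, k)" and Q: "Q = (n, j)" by (cases A, cases Q)
  have m: "m < N" "k < 2 ^ m" using assms(1) by (auto simp: A tiles_def)
  have n: "n \<le> m" "j = k div 2 ^ (m - n)" using assms(2) by (auto simp: A Q desc_def)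
  have "k < 2 ^ n * 2 ^ (m - n)" using m n(1) by (simp flip: power_add)
  then have "j < 2 ^ n" unfolding n(2) by (simp add: less_mult_imp_div_less)
  then show ?thesis using m n by (simp add: Q tiles_def)
qed

lemma dset_root: "dset N (0, 0) = tiles N"
proof -
  have "desc (0, 0) R" if "R \<in> tiles N" for R using that by (cases R) (simp add: desc_def tiles_def)
  then show ?thesis unfolding dset_def by blast
qed

lemma big_box_root: "big_box (0, 0) = ball 0 1" by (simp add: big_box_def)

context disc_weight begin

text \<open>Model value for the integral of the weight \<open>wt\<close> over a tile;
  \<open>S\<close> plays the same role for the dual weight. The integrals are bounded above by
  constant multiples of these values, which suffices for the operator bound, and the tree estimates
  rely on the product form.\<close>

definition W :: "nat \<times> nat \<Rightarrow> real" where
  "W Q = tile_area Q * avg g Q powr (1 - p * \<pi>0) * U Q powr (1 - p/2)"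

definition S :: "nat \<times> nat \<Rightarrow> real" where
  "S Q = tile_area Q * avg gd Q powr (1 - q * \<pi>0) * U Q powr (1 - q/2)"

definition wt :: "complex \<Rightarrow> real" where
  "wt z = g z powr (1 - p * \<pi>0) * u z powr (1 - p/2)"

lemma wt_meas [measurable]: "wt \<in> borel_measurable borel" unfolding wt_def by measurable

lemma g_avg_pos: "valid Q \<Longrightarrow> 0 < avg g Q" "valid Q \<Longrightarrow> 0 < avg gd Q"
  using avg_pos g_mass_pos by auto

lemma W_pos: "valid Q \<Longrightarrow> 0 < W Q" and S_pos: "valid Q \<Longrightarrow> 0 < S Q"
  unfolding W_def S_def using g_avg_pos[of Q] U_pos[of Q] by (simp_all add: less_imp_neq[symmetric])

lemma U_child:
  obtains K where "1 \<le> K" "\<forall>N n j i. (n, j) \<in> tiles N \<longrightarrow> i \<in> {2*j, 2*j+1} \<longrightarrow> (Suc n, i) \<in> tiles N \<longrightarrow> U (n, j) \<le> K * U (Suc n, i)"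
proof -
  obtain C where C: "1 \<le> C" "\<forall>Q R. valid Q \<longrightarrow> valid R \<longrightarrow> tile R \<subseteq> big_box Q \<longrightarrow> fst R \<le> Suc (fst Q) \<longrightarrow> U Q \<le> C * U R"
    using U_compare .
  show thesis
  proof (rule that[OF C(1)], intro allI impI)
    fix N n j i assume a: "(n, j) \<in> tiles N" "i \<in> {2*j, 2*j+1}" "(Suc n, i) \<in> tiles N"
    have "desc (n, j) (Suc n, i)" using a(2) by (auto simp: desc_def)
    then show "U (n, j) \<le> C * U (Suc n, i)"
      using C(2)[rule_format, OF tiles_valid[OF a(1)] tiles_valid[OF a(3)] desc_tile_subset] by simp
  qed
qed

text \<open>The pair \<open>p\<close>, \<open>g\<close> and the pair \<open>q\<close>,
  \<open>gd\<close> satisfy the same hypotheses, in particular \<open>p * \<pi>0 < 1\<close> and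
  \<open>q * \<pi>0 < 1\<close>; so \<open>tree\<close>, stated for an exponent \<open>e\<close> and
  a weight \<open>h\<close>, is used once for each.\<close>

lemma WS_root:
  obtains C where "2 \<le> C" "\<forall>N. subtree_bounded C N W \<and> subtree_bounded C N S"
proof -
  obtain C1 where C1: "2 \<le> C1" and root: "\<forall>Q. valid Q \<longrightarrow> rI (\<lambda>z. g z * u z) (big_box Q) \<le> C1 * mass g Q \<and> rI (\<lambda>z. gd z * u z) (big_box Q) \<le> C1 * mass gd Q"
    using g_root .
  obtain K1 where K1: "1 \<le> K1" and child: "\<forall>N n j i. (n, j) \<in> tiles N \<longrightarrow> i \<in> {2*j, 2*j+1} \<longrightarrow> (Suc n, i) \<in> tiles N \<longrightarrow> U (n, j) \<le> K1 * U (Suc n, i)"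
    using U_child .
  have tree: "\<exists>K. 0 < K \<and> (\<forall>N. \<forall>Q\<in>tiles N. dsum N (\<lambda>R. tile_area R * avg h R powr (1 - e * \<pi>0) * U R powr (1 - e/2)) Q \<le> K * (tile_area Q * avg h Q powr (1 - e * \<pi>0) * U Q powr (1 - e/2)))"
    if e: "1 < e" "e * \<pi>0 < 1" and [measurable]: "h \<in> borel_measurable borel" and fin: "\<And>Q. nnI (\<lambda>z. h z * u z) (big_box Q) < \<infinity>"
      and mp: "\<And>Q. valid Q \<Longrightarrow> 0 < mass h Q" and rt: "\<And>Q. valid Q \<Longrightarrow> rI (\<lambda>z. h z * u z) (big_box Q) \<le> C1 * mass h Q"
    for e h
  proof -
    have rt': "dsum N (\<lambda>R. tile_area R * U R * avg h R) Q \<le> C1 * (tile_area Q * U Q * avg h Q)" if Q: "Q \<in> tiles N" for N Q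
    proof -
      have "dsum N (\<lambda>R. tile_area R * U R * avg h R) Q = dsum N (\<lambda>R. rI (\<lambda>z. h z * u z) (tile R)) Q"
        unfolding dsum_def by (intro sum.cong refl) (simp add: dset_def mass_eq[OF tiles_valid, of _ N] mass_def)
      also have "\<dots> \<le> rI (\<lambda>z. h z * u z) (big_box Q)" by (rule dsum_rI_le[OF fin]) measurable
      also have "\<dots> \<le> C1 * mass h Q" by (rule rt[OF tiles_valid[OF Q]])
      finally show ?thesis by (simp add: mass_eq[OF tiles_valid[OF Q]])
    qed
    show ?thesis
    proof (rule tree_weight_sum[OF e(1) \<pi>0(1,2) e(2) C1 K1, of U "avg h"], goal_cases)
      case (1 N R) then show ?case by (intro U_pos tiles_valid)
    next
      case (2 N R) then show ?case by (intro avg_pos mp tiles_valid)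
    next
      case (3 N Q) then show ?case by (rule rt')
    next
      case (4 N n j i) then show ?case using child by blast
    next
      case (5 \<tau>) then show ?case by (rule neg_sum)
    next
      case (6 K) then show ?case by blast
    qed
  qed
  have "\<exists>K. 0 < K \<and> (\<forall>N. \<forall>Q\<in>tiles N. dsum N W Q \<le> K * W Q)"
    unfolding W_def[abs_def]
  proof (rule tree[OF p(1) \<pi>0(3) g_meas g_fin(1) g_mass_pos(1)])
    show "rI (\<lambda>z. g z * u z) (big_box Q) \<le> C1 * mass g Q" if "valid Q" for Q using root[rule_format, OF that] by simp
  qed
  then obtain KW where KW: "\<forall>N. \<forall>Q\<in>tiles N. dsum N W Q \<le> KW * W Q" by blast
  have "\<exists>K. 0 < K \<and> (\<forall>N. \<forall>Q\<in>tiles N. dsum N S Q \<le> K * S Q)"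
    unfolding S_def[abs_def]
  proof (rule tree[OF q(1) \<pi>0(4) gd_meas g_fin(2) g_mass_pos(2)])
    show "rI (\<lambda>z. gd z * u z) (big_box Q) \<le> C1 * mass gd Q" if "valid Q" for Q using root[rule_format, OF that] by simp
  qed
  then obtain KS where KS: "\<forall>N. \<forall>Q\<in>tiles N. dsum N S Q \<le> KS * S Q" by blast
  define C where "C = Max {2, KW, KS}"
  have C: "2 \<le> C" "KW \<le> C" "KS \<le> C" by (auto simp: C_def)
  show thesis
  proof (rule that[OF C(1)]; intro allI conjI)
    fix N
    show "subtree_bounded C N W" unfolding subtree_bounded_def
    proof (intro ballI conjI)
      fix R assume R: "R \<in> tiles N"
      show W0: "0 < W R" by (rule W_pos[OF tiles_valid[OF R]])
      have "dsum N W R \<le> KW * W R" using KW R by blast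
      also have "\<dots> \<le> C * W R" using C W0 by (intro mult_right_mono) auto
      finally show "dsum N W R \<le> C * W R" .
    qed
    show "subtree_bounded C N S" unfolding subtree_bounded_def
    proof (intro ballI conjI)
      fix R assume R: "R \<in> tiles N"
      show S0: "0 < S R" by (rule S_pos[OF tiles_valid[OF R]])
      have "dsum N S R \<le> KS * S R" using KS R by blast
      also have "\<dots> \<le> C * S R" using C S0 by (intro mult_right_mono) auto
      finally show "dsum N S R \<le> C * S R" .
    qed
  qed
qed

text \<open>Both sides equal \<open>1/q - \<pi>0\<close>. Because of this, the powers of the
  averages in \<open>W Q\<close> and \<open>S R\<close> combine into one power of
  \<open>avg g Q * avg gd R powr P1\<close>.\<close>

lemma exponent_identity: "(1 - p * \<pi>0) / p * P1 = (1 - q * \<pi>0) / q"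
proof -
  have s: "1 - p * \<pi>0 \<noteq> 0" using \<pi>0 by simp
  have "(1 - p * \<pi>0) / p * P1 = (p * (1 - \<pi>0) - 1) / p" using s by (simp add: P1)
  also have "\<dots> = 1 - 1/p - \<pi>0" using p(1) by (simp add: field_simps)
  also have "\<dots> = 1/q - \<pi>0" using p(2) by simp
  also have "\<dots> = (1 - q * \<pi>0) / q" using q by (simp add: field_simps)
  finally show ?thesis .
qed

text \<open>The area factors multiply to \<open>tile_area Q\<close>, which cancels the power of 4;
  the powers of \<open>U\<close> have opposite exponents \<open>d\<close> and \<open>-d\<close> and
  cancel up to the comparison of neighbours; the averages are bounded by the box condition.\<close>

lemma WS_nbr:
  obtains C where "0 < C" "\<forall>Q R. valid Q \<longrightarrow> valid R \<longrightarrow> nbr Q R \<longrightarrow> 4 ^ fst Q * (W Q powr (1/p) * S R powr (1/q)) \<le> C"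
proof -
  obtain C1 where C1: "1 \<le> C1" and nb: "\<forall>Q R. valid Q \<longrightarrow> valid R \<longrightarrow> nbr Q R \<longrightarrow> avg g Q * avg gd R powr P1 \<le> C1"
    using avg_nbr .
  obtain C2 where C2: "1 \<le> C2" and Un: "\<forall>Q R. valid Q \<longrightarrow> valid R \<longrightarrow> nbr Q R \<longrightarrow> U Q \<le> C2 * U R"
    using U_nbr .
  define s where "s = (1 - p * \<pi>0) / p"
  define d where "d = 1/p - 1/2"
  have s0: "0 \<le> s" using p \<pi>0 by (simp add: s_def)
  show thesis
  proof (rule that[of "C1 powr s * C2 powr \<bar>d\<bar>"]; (intro allI impI)?)
    show "0 < C1 powr s * C2 powr \<bar>d\<bar>" using C1 C2 by simp
    fix Q R :: "nat \<times> nat" assume a: "valid Q" "valid R" "nbr Q R"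
    note U = U_pos[OF a(1)] U_pos[OF a(2)]
    note av = g_avg_pos(1)[OF a(1)] g_avg_pos(2)[OF a(2)]
    let ?t = "tile_area Q"
    have tR: "tile_area R = ?t" using a(3) by (simp add: nbr_def tile_area_def)
    have W': "W Q powr (1/p) = ?t powr (1/p) * avg g Q powr s * U Q powr d"
    proof -
      have "(1 - p/2) * (1/p) = d" using p by (simp add: d_def field_simps)
      then show ?thesis unfolding W_def using av U by (simp add: powr_mult powr_powr s_def)
    qed
    have S': "S R powr (1/q) = ?t powr (1/q) * (avg gd R powr P1) powr s * U R powr (-d)"
    proof -
      have "(1 - q/2) * (1/q) = 1/q - 1/2" using q by (simp add: field_simps)
      also have "\<dots> = -d" using p(2) by (simp add: d_def)
      finally have "(1 - q/2) * (1/q) = -d" .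
      moreover have "(1 - q * \<pi>0) * (1/q) = P1 * s" using exponent_identity by (simp add: s_def mult_ac)
      ultimately show ?thesis unfolding S_def using av U by (simp add: tR powr_mult powr_powr)
    qed
    have "4 ^ fst Q * (W Q powr (1/p) * S R powr (1/q)) = (4 ^ fst Q * (?t powr (1/p) * ?t powr (1/q))) * ((avg g Q * avg gd R powr P1) powr s * (U Q powr d * U R powr (-d)))"
      unfolding W' S' using av by (simp add: powr_mult mult_ac)
    also have "?t powr (1/p) * ?t powr (1/q) = ?t" unfolding powr_add[symmetric] p(2) by simp
    also have "4 ^ fst Q * ?t = 1" by (simp add: tile_area_def power_divide)
    also have "1 * ((avg g Q * avg gd R powr P1) powr s * (U Q powr d * U R powr (-d))) \<le> 1 * (C1 powr s * C2 powr \<bar>d\<bar>)"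
    proof (intro mult_left_mono mult_mono)
      show "(avg g Q * avg gd R powr P1) powr s \<le> C1 powr s"
        using nb[rule_format, OF a] av s0 by (intro powr_mono2) auto
      show "U Q powr d * U R powr (-d) \<le> C2 powr \<bar>d\<bar>"
      \<comment> \<open>\<open>d\<close> is nonnegative exactly for \<open>p \<le> 2\<close>;
        otherwise the comparison of \<open>U\<close> is used with \<open>Q\<close> and
        \<open>R\<close> exchanged.\<close>
      proof (cases "0 \<le> d")
        case True
        have "U Q powr d \<le> (C2 * U R) powr d" using Un[rule_format, OF a] U True by (intro powr_mono2) auto
        then show ?thesis using U C2 True by (simp add: powr_mult powr_minus field_simps)
      next
        case False
        have "U R powr (-d) \<le> (C2 * U Q) powr (-d)" using Un[rule_format, OF a(2,1) nbr_sym[OF a(3)]] U False by (intro powr_mono2) auto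
        then have "U R powr (-d) \<le> C2 powr (-d) * U Q powr (-d)" using U C2 by (simp add: powr_mult)
        then have "U Q powr d * U R powr (-d) \<le> U Q powr d * (C2 powr (-d) * U Q powr (-d))" by (intro mult_left_mono) auto
        also have "\<dots> = C2 powr (-d) * (U Q powr d * U Q powr (-d))" by (simp add: mult_ac)
        also have "U Q powr d * U Q powr (-d) = 1" unfolding powr_add[symmetric] using U by simp
        finally show ?thesis using False by simp
      qed
    qed auto
    finally show "4 ^ fst Q * (W Q powr (1/p) * S R powr (1/q)) \<le> C1 powr s * C2 powr \<bar>d\<bar>" by simp
  qed
qed

lemma operator_bound:
  obtains K where "0 < K"
    "\<forall>N x. (\<forall>R\<in>tiles N. 0 \<le> x R) \<longrightarrow> (\<Sum>A\<in>tiles N. (W A powr (1/p) * (\<Sum>Q\<in>tiles N. \<Sum>Q'\<in>tiles N. \<Sum>B\<in>tiles N.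
               if desc Q A \<and> nbr Q Q' \<and> desc Q' B then 4 ^ fst Q * (S B powr (1/q) * x B) else 0)) powr p)
           \<le> K * (\<Sum>B\<in>tiles N. x B powr p)"
proof -
  obtain C where C: "2 \<le> C" and sb: "\<forall>N. subtree_bounded C N W \<and> subtree_bounded C N S" using WS_root .
  obtain C0 where C0: "0 < C0" and nb: "\<forall>Q R. valid Q \<longrightarrow> valid R \<longrightarrow> nbr Q R \<longrightarrow> 4 ^ fst Q * (W Q powr (1/p) * S R powr (1/q)) \<le> C0"
    using WS_nbr .
  obtain K where K: "0 < K" and op: "\<forall>N W S L x. subtree_bounded C N W \<longrightarrow> subtree_bounded C N S \<longrightarrow>
      (\<forall>Q\<in>tiles N. \<forall>Q'\<in>tiles N. nbr Q Q' \<longrightarrow> L Q * (W Q powr (1/p) * S Q' powr (1/q)) \<le> C0) \<longrightarrow>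
      (\<forall>R\<in>tiles N. 0 \<le> L R \<and> 0 \<le> x R)
       \<longrightarrow> (\<Sum>A\<in>tiles N. (W A powr (1/p) * (\<Sum>Q\<in>tiles N. \<Sum>Q'\<in>tiles N. \<Sum>B\<in>tiles N.
               if desc Q A \<and> nbr Q Q' \<and> desc Q' B then L Q * (S B powr (1/q) * x B) else 0)) powr p)
           \<le> K * (\<Sum>B\<in>tiles N. x B powr p)"
    using tree_operator_bounded[OF p C C0 nbr_card] .
  show thesis
  proof (rule that[OF K], intro allI impI)
    fix N and x :: "nat \<times> nat \<Rightarrow> real" assume x: "\<forall>R\<in>tiles N. 0 \<le> x R"
    show "(\<Sum>A\<in>tiles N. (W A powr (1/p) * (\<Sum>Q\<in>tiles N. \<Sum>Q'\<in>tiles N. \<Sum>B\<in>tiles N.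
               if desc Q A \<and> nbr Q Q' \<and> desc Q' B then 4 ^ fst Q * (S B powr (1/q) * x B) else 0)) powr p)
           \<le> K * (\<Sum>B\<in>tiles N. x B powr p)"
    proof (rule op[rule_format, where L = "\<lambda>Q. 4 ^ fst Q"])
      show "4 ^ fst Q * (W Q powr (1/p) * S Q' powr (1/q)) \<le> C0" if "Q \<in> tiles N" "Q' \<in> tiles N" "nbr Q Q'" for Q Q'
        using nb[rule_format, OF tiles_valid[OF that(1)] tiles_valid[OF that(2)] that(3)] .
      show "0 \<le> (4::real) ^ fst R \<and> 0 \<le> x R" if "R \<in> tiles N" for R using x that by simp
    qed (use sb in blast)+
  qed
qed

end

section \<open>From the tree back to the disc\<close>

lemma tiles_union: "(\<Union>N. \<Union>A\<in>tiles N. tile A) = ball 0 1"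
proof
  show "(\<Union>N. \<Union>A\<in>tiles N. tile A) \<subseteq> ball 0 1" using tile_subset_ball by blast
  show "ball 0 1 \<subseteq> (\<Union>N. \<Union>A\<in>tiles N. tile A)"
  proof
    fix z :: complex assume "z \<in> ball 0 1"
    then obtain Q where Q: "valid Q" "z \<in> tile Q" by (rule tile_exists)
    then have "Q \<in> tiles (Suc (fst Q))" by (cases Q) (simp add: tiles_def)
    with Q show "z \<in> (\<Union>N. \<Union>A\<in>tiles N. tile A)" by blast
  qed
qed

text \<open>Monotone convergence along the truncations. The bound is asked only for large
  \<open>N\<close>, so that a given tile may be assumed to be among those present.\<close>

lemma nn_integral_ball_tiles_le:
  fixes f :: "complex \<Rightarrow> ennreal"
  assumes [measurable]: "f \<in> borel_measurable borel"
    and le: "\<And>N. N0 \<le> N \<Longrightarrow> (\<Sum>A\<in>tiles N. \<integral>\<^sup>+z\<in>tile A. f z \<partial>lborel) \<le> c"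
  shows "(\<integral>\<^sup>+z\<in>ball 0 1. f z \<partial>lborel) \<le> c"
proof -
  define D where "D N = (\<Union>A\<in>tiles N. tile A)" for N
  have [measurable]: "D N \<in> sets borel" for N unfolding D_def by (intro sets.finite_UN finite_tiles) measurable
  have mono: "D N \<subseteq> D N'" if "N \<le> N'" for N N' using that tiles_mono unfolding D_def by blast
  have inc: "incseq (\<lambda>N z. f z * indicator (D N) z)"
    by (intro monoI le_funI mult_left_mono) (use mono in \<open>auto simp: indicator_def subset_iff\<close>)
  have "(\<integral>\<^sup>+z\<in>ball 0 1. f z \<partial>lborel) = (\<integral>\<^sup>+z. (SUP N. f z * indicator (D N) z) \<partial>lborel)"
  proof (intro nn_integral_cong)
    fix z
    show "f z * indicator (ball 0 1) z = (SUP N. f z * indicator (D N) z)"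
    proof (cases "z \<in> ball 0 1")
      case True
      then obtain N where N: "z \<in> D N" using tiles_union unfolding D_def by blast
      have "(SUP N. f z * indicator (D N) z) = f z"
      proof (rule antisym)
        show "(SUP N. f z * indicator (D N) z) \<le> f z" by (intro SUP_least) (auto simp: indicator_def)
        show "f z \<le> (SUP N. f z * indicator (D N) z)" by (rule SUP_upper2[of N]) (use N in auto)
      qed
      then show ?thesis using True by simp
    next
      case False
      then have "z \<notin> D N" for N using tiles_union unfolding D_def by blast
      then show ?thesis using False by simp
    qed
  qed
  also have "\<dots> = (SUP N. \<integral>\<^sup>+z. f z * indicator (D N) z \<partial>lborel)"
    by (rule nn_integral_monotone_convergence_SUP[OF inc]) measurable
  also have "\<dots> \<le> c"
  proof (rule SUP_least)
    fix N
    have "(\<integral>\<^sup>+z. f z * indicator (D N) z \<partial>lborel) \<le> (\<integral>\<^sup>+z. (\<Sum>A\<in>tiles (max N N0). f z * indicator (tile A) z) \<partial>lborel)"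
    proof (intro nn_integral_mono)
      fix z
      show "f z * indicator (D N) z \<le> (\<Sum>A\<in>tiles (max N N0). f z * indicator (tile A) z)"
      proof (cases "z \<in> D N")
        case True
        then obtain A where A: "A \<in> tiles N" "z \<in> tile A" unfolding D_def by blast
        have A': "A \<in> tiles (max N N0)" using A(1) by (rule tiles_mono) simp
        have "f z * indicator (D N) z = f z * indicator (tile A) z" using True A by simp
        also have "\<dots> \<le> (\<Sum>A\<in>tiles (max N N0). f z * indicator (tile A) z)"
          by (rule member_le_sum[OF A']) auto
        finally show ?thesis .
      qed simp
    qed
    also have "\<dots> = (\<Sum>A\<in>tiles (max N N0). \<integral>\<^sup>+z\<in>tile A. f z \<partial>lborel)"
      by (rule nn_integral_sum) measurable
    also have "\<dots> \<le> c" by (rule le) simp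
    finally show "(\<integral>\<^sup>+z. f z * indicator (D N) z \<partial>lborel) \<le> c" .
  qed
  finally show ?thesis .
qed

context disc_weight begin

definition dwt :: "complex \<Rightarrow> real" where
  "dwt z = gd z powr (1 - q * \<pi>0) * u z powr (1 - q/2)"

lemma dwt_meas [measurable]: "dwt \<in> borel_measurable borel" unfolding dwt_def by measurable

lemma wt_nonneg: "0 \<le> wt z" and dwt_nonneg: "0 \<le> dwt z" by (simp_all add: wt_def dwt_def)

text \<open>On the disc \<open>dwt\<close> is the dual weight \<open>wt powr (-q/p)\<close>. In this
  form Hoelder's inequality on a tile splits \<open>F\<close> into its weighted part and a power of
  the dual weight.\<close>

lemma wt_dual:
  assumes z: "z \<in> ball 0 1" and F: "0 \<le> F"
  shows "(F powr p * wt z) powr (1/p) * dwt z powr (1/q) = F"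
proof -
  note pos = g_pos[OF z] u_pos[OF z] gd_pos[OF z]
  define s where "s = (1 - p * \<pi>0) / p"
  define d where "d = 1/p - 1/2"
  have "(1 - p/2) * (1/p) = d" using p by (simp add: d_def field_simps)
  then have "(F powr p * wt z) powr (1/p) = F * (g z powr s * u z powr d)"
    using pos F p by (simp add: wt_def powr_mult powr_powr s_def)
  moreover have "dwt z powr (1/q) = g z powr (-s) * u z powr (-d)"
  proof -
    have "(1 - q/2) * (1/q) = 1/q - 1/2" using q by (simp add: field_simps)
    also have "\<dots> = -d" using p(2) by (simp add: d_def)
    finally have d: "(1 - q/2) * (1/q) = -d" .
    have "(-1/P1) * ((1 - q * \<pi>0) * (1/q)) = - (s * P1 / P1)" using exponent_identity by (simp add: s_def)
    also have "\<dots> = -s" using P1_pos by simp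
    finally have "(-1/P1) * ((1 - q * \<pi>0) * (1/q)) = -s" .
    then have "gd z powr ((1 - q * \<pi>0) * (1/q)) = g z powr (-s)" unfolding gd_def powr_powr by simp
    then show ?thesis using pos by (simp only: dwt_def powr_mult powr_powr d)
  qed
  moreover have "g z powr s * g z powr (-s) = 1" "u z powr d * u z powr (-d) = 1"
    unfolding powr_add[symmetric] using pos by simp_all
  ultimately show ?thesis by (simp add: mult_ac)
qed

text \<open>On the tile \<open>A\<close> every value of \<open>G\<close> is at most a constant times
  one number \<open>T A\<close>, because the kernel bound depends only on the tiles. Integration
  against \<open>wt\<close> then leaves a sum over tiles, to which the tree estimate applies. Source
  and target are truncated separately: the source tiles exhaust the disc while the targets are
  fixed, and only then the targets do.\<close>

theorem disc_operator_bounded: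
  obtains K where "0 < K"
    "\<forall>F G. F \<in> borel_measurable borel \<longrightarrow> G \<in> borel_measurable borel \<longrightarrow> (\<forall>z. 0 \<le> F z) \<longrightarrow> (\<forall>z. 0 \<le> G z) \<longrightarrow>
      (\<forall>a\<in>ball 0 1. ennreal (G a) \<le> (\<integral>\<^sup>+z\<in>ball 0 1. ennreal (F z / (cmod (1 - cnj a * z))\<^sup>2) \<partial>lborel)) \<longrightarrow>
      nnI (\<lambda>z. F z powr p * wt z) (ball 0 1) < \<infinity> \<longrightarrow>
      nnI (\<lambda>z. G z powr p * wt z) (ball 0 1) \<le> ennreal K * nnI (\<lambda>z. F z powr p * wt z) (ball 0 1)"
proof -
  obtain K where K: "0 < K" and op:
    "\<forall>N x. (\<forall>R\<in>tiles N. 0 \<le> x R) \<longrightarrow> (\<Sum>A\<in>tiles N. (W A powr (1/p) * (\<Sum>Q\<in>tiles N. \<Sum>Q'\<in>tiles N. \<Sum>B\<in>tiles N.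
               if desc Q A \<and> nbr Q Q' \<and> desc Q' B then 4 ^ fst Q * (S B powr (1/q) * x B) else 0)) powr p)
           \<le> K * (\<Sum>B\<in>tiles N. x B powr p)"
    using operator_bound .
  obtain CW where CW: "0 < CW" and CWle: "\<forall>Q. valid Q \<longrightarrow> nnI (\<lambda>z. g z powr (1 - p * \<pi>0) * u z powr (1 - p/2)) (tile Q) \<le>
     ennreal (CW * (tile_area Q * avg g Q powr (1 - p * \<pi>0) * U Q powr (1 - p/2)))"
    using tile_weight[OF p(1) \<pi>0(3) g_meas g_pos g_fin(1)] .
  obtain CS where CS: "0 < CS" and CSle: "\<forall>Q. valid Q \<longrightarrow> nnI (\<lambda>z. gd z powr (1 - q * \<pi>0) * u z powr (1 - q/2)) (tile Q) \<le>
     ennreal (CS * (tile_area Q * avg gd Q powr (1 - q * \<pi>0) * U Q powr (1 - q/2)))"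
    using tile_weight[OF q(1) \<pi>0(4) gd_meas gd_pos g_fin(2)] .
  have CWle': "nnI wt (tile Q) \<le> ennreal (CW * W Q)" if "Q \<in> tiles N" for Q N
    using CWle[rule_format, OF tiles_valid[OF that]] unfolding wt_def[abs_def] W_def .
  have CSle': "nnI dwt (tile Q) \<le> ennreal (CS * S Q)" if "Q \<in> tiles N" for Q N
    using CSle[rule_format, OF tiles_valid[OF that]] unfolding dwt_def[abs_def] S_def .
  define c where "c = 4 * CS powr (1/q)"
  have c: "0 < c" using CS by (simp add: c_def)
  show thesis
  proof (rule that[of "c powr p * CW * K"]; (intro allI impI)?)
    show "0 < c powr p * CW * K" using c CW K by simp
    fix F G :: "complex \<Rightarrow> real"
    assume Fm[measurable]: "F \<in> borel_measurable borel" and Gm[measurable]: "G \<in> borel_measurable borel"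
      and F0: "\<forall>z. 0 \<le> F z" and G0: "\<forall>z. 0 \<le> G z"
      and GF: "\<forall>a\<in>ball 0 1. ennreal (G a) \<le> (\<integral>\<^sup>+z\<in>ball 0 1. ennreal (F z / (cmod (1 - cnj a * z))\<^sup>2) \<partial>lborel)"
      and fin: "nnI (\<lambda>z. F z powr p * wt z) (ball 0 1) < \<infinity>"
    let ?h = "\<lambda>z. F z powr p * wt z"
    define FF where "FF = rI ?h (ball 0 1)"
    have FF: "nnI ?h (ball 0 1) = ennreal FF" "0 \<le> FF" using nnI_eq_rI[OF fin] by (auto simp: FF_def)
    define x where "x B = rI ?h (tile B) powr (1/p)" for B
    have x0: "0 \<le> x B" for B by (simp add: x_def)
    have xsum: "(\<Sum>B\<in>tiles N. x B powr p) \<le> FF" for N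
    proof -
      have "(\<Sum>B\<in>tiles N. x B powr p) = dsum N (\<lambda>R. rI ?h (tile R)) (0, 0)"
        unfolding dsum_def dset_root x_def using p(1) by (simp add: powr_powr)
      also have "\<dots> \<le> rI ?h (big_box (0, 0))"
        by (rule dsum_rI_le) (use fin in \<open>auto simp: big_box_root\<close>)
      finally show ?thesis by (simp add: big_box_root FF_def)
    qed
    have Ftile: "nnI F (tile B) \<le> ennreal (CS powr (1/q) * (S B powr (1/q) * x B))" if B: "B \<in> tiles N" for B N
    proof -
      have finh: "nnI ?h (tile B) < \<infinity>" by (rule nnI_finite_subset[OF tile_subset_ball fin])
      have find: "nnI dwt (tile B) < \<infinity>" using CSle'[OF B] by (rule order.strict_trans1) simp
      have SB: "0 < S B" by (rule S_pos[OF tiles_valid[OF B]])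
      have "nnI F (tile B) = nnI (\<lambda>z. ?h z powr (1/p) * dwt z powr (1/q)) (tile B)"
        unfolding nnI_def using F0 wt_dual[OF tile_ball]
        by (intro nn_integral_cong) (auto simp: indicator_def)
      also have "\<dots> \<le> ennreal (rI ?h (tile B) powr (1/p) * rI dwt (tile B) powr (1/q))"
        by (rule Holder_tile) (use p q finh find in \<open>auto simp: wt_nonneg dwt_nonneg\<close>)
      also have "\<dots> \<le> ennreal (CS powr (1/q) * (S B powr (1/q) * x B))"
      proof (rule ennreal_leI)
        have "ennreal (rI dwt (tile B)) \<le> ennreal (CS * S B)" using CSle'[OF B] nnI_eq_rI[OF find] by simp
        then have "rI dwt (tile B) \<le> CS * S B" using CS SB by simp
        then have "rI dwt (tile B) powr (1/q) \<le> (CS * S B) powr (1/q)" using q by (intro powr_mono2) auto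
        then have "x B * rI dwt (tile B) powr (1/q) \<le> x B * (CS powr (1/q) * S B powr (1/q))"
          using CS SB x0 by (intro mult_left_mono) (auto simp: powr_mult)
        then show "rI ?h (tile B) powr (1/p) * rI dwt (tile B) powr (1/q) \<le> CS powr (1/q) * (S B powr (1/q) * x B)"
          by (simp add: x_def mult_ac)
      qed
      finally show ?thesis .
    qed
    define V where "V N A = (\<Sum>Q\<in>tiles N. \<Sum>Q'\<in>tiles N. \<Sum>B\<in>tiles N.
               if desc Q A \<and> nbr Q Q' \<and> desc Q' B then 4 ^ fst Q * (S B powr (1/q) * x B) else 0)" for N A
    have t0: "0 \<le> (if P then 4 ^ n * (S B powr (1/q) * x B) else (0::real))" for P n B using x0 by simp
    have V0: "0 \<le> V N A" for N A unfolding V_def by (intro sum_nonneg t0)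
    have Vmono: "V N A \<le> V N' A" if "N \<le> N'" for N N' A
    proof -
      have sub: "tiles N \<subseteq> tiles N'" using tiles_mono that by blast
      let ?f = "\<lambda>Q Q' B. if desc Q A \<and> nbr Q Q' \<and> desc Q' B then 4 ^ fst Q * (S B powr (1/q) * x B) else (0::real)"
      have f0: "0 \<le> ?f Q Q' B" for Q Q' B by (rule t0)
      have "V N A \<le> (\<Sum>Q\<in>tiles N. \<Sum>Q'\<in>tiles N. \<Sum>B\<in>tiles N'. ?f Q Q' B)"
        unfolding V_def by (intro sum_mono sum_mono2 finite_tiles sub f0)
      also have "\<dots> \<le> (\<Sum>Q\<in>tiles N. \<Sum>Q'\<in>tiles N'. \<Sum>B\<in>tiles N'. ?f Q Q' B)"
        by (intro sum_mono sum_mono2 finite_tiles sub sum_nonneg f0)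
      also have "\<dots> \<le> V N' A"
        unfolding V_def by (intro sum_mono2 finite_tiles sub sum_nonneg f0)
      finally show ?thesis .
    qed
    have Vsum: "(\<Sum>A\<in>tiles N. (W A powr (1/p) * V N A) powr p) \<le> K * FF" for N
    proof -
      have "(\<Sum>A\<in>tiles N. (W A powr (1/p) * V N A) powr p) \<le> K * (\<Sum>B\<in>tiles N. x B powr p)"
        unfolding V_def using op x0 by blast
      also have "\<dots> \<le> K * FF" using xsum K by (intro mult_left_mono) auto
      finally show ?thesis .
    qed
    \<comment> \<open>A real supremum, meaningful only for bounded families. The tree estimate
      itself supplies the bound, as the single term of \<open>A\<close> is at most the whole
      sum.\<close>
    define T where "T A = (SUP N. V N A)" for A
    have bdd: "bdd_above (range (\<lambda>N. V N A))" if A: "A \<in> tiles M" for A M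
    proof (rule bdd_aboveI2)
      fix N
      let ?N = "max N M"
      have A': "A \<in> tiles ?N" using A by (rule tiles_mono) simp
      have W0: "0 < W A" by (rule W_pos[OF tiles_valid[OF A]])
      have "(W A powr (1/p) * V ?N A) powr p \<le> (\<Sum>A\<in>tiles ?N. (W A powr (1/p) * V ?N A) powr p)"
        by (rule member_le_sum[OF A']) auto
      also have "\<dots> \<le> K * FF" by (rule Vsum)
      finally have "((W A powr (1/p) * V ?N A) powr p) powr (1/p) \<le> (K * FF) powr (1/p)" using p by (intro powr_mono2) auto
      then have "W A powr (1/p) * V ?N A \<le> (K * FF) powr (1/p)" using p V0[of ?N A] by (simp add: powr_powr)
      then have "V ?N A \<le> (K * FF) powr (1/p) / W A powr (1/p)" using W0 by (simp add: pos_le_divide_eq mult.commute)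
      then show "V N A \<le> (K * FF) powr (1/p) / W A powr (1/p)" using Vmono[of N ?N A] by simp
    qed
    have Vlim: "(\<lambda>N. V N A) \<longlonglongrightarrow> T A" if A: "A \<in> tiles M" for A M
      unfolding T_def by (rule LIMSEQ_incseq_SUP[OF bdd[OF A]]) (auto intro!: monoI Vmono)
    have VT: "V N A \<le> T A" if A: "A \<in> tiles M" for A M N
      unfolding T_def by (rule cSUP_upper[OF _ bdd[OF A]]) simp
    have T0: "0 \<le> T A" if A: "A \<in> tiles M" for A M using V0[of 0 A] VT[OF A, of 0] by linarith
    have Tsum: "(\<Sum>A\<in>tiles M. (W A powr (1/p) * T A) powr p) \<le> K * FF" for M
    proof (rule LIMSEQ_le_const2)
      show "(\<lambda>N. \<Sum>A\<in>tiles M. (W A powr (1/p) * V N A) powr p) \<longlonglongrightarrow> (\<Sum>A\<in>tiles M. (W A powr (1/p) * T A) powr p)"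
        using p(1) V0 by (intro tendsto_sum tendsto_powr2 tendsto_mult tendsto_const Vlim always_eventually) auto
      show "\<exists>n0. \<forall>N\<ge>n0. (\<Sum>A\<in>tiles M. (W A powr (1/p) * V N A) powr p) \<le> K * FF"
      proof (intro exI[of _ M] allI impI)
        fix N assume "M \<le> N"
        then have sub: "tiles M \<subseteq> tiles N" using tiles_mono by blast
        have "(\<Sum>A\<in>tiles M. (W A powr (1/p) * V N A) powr p) \<le> (\<Sum>A\<in>tiles N. (W A powr (1/p) * V N A) powr p)"
          by (intro sum_mono2 finite_tiles sub powr_ge_zero)
        with Vsum[of N] show "(\<Sum>A\<in>tiles M. (W A powr (1/p) * V N A) powr p) \<le> K * FF" by linarith
      qed
    qed
    have GT: "G a \<le> c * T A" if A: "A \<in> tiles M" and a: "a \<in> tile A" for A M a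
    proof -
      have "ennreal (G a) \<le> (\<integral>\<^sup>+z\<in>ball 0 1. ennreal (F z / (cmod (1 - cnj a * z))\<^sup>2) \<partial>lborel)"
        using GF tile_ball[OF a] by blast
      also have "\<dots> \<le> ennreal (c * T A)"
      proof (rule nn_integral_ball_tiles_le[where ?N0.0 = M])
        fix N assume MN: "M \<le> N"
        have AN: "A \<in> tiles N" using A MN by (rule tiles_mono)
        \<comment> \<open>The kernel on the pair \<open>A\<close>, \<open>B\<close> is bounded by
          one summand. Summing over all admissible \<open>Q\<close> and \<open>Q'\<close>
          overcounts, but produces the shape of the tree operator.\<close>
        define \<kappa> where "\<kappa> B = (\<Sum>Q\<in>tiles N. \<Sum>Q'\<in>tiles N. if desc Q A \<and> nbr Q Q' \<and> desc Q' B then 4 * 4 ^ fst Q else (0::real))" for B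
        have \<kappa>0: "0 \<le> \<kappa> B" for B unfolding \<kappa>_def by (intro sum_nonneg) auto
        have tile: "(\<integral>\<^sup>+z\<in>tile B. ennreal (F z / (cmod (1 - cnj a * z))\<^sup>2) \<partial>lborel) \<le> ennreal (\<kappa> B * (CS powr (1/q) * (S B powr (1/q) * x B)))"
          if B: "B \<in> tiles N" for B
        proof -
          have ker: "1 / (cmod (1 - cnj a * z))\<^sup>2 \<le> \<kappa> B" if z: "z \<in> tile B" for z
          proof -
            obtain Q Q' where Q: "desc Q A" "desc Q' B" "nbr Q Q'" "1 / (cmod (1 - cnj a * z))\<^sup>2 \<le> 4 * 4 ^ fst Q"
              using kernel_tile_bound[OF a z] .
            have QN: "Q \<in> tiles N" "Q' \<in> tiles N" using desc_tiles[OF AN Q(1)] desc_tiles[OF B Q(2)] by auto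
            note Q(4)
            also have "4 * 4 ^ fst Q = (if desc Q A \<and> nbr Q Q' \<and> desc Q' B then 4 * 4 ^ fst Q else (0::real))" using Q by simp
            also have "\<dots> \<le> (\<Sum>Q'\<in>tiles N. if desc Q A \<and> nbr Q Q' \<and> desc Q' B then 4 * 4 ^ fst Q else (0::real))"
              by (rule member_le_sum[OF QN(2)]) auto
            also have "\<dots> \<le> \<kappa> B" unfolding \<kappa>_def
              by (rule member_le_sum[OF QN(1)]) (auto intro!: sum_nonneg)
            finally show ?thesis .
          qed
          have "(\<integral>\<^sup>+z\<in>tile B. ennreal (F z / (cmod (1 - cnj a * z))\<^sup>2) \<partial>lborel) \<le> (\<integral>\<^sup>+z. ennreal (\<kappa> B) * (ennreal (F z) * indicator (tile B) z) \<partial>lborel)"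
          proof (intro nn_integral_mono)
            fix z
            show "ennreal (F z / (cmod (1 - cnj a * z))\<^sup>2) * indicator (tile B) z \<le> ennreal (\<kappa> B) * (ennreal (F z) * indicator (tile B) z)"
            proof (cases "z \<in> tile B")
              case True
              have "F z * (1 / (cmod (1 - cnj a * z))\<^sup>2) \<le> F z * \<kappa> B" using ker[OF True] F0 by (intro mult_left_mono) auto
              then have "ennreal (F z / (cmod (1 - cnj a * z))\<^sup>2) \<le> ennreal (\<kappa> B * F z)" by (intro ennreal_leI) (simp add: mult_ac)
              then show ?thesis using True \<kappa>0 F0 by (simp add: ennreal_mult)
            qed simp
          qed
          also have "\<dots> = ennreal (\<kappa> B) * nnI F (tile B)" unfolding nnI_def by (rule nn_integral_cmult) measurable
          also have "\<dots> \<le> ennreal (\<kappa> B) * ennreal (CS powr (1/q) * (S B powr (1/q) * x B))"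
            by (intro mult_left_mono Ftile[OF B]) auto
          also have "\<dots> = ennreal (\<kappa> B * (CS powr (1/q) * (S B powr (1/q) * x B)))"
            using \<kappa>0 x0 by (simp add: ennreal_mult)
          finally show ?thesis .
        qed
        have "(\<Sum>B\<in>tiles N. \<integral>\<^sup>+z\<in>tile B. ennreal (F z / (cmod (1 - cnj a * z))\<^sup>2) \<partial>lborel) \<le> (\<Sum>B\<in>tiles N. ennreal (\<kappa> B * (CS powr (1/q) * (S B powr (1/q) * x B))))"
          by (intro sum_mono tile)
        also have "\<dots> = ennreal (\<Sum>B\<in>tiles N. \<kappa> B * (CS powr (1/q) * (S B powr (1/q) * x B)))"
          using \<kappa>0 x0 by (intro sum_ennreal) auto
        also have "(\<Sum>B\<in>tiles N. \<kappa> B * (CS powr (1/q) * (S B powr (1/q) * x B))) = c * V N A"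
        proof -
          have "(\<Sum>B\<in>tiles N. \<kappa> B * (CS powr (1/q) * (S B powr (1/q) * x B)))
            = (\<Sum>B\<in>tiles N. \<Sum>Q\<in>tiles N. \<Sum>Q'\<in>tiles N. c * (if desc Q A \<and> nbr Q Q' \<and> desc Q' B then 4 ^ fst Q * (S B powr (1/q) * x B) else 0))"
            unfolding \<kappa>_def sum_distrib_right by (intro sum.cong refl) (simp add: c_def)
          also have "\<dots> = (\<Sum>Q\<in>tiles N. \<Sum>B\<in>tiles N. \<Sum>Q'\<in>tiles N. c * (if desc Q A \<and> nbr Q Q' \<and> desc Q' B then 4 ^ fst Q * (S B powr (1/q) * x B) else 0))"
            by (rule sum.swap)
          also have "\<dots> = (\<Sum>Q\<in>tiles N. \<Sum>Q'\<in>tiles N. \<Sum>B\<in>tiles N. c * (if desc Q A \<and> nbr Q Q' \<and> desc Q' B then 4 ^ fst Q * (S B powr (1/q) * x B) else 0))"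
            by (intro sum.cong refl sum.swap)
          also have "\<dots> = c * V N A" unfolding V_def sum_distrib_left ..
          finally show ?thesis .
        qed
        also have "ennreal (c * V N A) \<le> ennreal (c * T A)" using VT[OF A] c by (intro ennreal_leI mult_left_mono) auto
        finally show "(\<Sum>B\<in>tiles N. \<integral>\<^sup>+z\<in>tile B. ennreal (F z / (cmod (1 - cnj a * z))\<^sup>2) \<partial>lborel) \<le> ennreal (c * T A)" .
      qed measurable
      finally show ?thesis using c T0[OF A] by simp
    qed
    have "nnI (\<lambda>z. G z powr p * wt z) (ball 0 1) \<le> ennreal (c powr p * CW * (K * FF))"
      unfolding nnI_def
    proof (rule nn_integral_ball_tiles_le[where ?N0.0 = 0])
      fix M
      have tile: "(\<integral>\<^sup>+z\<in>tile A. ennreal (G z powr p * wt z) \<partial>lborel) \<le> ennreal (c powr p * CW * (W A powr (1/p) * T A) powr p)"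
        if A: "A \<in> tiles M" for A
      proof -
        have W0: "0 < W A" by (rule W_pos[OF tiles_valid[OF A]])
        have "(\<integral>\<^sup>+z\<in>tile A. ennreal (G z powr p * wt z) \<partial>lborel) \<le> (\<integral>\<^sup>+z. ennreal ((c * T A) powr p) * (ennreal (wt z) * indicator (tile A) z) \<partial>lborel)"
        proof (intro nn_integral_mono)
          fix z
          show "ennreal (G z powr p * wt z) * indicator (tile A) z \<le> ennreal ((c * T A) powr p) * (ennreal (wt z) * indicator (tile A) z)"
          proof (cases "z \<in> tile A")
            case True
            have "G z powr p * wt z \<le> (c * T A) powr p * wt z"
              using GT[OF A True] G0 p by (intro mult_right_mono powr_mono2) (auto simp: wt_def)
            then have "ennreal (G z powr p * wt z) \<le> ennreal ((c * T A) powr p * wt z)" by (rule ennreal_leI)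
            then show ?thesis using True by (simp add: ennreal_mult wt_def)
          qed simp
        qed
        also have "\<dots> = ennreal ((c * T A) powr p) * nnI wt (tile A)" unfolding nnI_def by (rule nn_integral_cmult) measurable
        also have "\<dots> \<le> ennreal ((c * T A) powr p) * ennreal (CW * W A)" by (intro mult_left_mono CWle'[OF A]) auto
        also have "\<dots> = ennreal ((c * T A) powr p * (CW * W A))" using CW W0 by (simp add: ennreal_mult)
        also have "(c * T A) powr p * (CW * W A) = c powr p * CW * (W A powr (1/p) * T A) powr p"
          using c T0[OF A] W0 p by (simp add: powr_mult powr_powr mult_ac)
        finally show ?thesis .
      qed
      have "(\<Sum>A\<in>tiles M. \<integral>\<^sup>+z\<in>tile A. ennreal (G z powr p * wt z) \<partial>lborel) \<le> (\<Sum>A\<in>tiles M. ennreal (c powr p * CW * (W A powr (1/p) * T A) powr p))"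
        by (intro sum_mono tile)
      also have "\<dots> = ennreal (\<Sum>A\<in>tiles M. c powr p * CW * (W A powr (1/p) * T A) powr p)"
        using CW by (intro sum_ennreal) auto
      also have "\<dots> \<le> ennreal (c powr p * CW * (K * FF))"
        unfolding sum_distrib_left[symmetric] using CW Tsum by (intro ennreal_leI mult_left_mono) auto
      finally show "(\<Sum>A\<in>tiles M. \<integral>\<^sup>+z\<in>tile A. ennreal (G z powr p * wt z) \<partial>lborel) \<le> ennreal (c powr p * CW * (K * FF))" .
    qed measurable
    also have "\<dots> = ennreal (c powr p * CW * K) * nnI ?h (ball 0 1)"
      using FF CW K by (simp add: mult.assoc flip: ennreal_mult)
    finally show "nnI (\<lambda>z. G z powr p * wt z) (ball 0 1) \<le> ennreal (c powr p * CW * K) * nnI ?h (ball 0 1)" .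
  qed
qed

end

section \<open>Transfer to the domain\<close>

text \<open>Agreement almost everywhere is the right form here, as it lets a weight that is positive
  only almost everywhere be replaced by a positive one.\<close>

lemma set_integrable_iff_nnI:
  fixes h k :: "complex \<Rightarrow> real"
  assumes [measurable]: "h \<in> borel_measurable borel" "E \<in> sets borel"
    and ae: "AE z in lborel. z \<in> E \<longrightarrow> h z = k z \<and> 0 \<le> k z"
  shows "set_integrable lborel E h \<longleftrightarrow> nnI k E < \<infinity>" "(LINT z:E|lborel. h z) = rI k E"
proof -
  have m: "(\<lambda>z. indicator E z *\<^sub>R h z) \<in> borel_measurable lborel" by measurable
  have eq: "(\<integral>\<^sup>+z. ennreal (indicator E z *\<^sub>R h z) \<partial>lborel) = nnI k E"
    unfolding nnI_def by (intro nn_integral_cong_AE, use ae in eventually_elim) (auto simp: indicator_def)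
  have eq2: "(\<integral>\<^sup>+z. ennreal (norm (indicator E z *\<^sub>R h z)) \<partial>lborel) = nnI k E"
    unfolding nnI_def by (intro nn_integral_cong_AE, use ae in eventually_elim) (auto simp: indicator_def)
  show "set_integrable lborel E h \<longleftrightarrow> nnI k E < \<infinity>"
    unfolding set_integrable_def integrable_iff_bounded eq2 using m by simp
  have nn: "AE z in lborel. 0 \<le> indicator E z *\<^sub>R h z" using ae by eventually_elim (auto simp: indicator_def)
  show "(LINT z:E|lborel. h z) = rI k E"
    unfolding set_lebesgue_integral_def rI_def integral_eq_nn_integral[OF m nn] eq ..
qed

lemma wavg_eq:
  fixes f k :: "complex \<Rightarrow> real"
  assumes [measurable]: "f \<in> borel_measurable borel" "E \<in> sets borel"
    and ae: "AE z in lborel. z \<in> E \<longrightarrow> \<bar>f z\<bar> powr e = k z"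
  shows "wavg e (\<lambda>_. 1) E f = rI k E powr (1/e) / measure lborel E powr (1/e)"
proof -
  have "(LINT z:E|lborel. \<bar>f z\<bar> powr e * 1) = rI k E"
  proof (rule set_integrable_iff_nnI(2))
    show "AE z in lborel. z \<in> E \<longrightarrow> \<bar>f z\<bar> powr e * 1 = k z \<and> 0 \<le> k z"
      using ae
    proof eventually_elim
      case (elim z)
      then show ?case by (metis mult_1_right powr_ge_zero)
    qed
  qed measurable
  moreover have "(LINT z:E|lborel. (1::real)) = measure lborel E"
    unfolding set_lebesgue_integral_def by simp
  ultimately show ?thesis unfolding wavg_def by simp
qed

lemma nnI_holomorphic_image:
  assumes "open S" "\<psi> holomorphic_on S" "inj_on \<psi> S" "k \<in> borel_measurable borel" "A \<in> sets borel" "A \<subseteq> S" "\<And>z. z \<in> A \<Longrightarrow> 0 \<le> k (\<psi> z)"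
  shows "nnI k (\<psi> ` A) = nnI (\<lambda>z. k (\<psi> z) * (cmod (deriv \<psi> z))\<^sup>2) A"
proof -
  have "nnI k (\<psi> ` A) = (\<integral>\<^sup>+z\<in>A. ennreal (k (\<psi> z)) * ennreal ((cmod (deriv \<psi> z))\<^sup>2) \<partial>lborel)"
    unfolding nnI_def using assms by (intro nn_integral_holomorphic_image) auto
  also have "\<dots> = nnI (\<lambda>z. k (\<psi> z) * (cmod (deriv \<psi> z))\<^sup>2) A"
    unfolding nnI_def using assms(7) by (intro nn_integral_cong) (auto simp: indicator_def ennreal_mult)
  finally show ?thesis .
qed

text \<open>Absolute values in the mean value property; if \<open>h\<close> is not integrable, the
  right-hand side is infinite.\<close>

lemma area_sub_mean_value:
  assumes h: "h holomorphic_on ball a r" and r: "0 < r"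
  shows "ennreal (pi * r\<^sup>2 * cmod (h a)) \<le> nnI (\<lambda>z. cmod (h z)) (ball a r)"
proof (cases "nnI (\<lambda>z. cmod (h z)) (ball a r) < \<infinity>")
  case True
  have m: "(\<lambda>z. indicator (ball a r) z *\<^sub>R h z) \<in> borel_measurable borel"
    using borel_compose_holomorphic[OF open_ball h, of "\<lambda>z. z"] by simp
  have eq: "(\<integral>\<^sup>+z. ennreal (norm (indicator (ball a r) z *\<^sub>R h z)) \<partial>lborel) = nnI (\<lambda>z. cmod (h z)) (ball a r)"
    unfolding nnI_def by (intro nn_integral_cong) (auto simp: indicator_def)
  have int: "set_integrable lborel (ball a r) h"
    unfolding set_integrable_def integrable_iff_bounded eq using m True by simp
  have "pi * r\<^sup>2 * cmod (h a) = norm (LINT z:ball a r|lborel. h z)"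
    unfolding area_mean_value[OF h r int] by (simp add: norm_mult norm_power)
  also have "ennreal \<dots> \<le> nnI (\<lambda>z. cmod (h z)) (ball a r)"
    unfolding eq[symmetric] set_lebesgue_integral_def
    by (rule integral_norm_bound_ennreal[OF int[unfolded set_integrable_def]])
  finally show ?thesis .
next
  case False
  then show ?thesis by (simp add: less_top[symmetric])
qed

section \<open>The hypotheses as conditions on disc integrals\<close>

lemma carleson_boxes_borel: "X \<in> carleson_boxes \<Longrightarrow> X \<in> sets borel"
  and carleson_boxes_subset: "X \<in> carleson_boxes \<Longrightarrow> X \<subseteq> ball 0 1"
  unfolding carleson_boxes_def using carleson_box_borel carleson_box_subset_ball by auto

text \<open>For the exponent \<open>1 + 1/\<tau>\<close> the dual average is that of
  \<open>u powr (-\<tau>)\<close>. Clearing denominators turns averages into integrals, the form in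
  which the big boxes are treated.\<close>

lemma B_cond_disc:
  assumes B: "B_cond carleson_boxes (1 + 1/\<tau>) u" and \<tau>: "0 < \<tau>" and um[measurable]: "u \<in> borel_measurable borel"
    and upos: "\<And>z. z \<in> ball 0 1 \<Longrightarrow> 0 < u z"
  shows "\<exists>C. \<forall>X\<in>carleson_boxes. nnI u X < \<infinity> \<and> nnI (\<lambda>z. u z powr (-\<tau>)) X < \<infinity> \<and>
          rI u X * rI (\<lambda>z. u z powr (-\<tau>)) X powr (1/\<tau>) \<le> C * measure lborel X powr (1 + 1/\<tau>)"
proof -
  have q: "1 + 1/\<tau> \<noteq> 1" "1 / (1 + 1/\<tau> - 1) = \<tau>" using \<tau> by auto
  obtain C where C: "\<And>X. X \<in> carleson_boxes \<Longrightarrow> set_integrable lborel X u \<and>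
      set_integrable lborel X (\<lambda>z. \<bar>1 / u z\<bar> powr \<tau>) \<and> wavg 1 (\<lambda>_. 1) X u * wavg \<tau> (\<lambda>_. 1) X (\<lambda>z. 1 / u z) \<le> C"
    using B q unfolding B_cond_def by auto
  show ?thesis
  proof (intro exI[of _ C] ballI)
    fix X assume X: "X \<in> carleson_boxes"
    note [measurable] = carleson_boxes_borel[OF X]
    have pos: "0 < u z" if "z \<in> X" for z using upos carleson_boxes_subset[OF X] that by blast
    have eq: "\<bar>1 / u z\<bar> powr \<tau> = u z powr (-\<tau>)" if "z \<in> X" for z
      using pos[OF that] by (simp add: powr_divide powr_minus_divide)
    have f1: "nnI u X < \<infinity>"
      using C[OF X] set_integrable_iff_nnI(1)[of u X u] pos by (auto simp: less_imp_le)
    have f2: "nnI (\<lambda>z. u z powr (-\<tau>)) X < \<infinity>"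
      using C[OF X] set_integrable_iff_nnI(1)[of "\<lambda>z. \<bar>1 / u z\<bar> powr \<tau>" X "\<lambda>z. u z powr (-\<tau>)"] eq by auto
    let ?m = "measure lborel X" and ?J = "rI (\<lambda>z. u z powr (-\<tau>)) X"
    have w1: "wavg 1 (\<lambda>_. 1) X u = rI u X / ?m"
      using wavg_eq[of u X 1 u] pos by (simp add: less_imp_le)
    have w2: "wavg \<tau> (\<lambda>_. 1) X (\<lambda>z. 1 / u z) = ?J powr (1/\<tau>) / ?m powr (1/\<tau>)"
      by (rule wavg_eq) (use eq in auto)
    have le: "rI u X / ?m * (?J powr (1/\<tau>) / ?m powr (1/\<tau>)) \<le> C" using C[OF X] unfolding w1 w2 by blast
    have "rI u X * ?J powr (1/\<tau>) \<le> C * ?m powr (1 + 1/\<tau>)"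
    \<comment> \<open>Division by zero gives 0, so the condition on averages says nothing about a
      set of measure 0; there the integral of \<open>u\<close> vanishes as well.\<close>
    proof (cases "?m = 0")
      case True
      have "emeasure lborel X \<noteq> \<infinity>"
        using emeasure_mono[OF carleson_boxes_subset[OF X], of lborel] emeasure_lborel_ball_finite[of "0::complex" 1] by (auto simp: top_unique)
      then have "X \<in> null_sets lborel" using True by (auto simp: measure_def enn2real_eq_0_iff null_sets_def)
      then have "AE z in lborel. z \<notin> X" by (rule AE_not_in)
      then have "nnI u X = 0" unfolding nnI_def by (subst nn_integral_0_iff_AE) (auto elim!: eventually_mono)
      then show ?thesis using True by (simp add: rI_def)
    next
      case False
      then have m: "0 < ?m" by (simp add: zero_less_measure_iff)
      have "rI u X * ?J powr (1/\<tau>) = (rI u X / ?m * (?J powr (1/\<tau>) / ?m powr (1/\<tau>))) * ?m powr (1 + 1/\<tau>)"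
        using m by (simp add: powr_add)
      also have "\<dots> \<le> C * ?m powr (1 + 1/\<tau>)" by (intro mult_right_mono le) auto
      finally show ?thesis .
    qed
    with f1 f2 show "nnI u X < \<infinity> \<and> nnI (\<lambda>z. u z powr (-\<tau>)) X < \<infinity> \<and> rI u X * ?J powr (1/\<tau>) \<le> C * ?m powr (1 + 1/\<tau>)" by blast
  qed
qed

lemma nnI_null:
  assumes [measurable]: "u \<in> borel_measurable borel" "X \<in> sets borel" and pos: "\<And>z. z \<in> X \<Longrightarrow> 0 < u z"
    and z: "nnI u X < \<infinity>" "rI u X = 0"
  shows "nnI h X = 0"
proof -
  have "nnI u X = 0" using z nnI_eq_rI by fastforce
  then have "AE z in lborel. ennreal (u z) * indicator X z = 0"
    unfolding nnI_def by (subst (asm) nn_integral_0_iff_AE) auto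
  then have ae: "AE z in lborel. ennreal (h z) * indicator X z = 0"
  proof eventually_elim
    case (elim z)
    show ?case
    proof (cases "z \<in> X")
      case True
      then have "u z \<le> 0" using elim by (simp add: ennreal_eq_0_iff)
      with pos[OF True] show ?thesis by simp
    qed simp
  qed
  have "nnI h X = (\<integral>\<^sup>+z. 0 \<partial>(lborel :: complex measure))"
    unfolding nnI_def by (rule nn_integral_cong_AE[OF ae])
  then show ?thesis by simp
qed

locale conformal_weight =
  fixes \<psi> :: "complex \<Rightarrow> complex" and \<sigma> :: "complex \<Rightarrow> real"
  assumes hol: "\<psi> holomorphic_on ball 0 1" and inj: "inj_on \<psi> (ball 0 1)"
    and \<sigma>_meas [measurable]: "\<sigma> \<in> borel_measurable borel"
    and \<sigma>_pos: "AE z in lborel. z \<in> \<psi> ` ball 0 1 \<longrightarrow> 0 < \<sigma> z"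
begin

definition u :: "complex \<Rightarrow> real" where "u z = (cmod (deriv \<psi> z))\<^sup>2"

text \<open>\<open>\<sigma>\<close> is positive only almost everywhere.\<close>

definition \<sigma>1 :: "complex \<Rightarrow> real" where "\<sigma>1 z = (if 0 < \<sigma> z then \<sigma> z else 1)"

text \<open>The weight transported to the disc, set to 1 elsewhere so that it is measurable and
  positive on the whole plane.\<close>

definition \<rho> :: "complex \<Rightarrow> real" where "\<rho> z = (if z \<in> ball 0 1 then \<sigma>1 (\<psi> z) else 1)"

lemma \<sigma>1_meas [measurable]: "\<sigma>1 \<in> borel_measurable borel" unfolding \<sigma>1_def by measurable

lemma \<sigma>1_pos: "0 < \<sigma>1 z" by (simp add: \<sigma>1_def)

lemma \<rho>_pos: "0 < \<rho> z" by (simp add: \<rho>_def \<sigma>1_pos)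

lemma \<rho>_meas [measurable]: "\<rho> \<in> borel_measurable borel"
proof -
  have m: "(\<lambda>z. \<sigma>1 (if z \<in> ball 0 1 then \<psi> z else 0)) \<in> borel_measurable borel"
    by (rule measurable_compose[OF holomorphic_extend_borel[OF open_ball hol] \<sigma>1_meas])
  have "(\<lambda>z. if z \<in> ball 0 1 then \<sigma>1 (if z \<in> ball 0 1 then \<psi> z else 0) else 1) \<in> borel_measurable borel"
    by (rule measurable_If_set[OF m]) auto
  also have "(\<lambda>z. if z \<in> ball 0 1 then \<sigma>1 (if z \<in> ball 0 1 then \<psi> z else 0) else 1) = \<rho>"
    by (auto simp: \<rho>_def)
  finally show ?thesis .
qed

lemma u_pos: "z \<in> ball 0 1 \<Longrightarrow> 0 < u z"
  unfolding u_def using holomorphic_injective_imp_regular[OF hol open_ball inj] by simp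

lemma nnI_image:
  assumes "X \<in> sets borel" "X \<subseteq> ball 0 1" "k \<in> borel_measurable borel" "\<And>z. 0 \<le> k z"
  shows "nnI k (\<psi> ` X) = nnI (\<lambda>z. k (\<psi> z) * u z) X"
  unfolding u_def using assms by (intro nnI_holomorphic_image[OF open_ball hol inj]) auto

lemma nnI_image_powr:
  assumes "X \<in> sets borel" "X \<subseteq> ball 0 1"
  shows "nnI (\<lambda>z. \<sigma>1 z powr e) (\<psi> ` X) = nnI (\<lambda>z. \<rho> z powr e * u z) X"
proof -
  have "nnI (\<lambda>z. \<sigma>1 z powr e) (\<psi> ` X) = nnI (\<lambda>z. \<sigma>1 (\<psi> z) powr e * u z) X"
    using assms by (intro nnI_image) auto
  also have "\<dots> = nnI (\<lambda>z. \<rho> z powr e * u z) X"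
    unfolding nnI_def using assms(2) by (intro nn_integral_cong) (auto simp: indicator_def \<rho>_def subset_iff)
  finally show ?thesis .
qed

lemma measure_image:
  assumes "X \<in> sets borel" "X \<subseteq> ball 0 1"
  shows "measure lborel (\<psi> ` X) = rI u X"
  unfolding measure_def emeasure_holomorphic_image[OF open_ball hol inj assms] rI_def nnI_def u_def ..

lemma image_borel: "X \<in> sets borel \<Longrightarrow> X \<subseteq> ball 0 1 \<Longrightarrow> \<psi> ` X \<in> sets borel"
  by (rule inj_holomorphic_image_borel[OF open_ball hol inj])

lemma \<sigma>_AE:
  assumes "X \<subseteq> ball 0 1"
  shows "AE z in lborel. z \<in> \<psi> ` X \<longrightarrow> 0 < \<sigma> z \<and> \<sigma>1 z = \<sigma> z"
  using \<sigma>_pos by eventually_elim (use assms in \<open>auto simp: \<sigma>1_def\<close>)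

text \<open>The change of variables makes every average of \<open>\<sigma>\<close> over the image of
  a box an average of \<open>\<rho>\<close> over the box with respect to \<open>u dA\<close>; this
  is how the measure \<open>u dA\<close> enters the conditions on the disc.\<close>

lemma \<sigma>_image:
  assumes X: "X \<in> sets borel" "X \<subseteq> ball 0 1"
  shows "set_integrable lborel (\<psi> ` X) (\<lambda>z. \<bar>\<sigma> z\<bar> powr e) \<longleftrightarrow> nnI (\<lambda>z. \<rho> z powr e * u z) X < \<infinity>"
    and "set_integrable lborel (\<psi> ` X) (\<lambda>z. \<bar>1 / \<sigma> z\<bar> powr e) \<longleftrightarrow> nnI (\<lambda>z. \<rho> z powr (-e) * u z) X < \<infinity>"
    and "set_integrable lborel (\<psi> ` X) \<sigma> \<longleftrightarrow> nnI (\<lambda>z. \<rho> z * u z) X < \<infinity>"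
    and "wavg e (\<lambda>_. 1) (\<psi> ` X) \<sigma> = rI (\<lambda>z. \<rho> z powr e * u z) X powr (1/e) / rI u X powr (1/e)"
    and "wavg e (\<lambda>_. 1) (\<psi> ` X) (\<lambda>z. 1 / \<sigma> z) = rI (\<lambda>z. \<rho> z powr (-e) * u z) X powr (1/e) / rI u X powr (1/e)"
proof -
  note [measurable] = image_borel[OF X]
  have ae1: "AE z in lborel. z \<in> \<psi> ` X \<longrightarrow> \<bar>\<sigma> z\<bar> powr e = \<sigma>1 z powr e"
    using \<sigma>_AE[OF X(2)] by eventually_elim auto
  have ae2: "AE z in lborel. z \<in> \<psi> ` X \<longrightarrow> \<bar>1 / \<sigma> z\<bar> powr e = \<sigma>1 z powr (-e)"
    using \<sigma>_AE[OF X(2)] by eventually_elim (auto simp: powr_divide powr_minus_divide)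
  have ae3: "AE z in lborel. z \<in> \<psi> ` X \<longrightarrow> \<sigma> z = \<sigma>1 z powr 1 \<and> 0 \<le> \<sigma>1 z powr 1"
    using \<sigma>_AE[OF X(2)] by eventually_elim auto
  have rI_powr: "rI (\<lambda>z. \<sigma>1 z powr e) (\<psi> ` X) = rI (\<lambda>z. \<rho> z powr e * u z) X" for e
    unfolding rI_def nnI_image_powr[OF X] ..
  have "set_integrable lborel (\<psi> ` X) (\<lambda>z. \<bar>\<sigma> z\<bar> powr e) \<longleftrightarrow> nnI (\<lambda>z. \<sigma>1 z powr e) (\<psi> ` X) < \<infinity>"
    by (rule set_integrable_iff_nnI(1)) (use ae1 in \<open>auto elim!: eventually_mono\<close>)
  then show "set_integrable lborel (\<psi> ` X) (\<lambda>z. \<bar>\<sigma> z\<bar> powr e) \<longleftrightarrow> nnI (\<lambda>z. \<rho> z powr e * u z) X < \<infinity>"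
    unfolding nnI_image_powr[OF X] .
  have "set_integrable lborel (\<psi> ` X) (\<lambda>z. \<bar>1 / \<sigma> z\<bar> powr e) \<longleftrightarrow> nnI (\<lambda>z. \<sigma>1 z powr (-e)) (\<psi> ` X) < \<infinity>"
    by (rule set_integrable_iff_nnI(1)) (use ae2 in \<open>auto elim!: eventually_mono\<close>)
  then show "set_integrable lborel (\<psi> ` X) (\<lambda>z. \<bar>1 / \<sigma> z\<bar> powr e) \<longleftrightarrow> nnI (\<lambda>z. \<rho> z powr (-e) * u z) X < \<infinity>"
    unfolding nnI_image_powr[OF X] .
  have "set_integrable lborel (\<psi> ` X) \<sigma> \<longleftrightarrow> nnI (\<lambda>z. \<sigma>1 z powr 1) (\<psi> ` X) < \<infinity>"
    by (rule set_integrable_iff_nnI(1)) (use ae3 in auto)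
  then show "set_integrable lborel (\<psi> ` X) \<sigma> \<longleftrightarrow> nnI (\<lambda>z. \<rho> z * u z) X < \<infinity>"
    unfolding nnI_image_powr[OF X] using \<rho>_pos by (simp add: less_imp_le)
  show "wavg e (\<lambda>_. 1) (\<psi> ` X) \<sigma> = rI (\<lambda>z. \<rho> z powr e * u z) X powr (1/e) / rI u X powr (1/e)"
    unfolding rI_powr[symmetric] measure_image[OF X, symmetric] by (rule wavg_eq[OF _ _ ae1]) measurable
  show "wavg e (\<lambda>_. 1) (\<psi> ` X) (\<lambda>z. 1 / \<sigma> z) = rI (\<lambda>z. \<rho> z powr (-e) * u z) X powr (1/e) / rI u X powr (1/e)"
    unfolding rI_powr[symmetric] measure_image[OF X, symmetric] by (rule wavg_eq[OF _ _ ae2]) measurable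
qed

lemma B_dom_disc:
  assumes B: "B_dom \<psi> P0 \<sigma>" and P0: "1 < P0" and um: "u \<in> borel_measurable borel" and ufin: "\<And>X. X \<in> carleson_boxes \<Longrightarrow> nnI u X < \<infinity>"
  obtains C where "0 < C" "\<forall>X\<in>carleson_boxes. nnI (\<lambda>z. \<rho> z * u z) X < \<infinity> \<and> nnI (\<lambda>z. \<rho> z powr (-1/(P0 - 1)) * u z) X < \<infinity> \<and>
     rI (\<lambda>z. \<rho> z * u z) X * rI (\<lambda>z. \<rho> z powr (-1/(P0 - 1)) * u z) X powr (P0 - 1) \<le> C * rI u X powr P0"
proof -
  define e where "e = 1 / (P0 - 1)"
  have e: "1/e = P0 - 1" "-1/(P0 - 1) = -e" by (auto simp: e_def)
  obtain C where C: "\<And>X. X \<in> carleson_boxes \<Longrightarrow> set_integrable lborel (\<psi> ` X) \<sigma> \<and>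
      set_integrable lborel (\<psi> ` X) (\<lambda>z. \<bar>1 / \<sigma> z\<bar> powr e) \<and> wavg 1 (\<lambda>_. 1) (\<psi> ` X) \<sigma> * wavg e (\<lambda>_. 1) (\<psi> ` X) (\<lambda>z. 1 / \<sigma> z) \<le> C"
    using B P0 unfolding B_dom_def B_cond_def e_def by auto
  show thesis
  proof (rule that[of "max 1 C"]; (intro ballI)?)
    fix X assume X: "X \<in> carleson_boxes"
    note XX = carleson_boxes_borel[OF X] carleson_boxes_subset[OF X]
    let ?c = "rI (\<lambda>z. \<rho> z * u z) X" and ?b = "rI (\<lambda>z. \<rho> z powr (-e) * u z) X" and ?m = "rI u X"
    have f: "nnI (\<lambda>z. \<rho> z * u z) X < \<infinity>" "nnI (\<lambda>z. \<rho> z powr (-e) * u z) X < \<infinity>"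
      using C[OF X] \<sigma>_image(2,3)[OF XX] by blast+
    have w: "wavg 1 (\<lambda>_. 1) (\<psi> ` X) \<sigma> = ?c / ?m" "wavg e (\<lambda>_. 1) (\<psi> ` X) (\<lambda>z. 1 / \<sigma> z) = ?b powr (P0 - 1) / ?m powr (P0 - 1)"
      using \<sigma>_image(4)[OF XX, of 1] \<sigma>_image(5)[OF XX, of e] \<rho>_pos by (simp_all add: e(1) less_imp_le)
    have le: "?c / ?m * (?b powr (P0 - 1) / ?m powr (P0 - 1)) \<le> C" using C[OF X] unfolding w by blast
    have "?c * ?b powr (P0 - 1) \<le> max 1 C * ?m powr P0"
    proof (cases "?m = 0")
      case True
      have "nnI (\<lambda>z. \<rho> z * u z) X = 0"
        using XX u_pos True by (intro nnI_null[OF um _ _ ufin[OF X]]) auto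
      then show ?thesis using True by (simp add: rI_def)
    next
      case False
      then have m: "0 < ?m" using rI_nonneg[of u X] by linarith
      have "?m * ?m powr (P0 - 1) = ?m powr (1 + (P0 - 1))" unfolding powr_add using m by simp
      then have "?c * ?b powr (P0 - 1) = (?c / ?m * (?b powr (P0 - 1) / ?m powr (P0 - 1))) * ?m powr P0"
        using m by (simp add: field_simps)
      also have "\<dots> \<le> max 1 C * ?m powr P0" using le by (intro mult_right_mono) auto
      finally show ?thesis .
    qed
    with f show "nnI (\<lambda>z. \<rho> z * u z) X < \<infinity> \<and> nnI (\<lambda>z. \<rho> z powr (-1/(P0 - 1)) * u z) X < \<infinity> \<and>
     ?c * rI (\<lambda>z. \<rho> z powr (-1/(P0 - 1)) * u z) X powr (P0 - 1) \<le> max 1 C * ?m powr P0" unfolding e(2) by blast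
  qed simp
qed

lemma RH_dom_disc:
  assumes R: "RH_dom \<psi> s \<sigma>" and s: "1 < s" and um: "u \<in> borel_measurable borel" and ufin: "\<And>X. X \<in> carleson_boxes \<Longrightarrow> nnI u X < \<infinity>"
  obtains C where "0 < C" "\<forall>X\<in>carleson_boxes. nnI (\<lambda>z. \<rho> z powr s * u z) X < \<infinity> \<and>
     rI (\<lambda>z. \<rho> z powr s * u z) X \<le> C * (rI (\<lambda>z. \<rho> z * u z) X powr s * rI u X powr (1 - s))"
proof -
  obtain C where C: "\<And>X. X \<in> carleson_boxes \<Longrightarrow> set_integrable lborel (\<psi> ` X) (\<lambda>z. \<bar>\<sigma> z\<bar> powr s) \<and>
      wavg s (\<lambda>_. 1) (\<psi> ` X) \<sigma> \<le> C * wavg 1 (\<lambda>_. 1) (\<psi> ` X) \<sigma>"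
    using R unfolding RH_dom_def RH_cond_def by auto
  \<comment> \<open>A nonpositive \<open>C\<close> would not survive being raised to the power
    \<open>s\<close>.\<close>
  define K where "K = max 1 C"
  show thesis
  proof (rule that[of "K powr s"]; (intro ballI)?)
    show "0 < K powr s" by (simp add: K_def)
    fix X assume X: "X \<in> carleson_boxes"
    note XX = carleson_boxes_borel[OF X] carleson_boxes_subset[OF X]
    let ?c = "rI (\<lambda>z. \<rho> z * u z) X" and ?a = "rI (\<lambda>z. \<rho> z powr s * u z) X" and ?m = "rI u X"
    have f: "nnI (\<lambda>z. \<rho> z powr s * u z) X < \<infinity>" using C[OF X] \<sigma>_image(1)[OF XX] by blast
    have w: "wavg 1 (\<lambda>_. 1) (\<psi> ` X) \<sigma> = ?c / ?m" "wavg s (\<lambda>_. 1) (\<psi> ` X) \<sigma> = ?a powr (1/s) / ?m powr (1/s)"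
      using \<sigma>_image(4)[OF XX, of 1] \<sigma>_image(4)[OF XX, of s] \<rho>_pos by (simp_all add: less_imp_le)
    have le: "?a powr (1/s) / ?m powr (1/s) \<le> C * (?c / ?m)" using C[OF X] unfolding w by blast
    have "?a \<le> K powr s * (?c powr s * ?m powr (1 - s))"
    proof (cases "?m = 0")
      case True
      have "nnI (\<lambda>z. \<rho> z powr s * u z) X = 0"
        using XX u_pos True by (intro nnI_null[OF um _ _ ufin[OF X]]) auto
      then show ?thesis using True by (simp add: rI_def)
    next
      case False
      then have m: "0 < ?m" using rI_nonneg[of u X] by linarith
      have "?a powr (1/s) / ?m powr (1/s) \<le> K * (?c / ?m)"
      proof (rule order_trans[OF le])
        show "C * (?c / ?m) \<le> K * (?c / ?m)" using m by (intro mult_right_mono) (auto simp: K_def)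
      qed
      then have "?a powr (1/s) \<le> K * (?c / ?m) * ?m powr (1/s)" using m by (simp add: pos_divide_le_eq)
      then have "(?a powr (1/s)) powr s \<le> (K * (?c / ?m) * ?m powr (1/s)) powr s" using s by (intro powr_mono2) auto
      then have "?a \<le> K powr s * (?c powr s / ?m powr s) * ?m"
        using s m by (simp add: powr_mult powr_divide powr_powr K_def)
      also have "\<dots> = K powr s * (?c powr s * ?m powr (1 - s))" using m by (simp add: powr_diff)
      finally show ?thesis .
    qed
    with f show "nnI (\<lambda>z. \<rho> z powr s * u z) X < \<infinity> \<and> ?a \<le> K powr s * (?c powr s * ?m powr (1 - s))" by blast
  qed
qed

lemma u_cont: "continuous_on (ball 0 1) u"
  unfolding u_def[abs_def]
  by (intro continuous_intros holomorphic_on_imp_continuous_on holomorphic_deriv hol open_ball)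

lemma u_sub:
  assumes "0 < r" "ball z r \<subseteq> ball 0 1"
  shows "ennreal (pi * r\<^sup>2 * u z) \<le> nnI u (ball z r)"
proof -
  have "(\<lambda>z. (deriv \<psi> z)\<^sup>2) holomorphic_on ball z r"
    using assms(2) by (intro holomorphic_intros holomorphic_on_subset[OF holomorphic_deriv[OF hol open_ball]])
  from area_sub_mean_value[OF this assms(1)] show ?thesis by (simp add: u_def[abs_def] norm_power)
qed

text \<open>By injectivity \<open>deriv \<psi>\<close> has no zeros, hence it has a holomorphic
  logarithm \<open>l\<close> on the disc, and \<open>u powr (-\<tau>)\<close> is the modulus of the
  holomorphic function \<open>exp (-2 * \<tau> * l)\<close>.\<close>

lemma u_neg_sub:
  assumes "0 < r" "ball z r \<subseteq> ball 0 1"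
  shows "ennreal (pi * r\<^sup>2 * u z powr (-\<tau>)) \<le> nnI (\<lambda>z. u z powr (-\<tau>)) (ball z r)"
proof -
  have nz: "deriv \<psi> z \<noteq> 0" if "z \<in> ball 0 1" for z using holomorphic_injective_imp_regular[OF hol open_ball inj that] .
  obtain l where l: "l holomorphic_on ball 0 1" "\<And>z. z \<in> ball 0 1 \<Longrightarrow> deriv \<psi> z = exp (l z)"
    using contractible_imp_holomorphic_log[OF holomorphic_deriv[OF hol open_ball] convex_imp_contractible[OF convex_ball] nz] by metis
  have hl: "(\<lambda>z. exp (- of_real (2 * \<tau>) * l z)) holomorphic_on ball z r"
    by (intro holomorphic_intros holomorphic_on_subset[OF l(1) assms(2)])
  have eq: "u w powr (-\<tau>) = cmod (exp (- of_real (2 * \<tau>) * l w))" if "w \<in> ball 0 1" for w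
  proof -
    have "u w = exp (2 * Re (l w))" using l(2)[OF that] by (simp add: u_def exp_double)
    then show ?thesis by (simp add: exp_powr_real)
  qed
  have z: "z \<in> ball 0 1" using assms centre_in_ball[of z r] by blast
  have "nnI (\<lambda>z. u z powr (-\<tau>)) (ball z r) = nnI (\<lambda>w. cmod (exp (- of_real (2 * \<tau>) * l w))) (ball z r)"
    unfolding nnI_def using eq assms(2) by (intro nn_integral_cong) (auto simp: indicator_def subset_iff)
  then show ?thesis using area_sub_mean_value[OF hl assms(1)] eq[OF z] by simp
qed

end

section \<open>The exponents of the theorem and the passage from the disc to the domain\<close>

theorem theorem3p1:
  fixes \<Omega> :: "complex set" and \<psi> :: "complex \<Rightarrow> complex" and \<sigma> :: "complex \<Rightarrow> real"
    and p0 p :: real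
  assumes "open \<Omega>" and "connected \<Omega>" and "bounded \<Omega>" and "simply_connected \<Omega>"
    and "\<psi> holomorphic_on ball 0 1" and "inj_on \<psi> (ball 0 1)" and "\<psi> ` ball 0 1 = \<Omega>"
    and "1 \<le> p0" and "p0 < 2"
    and "B_disc_plus (p0 / (2 - p0)) (\<lambda>z. (cmod (deriv \<psi> z))\<^sup>2)"
    and "p0 < p" and "p0 = 1 \<or> p < p0 / (p0 - 1)"
    and "is_weight \<Omega> \<sigma>"
    and "if p0 = 1 then B_dom \<psi> p \<sigma>
         else B_dom \<psi> (p / p0) \<sigma> \<and>
              RH_dom \<psi> ((p0 / (p0 - 1)) / (p0 / (p0 - 1) - p)) \<sigma>"
  shows "bergman_bounded \<Omega> p \<sigma>"
proof -
  \<comment> \<open>Working with the reciprocal \<open>\<pi>0 = 1/p0'\<close> keeps the case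
    \<open>p0 = 1\<close> regular: \<open>\<pi>0\<close> is then 0, and \<open>s\<close>, which is
    \<open>p0' / (p0' - p)\<close> otherwise, becomes 1.\<close>
  define \<pi>0 where "\<pi>0 = (p0 - 1) / p0"
  define q where "q = p / (p - 1)"
  define s where "s = 1 / (1 - p * \<pi>0)"
  define P1 where "P1 = (p * (1 - \<pi>0) - 1) / (1 - p * \<pi>0)"
  note p0 = assms(8,9) and \<psi> = assms(5,6)
  have p: "1 < p" "p0 < p" using assms(8,11) by auto
  have pq: "1/p + 1/q = 1" using p by (simp add: q_def field_simps)
  have \<pi>0: "0 \<le> \<pi>0" "\<pi>0 < 1/2" using p0 by (auto simp: \<pi>0_def field_simps)
  have p\<pi>: "p * \<pi>0 < 1"
  proof (cases "p0 = 1")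
    case False
    then have "p < p0 / (p0 - 1)" "0 < p0 - 1" using assms(8,12) by auto
    then have "p * (p0 - 1) < p0" by (simp add: pos_less_divide_eq)
    then show ?thesis using p0 by (simp add: \<pi>0_def)
  qed (simp add: \<pi>0_def)
  have q\<pi>: "q * \<pi>0 < 1"
  proof -
    have "p * (p0 - 1) < (p - 1) * p0" using p by (simp add: algebra_simps)
    then show ?thesis using p p0 by (simp add: q_def \<pi>0_def)
  qed
  have s1: "1 \<le> s" "0 < s" "s * (1 - p * \<pi>0) = 1" using p\<pi> p \<pi>0 by (auto simp: s_def)
  have P0: "1 < p / p0" using p p0 by simp
  have "1 - \<pi>0 = 1 / p0" using p0 by (simp add: \<pi>0_def field_simps)
  \<comment> \<open>This ties the exponent \<open>P1\<close> of the disc estimates to the exponent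
    \<open>p / p0\<close> in the hypothesis on \<open>\<sigma>\<close>.\<close>
  then have P1eq: "P1 = s * (p / p0 - 1)" by (simp add: P1_def s_def)
  then have P1pos: "0 < P1" using s1 P0 by simp
  have \<sigma>: "\<sigma> \<in> borel_measurable borel" "AE z in lborel. z \<in> \<psi> ` ball 0 1 \<longrightarrow> 0 < \<sigma> z"
    using assms(13) unfolding is_weight_def assms(7) by auto
  interpret cw: conformal_weight \<psi> \<sigma> by unfold_locales (use \<psi> \<sigma> in auto)
  have Bu: "is_weight (ball 0 1) cw.u" "B_cond carleson_boxes r cw.u" if "p0 / (2 - p0) < r" for r
    using assms(10) that unfolding B_disc_plus_def B_disc_def cw.u_def[abs_def] by auto
  have um[measurable]: "cw.u \<in> borel_measurable borel"
    using Bu(1)[of "p0 / (2 - p0) + 1"] by (simp add: is_weight_def)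
  have u_box: "\<exists>C. \<forall>X\<in>carleson_boxes. nnI cw.u X < \<infinity> \<and> nnI (\<lambda>z. cw.u z powr (-\<tau>)) X < \<infinity> \<and>
      rI cw.u X * rI (\<lambda>z. cw.u z powr (-\<tau>)) X powr (1/\<tau>) \<le> C * measure lborel X powr (1 + 1/\<tau>)"
    if \<tau>: "0 < \<tau>" "\<tau> * (2 * \<pi>0) < 1 - 2 * \<pi>0" for \<tau>
  proof (rule B_cond_disc[OF Bu(2) \<tau>(1) um cw.u_pos])
    \<comment> \<open>Admissibility of \<open>\<tau>\<close>, multiplied by \<open>p0\<close>. It is
      equivalent to \<open>1 + 1/\<tau> > q0\<close>, so the hypothesis for all exponents beyond
      \<open>q0\<close> applies.\<close>
    have "\<tau> * (2 * (p0 - 1)) < 2 - p0"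
    proof -
      have "\<tau> * (2 * \<pi>0) * p0 < (1 - 2 * \<pi>0) * p0" using \<tau>(2) p0 by (intro mult_strict_right_mono) auto
      moreover have eq: "\<pi>0 * p0 = p0 - 1" using p0 by (simp add: \<pi>0_def)
      have "\<tau> * (2 * \<pi>0) * p0 = \<tau> * (2 * (p0 - 1))" by (simp only: mult.assoc eq)
      moreover have "(1 - 2 * \<pi>0) * p0 = 2 - p0" using eq by (simp add: algebra_simps)
      ultimately show ?thesis by simp
    qed
    then have "2 * (p0 - 1) / (2 - p0) < 1 / \<tau>" using \<tau>(1) p0 by (simp add: field_simps)
    moreover have "p0 / (2 - p0) = 1 + 2 * (p0 - 1) / (2 - p0)" using p0 by (simp add: field_simps)
    ultimately show "p0 / (2 - p0) < 1 + 1/\<tau>" by simp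
  qed auto
  have ufin: "nnI cw.u X < \<infinity>" if "X \<in> carleson_boxes" for X
  proof -
    have "(1 - 2 * \<pi>0) / 2 * (2 * \<pi>0) < 1 - 2 * \<pi>0"
    proof -
      have "(1 - 2 * \<pi>0) * \<pi>0 < (1 - 2 * \<pi>0) * 1" using \<pi>0 by (intro mult_strict_left_mono) auto
      then show ?thesis by simp
    qed
    then show ?thesis using u_box[of "(1 - 2 * \<pi>0) / 2"] \<pi>0 that by auto
  qed
  have B: "B_dom \<psi> (p / p0) \<sigma>" using assms(14) by (cases "p0 = 1") auto
  obtain C1 where C1: "0 < C1" and Bd: "\<forall>X\<in>carleson_boxes. nnI (\<lambda>z. cw.\<rho> z * cw.u z) X < \<infinity> \<and> nnI (\<lambda>z. cw.\<rho> z powr (-1/(p / p0 - 1)) * cw.u z) X < \<infinity> \<and>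
     rI (\<lambda>z. cw.\<rho> z * cw.u z) X * rI (\<lambda>z. cw.\<rho> z powr (-1/(p / p0 - 1)) * cw.u z) X powr (p / p0 - 1) \<le> C1 * rI cw.u X powr (p / p0)"
    using cw.B_dom_disc[OF B P0 um ufin] .
  have "\<exists>C>0. \<forall>X\<in>carleson_boxes. nnI (\<lambda>z. cw.\<rho> z powr s * cw.u z) X < \<infinity> \<and>
     rI (\<lambda>z. cw.\<rho> z powr s * cw.u z) X \<le> C * (rI (\<lambda>z. cw.\<rho> z * cw.u z) X powr s * rI cw.u X powr (1 - s))"
  \<comment> \<open>For \<open>p0 = 1\<close> one has \<open>s = 1\<close> and both sides agree,
    except that \<open>0 powr 0 = 0\<close> requires boxes of zero \<open>u\<close>-mass to be
    looked at separately.\<close>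
  proof (cases "p0 = 1")
    case True
    then have s: "s = 1" by (simp add: s_def \<pi>0_def)
    have eq: "(\<lambda>z. cw.\<rho> z powr s * cw.u z) = (\<lambda>z. cw.\<rho> z * cw.u z)" using cw.\<rho>_pos by (simp add: s less_imp_le)
    show ?thesis unfolding eq
    proof (intro exI[of _ 1] conjI ballI)
      fix X assume X: "X \<in> carleson_boxes"
      show "nnI (\<lambda>z. cw.\<rho> z * cw.u z) X < \<infinity>" using Bd X by blast
      show "rI (\<lambda>z. cw.\<rho> z * cw.u z) X \<le> 1 * (rI (\<lambda>z. cw.\<rho> z * cw.u z) X powr s * rI cw.u X powr (1 - s))"
      proof (cases "rI cw.u X = 0")
        case True
        have "nnI (\<lambda>z. cw.\<rho> z * cw.u z) X = 0"
          using carleson_boxes_borel[OF X] carleson_boxes_subset[OF X] cw.u_pos True by (intro nnI_null[OF um _ _ ufin[OF X]]) auto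
        then show ?thesis by (simp add: rI_def)
      qed (simp add: s)
    qed simp
  next
    case False
    have "(p0 / (p0 - 1)) / (p0 / (p0 - 1) - p) = s"
    proof -
      define c where "c = p0 / (p0 - 1)"
      have c: "0 < c" "\<pi>0 = 1 / c" using False p0 by (simp_all add: c_def \<pi>0_def)
      have "1 - p * \<pi>0 = (c - p) / c" using c by (simp add: diff_divide_distrib)
      then show ?thesis by (simp add: s_def c_def)
    qed
    then have R: "RH_dom \<psi> s \<sigma>" using assms(14) False by simp
    have "0 < \<pi>0" using False p0 by (simp add: \<pi>0_def)
    then have "0 < p * \<pi>0" using p by simp
    then have s: "1 < s" using p\<pi> by (simp add: s_def)
    show ?thesis using cw.RH_dom_disc[OF R s um ufin] by blast
  qed
  then obtain C2 where C2: "0 < C2" and Rd: "\<forall>X\<in>carleson_boxes. nnI (\<lambda>z. cw.\<rho> z powr s * cw.u z) X < \<infinity> \<and>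
     rI (\<lambda>z. cw.\<rho> z powr s * cw.u z) X \<le> C2 * (rI (\<lambda>z. cw.\<rho> z * cw.u z) X powr s * rI cw.u X powr (1 - s))" by blast
  define g where "g z = cw.\<rho> z powr s" for z
  have gpos: "0 < g z" for z using cw.\<rho>_pos[of z] by (simp add: g_def)
  have gm[measurable]: "g \<in> borel_measurable borel" unfolding g_def by measurable
  have "s * (-1/P1) = -1/(p / p0 - 1)" using s1 P0 by (simp add: P1eq)
  then have gdual: "g z powr (-1/P1) = cw.\<rho> z powr (-1/(p / p0 - 1))" for z by (simp add: g_def powr_powr)
  \<comment> \<open>The reverse Hoelder condition replaces the integral of
    \<open>\<rho> powr s\<close> by the \<open>s\<close>-th power of that of \<open>\<rho>\<close>,
    and the \<open>s\<close>-th power of the Bekolle condition finishes: the exponents of the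
    \<open>u\<close>-mass add up to \<open>1 - s + s * p / p0 = 1 + P1\<close>.\<close>
  have g_box: "\<exists>C. \<forall>X\<in>carleson_boxes. nnI (\<lambda>z. g z * cw.u z) X < \<infinity> \<and> nnI (\<lambda>z. g z powr (-1/P1) * cw.u z) X < \<infinity> \<and>
          rI (\<lambda>z. g z * cw.u z) X * rI (\<lambda>z. g z powr (-1/P1) * cw.u z) X powr P1 \<le> C * rI cw.u X powr (1 + P1)"
  proof (intro exI[of _ "C2 * C1 powr s"] ballI)
    fix X assume X: "X \<in> carleson_boxes"
    let ?a = "rI (\<lambda>z. g z * cw.u z) X" and ?b = "rI (\<lambda>z. g z powr (-1/P1) * cw.u z) X" and ?c = "rI (\<lambda>z. cw.\<rho> z * cw.u z) X" and ?m = "rI cw.u X"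
    have fin1: "nnI (\<lambda>z. g z * cw.u z) X < \<infinity>" using Rd X unfolding g_def by blast
    have fin2: "nnI (\<lambda>z. g z powr (-1/P1) * cw.u z) X < \<infinity>" using Bd X unfolding gdual by blast
    have le1: "?c * ?b powr (p / p0 - 1) \<le> C1 * ?m powr (p / p0)" using Bd X unfolding gdual by blast
    have le2: "?a \<le> C2 * (?c powr s * ?m powr (1 - s))" using Rd X unfolding g_def by blast
    have "?a * ?b powr P1 \<le> C2 * (?c powr s * ?m powr (1 - s)) * ?b powr P1" using le2 by (intro mult_right_mono) auto
    also have "\<dots> = C2 * (?c powr s * ?m powr (1 - s)) * (?b powr (p / p0 - 1)) powr s"
      by (simp add: powr_powr P1eq mult.commute)
    also have "\<dots> = C2 * ?m powr (1 - s) * (?c * ?b powr (p / p0 - 1)) powr s"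
      by (simp add: powr_mult mult_ac)
    also have "\<dots> \<le> C2 * ?m powr (1 - s) * (C1 * ?m powr (p / p0)) powr s"
      using le1 C2 s1 by (intro mult_left_mono powr_mono2) auto
    also have "\<dots> = C2 * C1 powr s * (?m powr (1 - s) * ?m powr (p / p0 * s))"
      using C1 by (simp add: powr_mult powr_powr mult_ac)
    also have "?m powr (1 - s) * ?m powr (p / p0 * s) = ?m powr (1 + P1)"
      unfolding powr_add[symmetric] by (simp add: P1eq algebra_simps)
    finally show "nnI (\<lambda>z. g z * cw.u z) X < \<infinity> \<and> nnI (\<lambda>z. g z powr (-1/P1) * cw.u z) X < \<infinity> \<and> ?a * ?b powr P1 \<le> C2 * C1 powr s * ?m powr (1 + P1)"
      using fin1 fin2 by blast
  qed
  interpret dw: disc_weight cw.u g \<pi>0 p q P1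
  proof unfold_locales
    show "ennreal (pi * r\<^sup>2 * cw.u z) \<le> nnI cw.u (ball z r)" if "0 < r" "ball z r \<subseteq> ball 0 1" for z r
      using that by (rule cw.u_sub)
    show "ennreal (pi * r\<^sup>2 * cw.u z powr (-\<tau>)) \<le> nnI (\<lambda>z. cw.u z powr (-\<tau>)) (ball z r)" if "0 < \<tau>" "0 < r" "ball z r \<subseteq> ball 0 1" for z r \<tau>
      using that(2,3) by (rule cw.u_neg_sub)
  qed (use p pq \<pi>0 p\<pi> q\<pi> P1_def um gm cw.u_pos gpos cw.u_cont u_box g_box in \<open>simp_all\<close>)
  obtain K where K: "0 < K" and bound:
    "\<forall>F G. F \<in> borel_measurable borel \<longrightarrow> G \<in> borel_measurable borel \<longrightarrow> (\<forall>z. 0 \<le> F z) \<longrightarrow> (\<forall>z. 0 \<le> G z) \<longrightarrow>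
      (\<forall>a\<in>ball 0 1. ennreal (G a) \<le> (\<integral>\<^sup>+z\<in>ball 0 1. ennreal (F z / (cmod (1 - cnj a * z))\<^sup>2) \<partial>lborel)) \<longrightarrow>
      nnI (\<lambda>z. F z powr p * dw.wt z) (ball 0 1) < \<infinity> \<longrightarrow>
      nnI (\<lambda>z. G z powr p * dw.wt z) (ball 0 1) \<le> ennreal K * nnI (\<lambda>z. F z powr p * dw.wt z) (ball 0 1)"
    using dw.disc_operator_bounded .
  \<comment> \<open>The modulus of the pullback \<open>(f \<circ> \<psi>) * deriv \<psi>\<close>,
    cut off outside the disc for measurability.\<close>
  define pull where "pull f z = cmod (indicator (ball 0 1) z *\<^sub>R f (\<psi> z)) * cmod (indicator (ball 0 1) z *\<^sub>R deriv \<psi> z)" for f :: "complex \<Rightarrow> complex" and z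
  define k where "k f w = cmod (f w) powr p * cw.\<sigma>1 w" for f :: "complex \<Rightarrow> complex" and w
  have pull_nonneg: "0 \<le> pull f z" for f z by (simp add: pull_def)
  have k0: "0 \<le> k f w" for f w using cw.\<sigma>1_pos[of w] by (simp add: k_def)
  have km: "k f \<in> borel_measurable borel" if [measurable]: "f \<in> borel_measurable borel" for f
    unfolding k_def by measurable
  have pull_meas: "pull f \<in> borel_measurable borel" if "f \<in> borel_measurable borel" for f
  proof -
    have [measurable]: "(\<lambda>z. indicator (ball 0 1) z *\<^sub>R f (\<psi> z)) \<in> borel_measurable borel"
      by (rule borel_compose_holomorphic[OF open_ball \<psi>(1) that])
    have [measurable]: "(\<lambda>z. indicator (ball 0 1) z *\<^sub>R deriv \<psi> z) \<in> borel_measurable borel"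
      using borel_compose_holomorphic[OF open_ball holomorphic_deriv[OF \<psi>(1) open_ball], of "\<lambda>z. z"] by simp
    show ?thesis unfolding pull_def by measurable
  qed
  \<comment> \<open>The reason for the exponent \<open>1 - p/2\<close> of \<open>u\<close> in the
    disc weight: \<open>cmod (deriv \<psi>) powr p\<close> supplies \<open>u powr (p/2)\<close>, and
    together they give the Jacobian \<open>u\<close>, so the pullback preserves weighted
    norms.\<close>
  have pull_eq: "nnI (\<lambda>z. pull f z powr p * dw.wt z) (ball 0 1) = nnI (k f) \<Omega>" if f: "f \<in> borel_measurable borel" for f
  proof -
    have "nnI (\<lambda>z. pull f z powr p * dw.wt z) (ball 0 1) = nnI (\<lambda>z. k f (\<psi> z) * cw.u z) (ball 0 1)"
      unfolding nnI_def
    proof (intro nn_integral_cong)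
      fix z
      show "ennreal (pull f z powr p * dw.wt z) * indicator (ball 0 1) z = ennreal (k f (\<psi> z) * cw.u z) * indicator (ball 0 1) z"
      proof (cases "z \<in> ball 0 1")
        case True
        note upos = cw.u_pos[OF True]
        have "cmod (deriv \<psi> z) powr p = cw.u z powr (p/2)"
          unfolding cw.u_def by (simp add: powr_powr flip: powr_numeral)
        moreover have "cw.u z powr (p/2) * cw.u z powr (1 - p/2) = cw.u z"
          unfolding powr_add[symmetric] using upos by simp
        moreover have "g z powr (1 - p * \<pi>0) = cw.\<sigma>1 (\<psi> z)"
          using True s1(3) cw.\<sigma>1_pos[of "\<psi> z"] by (simp add: g_def powr_powr cw.\<rho>_def less_imp_le)
        ultimately have "pull f z powr p * dw.wt z = k f (\<psi> z) * cw.u z"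
          using True by (simp add: pull_def dw.wt_def k_def powr_mult mult_ac)
        then show ?thesis by simp
      qed simp
    qed
    also have "\<dots> = nnI (k f) \<Omega>"
      unfolding assms(7)[symmetric] by (rule cw.nnI_image[symmetric]) (use km[OF f] k0 in auto)
    finally show ?thesis .
  qed
  have Lp: "set_integrable lborel \<Omega> (\<lambda>z. cmod (f z) powr p * \<sigma> z) \<longleftrightarrow> nnI (k f) \<Omega> < \<infinity>"
    "(LINT z:\<Omega>|lborel. cmod (f z) powr p * \<sigma> z) = rI (k f) \<Omega>" if f[measurable]: "f \<in> borel_measurable borel" for f
  proof -
    have ae: "AE z in lborel. z \<in> \<Omega> \<longrightarrow> cmod (f z) powr p * \<sigma> z = k f z \<and> 0 \<le> k f z"
      using cw.\<sigma>_AE[of "ball 0 1"] unfolding assms(7) by (auto elim!: eventually_mono simp: k_def)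
    have m: "(\<lambda>z. cmod (f z) powr p * \<sigma> z) \<in> borel_measurable borel" by measurable
    have \<Omega>b: "\<Omega> \<in> sets borel" using assms(1) by simp
    show "set_integrable lborel \<Omega> (\<lambda>z. cmod (f z) powr p * \<sigma> z) \<longleftrightarrow> nnI (k f) \<Omega> < \<infinity>"
      "(LINT z:\<Omega>|lborel. cmod (f z) powr p * \<sigma> z) = rI (k f) \<Omega>"
      using set_integrable_iff_nnI[OF m \<Omega>b ae] by auto
  qed
  show ?thesis unfolding bergman_bounded_def
  proof (intro exI[of _ "K powr (1/p)"] allI impI)
    fix f h assume a: "in_Lp \<Omega> 2 (\<lambda>_. 1) f \<and> in_Lp \<Omega> p \<sigma> f \<and> is_bergman_proj \<Omega> f h"
    have fm: "f \<in> borel_measurable borel" and hm: "h \<in> borel_measurable borel"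
      using a by (auto simp: in_Lp_def is_bergman_proj_def bergman_space_def)
    have ffin: "nnI (k f) \<Omega> < \<infinity>" using a Lp(1)[OF fm] by (simp add: in_Lp_def)
    have "nnI (\<lambda>z. pull h z powr p * dw.wt z) (ball 0 1) \<le> ennreal K * nnI (\<lambda>z. pull f z powr p * dw.wt z) (ball 0 1)"
    proof (rule bound[rule_format])
      fix b :: complex assume b: "b \<in> ball 0 1"
      have "ennreal (pull h b) = ennreal (cmod (h (\<psi> b)) * cmod (deriv \<psi> b))" using b by (simp add: pull_def)
      also have "\<dots> \<le> (\<integral>\<^sup>+z\<in>ball 0 1. ennreal (cmod (f (\<psi> z)) * cmod (deriv \<psi> z) / (cmod (1 - cnj b * z))\<^sup>2) \<partial>lborel)"
        using a b unfolding assms(7)[symmetric] by (intro bergman_proj_pointwise \<psi>) auto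
      also have "\<dots> = (\<integral>\<^sup>+z\<in>ball 0 1. ennreal (pull f z / (cmod (1 - cnj b * z))\<^sup>2) \<partial>lborel)"
        by (intro nn_integral_cong) (auto simp: pull_def indicator_def)
      finally show "ennreal (pull h b) \<le> (\<integral>\<^sup>+z\<in>ball 0 1. ennreal (pull f z / (cmod (1 - cnj b * z))\<^sup>2) \<partial>lborel)" .
    next
      show "nnI (\<lambda>z. pull f z powr p * dw.wt z) (ball 0 1) < \<infinity>" using ffin by (simp add: pull_eq[OF fm])
    qed (use pull_meas fm hm pull_nonneg in auto)
    then have le: "nnI (k h) \<Omega> \<le> ennreal K * nnI (k f) \<Omega>" unfolding pull_eq[OF fm] pull_eq[OF hm] .
    also have "\<dots> = ennreal (K * rI (k f) \<Omega>)" using nnI_eq_rI[OF ffin] K by (simp add: ennreal_mult)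
    finally have le': "nnI (k h) \<Omega> \<le> ennreal (K * rI (k f) \<Omega>)" .
    then have hfin: "nnI (k h) \<Omega> < \<infinity>" by (rule order.strict_trans1) simp
    have "rI (k h) \<Omega> \<le> K * rI (k f) \<Omega>" using le' unfolding nnI_eq_rI[OF hfin] using K by simp
    then have "rI (k h) \<Omega> powr (1/p) \<le> (K * rI (k f) \<Omega>) powr (1/p)" using p by (intro powr_mono2) auto
    also have "\<dots> = K powr (1/p) * rI (k f) \<Omega> powr (1/p)" using K by (simp add: powr_mult)
    finally have "Lp_norm \<Omega> p \<sigma> h \<le> K powr (1/p) * Lp_norm \<Omega> p \<sigma> f"
      unfolding Lp_norm_def Lp(2)[OF fm] Lp(2)[OF hm] .
    moreover have "in_Lp \<Omega> p \<sigma> h" unfolding in_Lp_def using hm Lp(1)[OF hm] hfin by simp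
    ultimately show "in_Lp \<Omega> p \<sigma> h \<and> Lp_norm \<Omega> p \<sigma> h \<le> K powr (1/p) * Lp_norm \<Omega> p \<sigma> f" by blast
  qed
qed

end
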